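(* Let $\Omega=[a,b]$ with partition $a=x_0<x_1<\dots<x_m=b$, $\Omega_j=(x_{j-1},x_j)$, $m\ge 1$, and let $p,q,w$ be complex-valued functions on $\Omega$, extended periodically to $\mathbb{R}$ with period $\ell=b-a$. Assume: (1) for every $j\in\{1,\dots,m\}$: $p,w\in W^{2,\infty}(\Omega_j)$, $\inf_{x\in\overline{\Omega_j}}|p(x)|>0$ and $\inf_{x\in\overline{\Omega_j}}|w(x)|>0$; (2) $w/p=r^2$ on $\Omega$ for some $r:\Omega\to(0,\infty)$ (also extended $\ell$-periodically); (3) $q\in L^\infty(\Omega)$; (4) $(p\,r)(x_j^+)+(p\,r)(x_j^-)\neq 0$ for every $j\in\{1,\dots,m\}$. Let $\varphi\in\mathbb{R}$, and call $\lambda\in\mathbb{C}$ an eigenvalue if there is a nontrivial solution $y$ of $-(p\,y')'+q\,y=\lambda\,w\,y$ on $\Omega$ whose state vector $Y=(y,py')^{T}$ satisfies $Y(b^+)=e^{i\varphi}Y(a^+)$. With $\tilde\ell_j,\tilde\ell,V_j,\rho_0,\alpha_j,\beta_j,\Gamma_m$ as defined in the context, set $$\tilde c:=\max_{1\le j\le m}\big\{|\alpha_j|,|\alpha_j|^{-1}\big\},$$ $$\tilde d:=\max_{1\le j\le m}\Big\{|\beta_j|+2\max\big\{|\alpha_j|,|\alpha_j|^{-1},|\beta_j|/\rho_0\big\}\Big(4\tilde\ell_jV_j+\frac{1}{\sqrt2\,e\,\tilde\ell_j}\Big)\Big\}.$$ Then every eigenvalue $\lambda=-\kappa^2$ with $\operatorname{Re}(\lambda)<0$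 satisfies $$|\kappa|\le\sqrt2\,\max\Big\{\rho_0,\ \ \frac{2\rho_0}{|\Gamma_m|}\Big[\big(\tilde c+\tilde d/\rho_0\big)^m-\tilde c^{\,m}\Big],\ \ \frac{1}{\tilde\ell}\ln\frac{4}{|\Gamma_m|}\Big\}.$$
   Context: A solution of $-(py')'+qy=\lambda wy$ on $\Omega$ is a function $y$ with $y,\,py'\in AC(\Omega)$ (absolutely continuous on $[a,b]$) satisfying the equation almost everywhere on $\Omega$. The state vector $Y=(y,py')^T$ is therefore continuous across each interface, $Y(x_j^+)=Y(x_j^-)$ for $j=1,\dots,m$; in particular, at $x_m=b$, $Y(b^+)=Y(b^-)$, so the boundary condition relates the value of $Y$ at $b$ to its value at $a$. $f(x^\pm)$ denotes the one-sided limits of $f$ at $x$. All interface values of $p,r$ and their derivatives are one-sided limits (these exist because $p,r\in W^{2,\infty}(\Omega_j)$). At $j=m$ the limit from the right is taken via the $\ell$-periodic extension, i.e. as the right limit at $a$. $W^{2,\infty}(I)$ is the Sobolev space of functions on the open interval $I$ with weak derivatives up to order 2 in $L^\infty(I)$ (identified with their continuous representatives on $\overline I$). For $\operatorname{Re}(\lambda)<0$, $\kappa=(-\lambda)^{1/2}$ is taken with the branch $\operatorname{Re}(\kappa)>0$. Constants, for $j\in\{1,\dots,m\}$: $$\tilde\ell_j:=\int_{\Omega_j}r(s)\,ds,\qquad \tilde\ell:=\sum_{j=1}^m\tilde\ell_j,$$ $$v_j:=\frac1{r^2}\Big[\frac qp+\frac12\frac{p''}{p}-\frac14\Big(\frac{p'}{p}\Big)^2+\frac12\frac{r''}{r}-\frac34\Big(\frac{r'}{r}\Big)^2\Big]\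 \text{ on }\Omega_j,\qquad V_j:=\|v_j\|_{L^\infty(\Omega_j)},$$ $$\rho_0:=2\max_{1\le j\le m}\{\tilde\ell_jV_j\}.$$ Let $\sigma:=(pr)^{1/2}$, where on each subinterval $\Omega_j$ a (continuous) branch of the square root is fixed, and $\sigma$ is extended $\ell$-periodically. Then $$\alpha_j:=\frac{\sigma(x_j^+)}{\sigma(x_j^-)},\qquad \beta_j:=\frac12\,\frac{\dfrac{(pr)'(x_j^+)}{r(x_j^+)}-\dfrac{(pr)'(x_j^-)}{r(x_j^-)}}{\sigma(x_j^+)\,\sigma(x_j^-)},$$ $$\Gamma_m:=\prod_{j=1}^m\frac12\big(\alpha_j+\alpha_j^{-1}\big),$$ which is nonzero by hypothesis (4). In the formula for $\tilde d$, $e$ is Euler's number. *)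

theory Defs
  imports "HOL-Probability.Essential_Supremum"
begin

section \<open>Function spaces on the line\<close>

definition Linf :: "real set \<Rightarrow> (real \<Rightarrow> 'a::real_normed_vector) set" where
  "Linf I = {f. f \<in> borel_measurable (lebesgue_on I) \<and>
                esssup (lebesgue_on I) (\<lambda>t. ereal (norm (f t))) < \<infinity>}"

(* meaningful for f \<in> Linf I only: real_of_ereal sends \<infinity> to 0 *)
definition Linf_norm :: "real set \<Rightarrow> (real \<Rightarrow> 'a::real_normed_vector) \<Rightarrow> real" where
  "Linf_norm I f = real_of_ereal (esssup (lebesgue_on I) (\<lambda>t. ereal (norm (f t))))"

definition test_functions :: "real set \<Rightarrow> (real \<Rightarrow> real) set" where
  "test_functions I = {\<phi>. (\<forall>n t. ((deriv ^^ n) \<phi>) differentiable (at t)) \<and>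
                          (\<exists>K. compact K \<and> K \<subseteq> I \<and> (\<forall>t. t \<notin> K \<longrightarrow> \<phi> t = 0))}"

definition is_weak_deriv ::
    "nat \<Rightarrow> real set \<Rightarrow> (real \<Rightarrow> 'a::{banach, second_countable_topology}) \<Rightarrow> (real \<Rightarrow> 'a) \<Rightarrow> bool" where
  "is_weak_deriv n I f g \<longleftrightarrow>
     (\<forall>\<phi>\<in>test_functions I.
        (LINT t|lebesgue_on I. ((deriv ^^ n) \<phi> t) *\<^sub>R f t)
          = (- 1) ^ n *\<^sub>R (LINT t|lebesgue_on I. \<phi> t *\<^sub>R g t))"

(* I is meant to be a bounded open interval.  Elements are the continuous representatives,
   so that pointwise values, one-sided limits and classical first derivatives make sense. *)
definition W2inf :: "real set \<Rightarrow> (real \<Rightarrow> 'a::{banach, second_countable_topology}) set" where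
  "W2inf I = {f. continuous_on I f \<and> f \<in> Linf I \<and>
                 (\<exists>g\<in>Linf I. is_weak_deriv 1 I f g) \<and>
                 (\<exists>g\<in>Linf I. is_weak_deriv 2 I f g)}"

(* determined up to a null set, which is harmless under Linf_norm *)
definition weak_deriv ::
    "nat \<Rightarrow> real set \<Rightarrow> (real \<Rightarrow> 'a::{banach, second_countable_topology}) \<Rightarrow> real \<Rightarrow> 'a" where
  "weak_deriv n I f = (SOME g. g \<in> Linf I \<and> is_weak_deriv n I f g)"

(* D is a finite family of intervals [s, t], given by their end points,
   with pairwise disjoint interiors *)
definition abs_continuous_on :: "real \<Rightarrow> real \<Rightarrow> (real \<Rightarrow> 'a::real_normed_vector) \<Rightarrow> bool" where
  "abs_continuous_on a b f \<longleftrightarrow>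
     (\<forall>\<epsilon>>0. \<exists>\<delta>>0. \<forall>D. finite D \<longrightarrow>
        (\<forall>(s, t)\<in>D. a \<le> s \<and> s < t \<and> t \<le> b) \<longrightarrow>
        pairwise (\<lambda>(s, t) (s', t'). {s<..<t} \<inter> {s'<..<t'} = {}) D \<longrightarrow>
        (\<Sum>(s, t)\<in>D. t - s) < \<delta> \<longrightarrow>
        (\<Sum>(s, t)\<in>D. norm (f t - f s)) < \<epsilon>)"


section \<open>The eigenvalue problem\<close>

(* u is the quasi-derivative p y', i.e. the representative of p y' that is absolutely continuous *)
definition is_solution ::
    "real \<Rightarrow> real \<Rightarrow> (real \<Rightarrow> complex) \<Rightarrow> (real \<Rightarrow> complex) \<Rightarrow> (real \<Rightarrow> complex) \<Rightarrow> complex \<Rightarrow>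
     (real \<Rightarrow> complex) \<Rightarrow> (real \<Rightarrow> complex) \<Rightarrow> bool" where
  "is_solution a b p q w lam y u \<longleftrightarrow>
     abs_continuous_on a b y \<and> abs_continuous_on a b u \<and>
     (AE t in lebesgue_on {a..b}. \<exists>y' u'.
        (y has_vector_derivative y') (at t) \<and> u t = p t * y' \<and>
        (u has_vector_derivative u') (at t) \<and> - u' + q t * y t = lam * w t * y t)"

(* The state (y, u) is continuous, so its one-sided limits at a and b are its values there. *)
definition is_eigenvalue ::
    "real \<Rightarrow> real \<Rightarrow> (real \<Rightarrow> complex) \<Rightarrow> (real \<Rightarrow> complex) \<Rightarrow> (real \<Rightarrow> complex) \<Rightarrow> real \<Rightarrow>
     complex \<Rightarrow> bool" where
  "is_eigenvalue a b p q w \<phi> lam \<longleftrightarrow>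
     (\<exists>y u. is_solution a b p q w lam y u \<and> (\<exists>t\<in>{a..b}. y t \<noteq> 0) \<and>
            y b = exp (\<i> * of_real \<phi>) * y a \<and> u b = exp (\<i> * of_real \<phi>) * u a)"


section \<open>Partition and one-sided limits\<close>

(* The partition is x 0 < x 1 < ... < x m. *)
definition cell :: "(nat \<Rightarrow> real) \<Rightarrow> nat \<Rightarrow> real set" where
  "cell x j = {x (j - 1)<..<x j}"

definition lim_minus :: "(nat \<Rightarrow> real) \<Rightarrow> nat \<Rightarrow> (real \<Rightarrow> 'a::t2_space) \<Rightarrow> 'a" where
  "lim_minus x j f = Lim (at_left (x j)) f"

(* Periodic extension: the limit from the right at x m is the limit from the right at x 0. *)
definition lim_plus :: "nat \<Rightarrow> (nat \<Rightarrow> real) \<Rightarrow> nat \<Rightarrow> (real \<Rightarrow> 'a::t2_space) \<Rightarrow> 'a" where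
  "lim_plus m x j f = Lim (at_right (if j = m then x 0 else x j)) f"


section \<open>The constants\<close>

definition pr :: "(real \<Rightarrow> complex) \<Rightarrow> (real \<Rightarrow> real) \<Rightarrow> real \<Rightarrow> complex" where
  "pr p r t = p t * of_real (r t)"

definition ell_tilde_j :: "(nat \<Rightarrow> real) \<Rightarrow> (real \<Rightarrow> real) \<Rightarrow> nat \<Rightarrow> real" where
  "ell_tilde_j x r j = (LINT s|lebesgue_on (cell x j). r s)"

definition ell_tilde :: "nat \<Rightarrow> (nat \<Rightarrow> real) \<Rightarrow> (real \<Rightarrow> real) \<Rightarrow> real" where
  "ell_tilde m x r = (\<Sum>j=1..m. ell_tilde_j x r j)"

definition v_fun ::
    "(nat \<Rightarrow> real) \<Rightarrow> (real \<Rightarrow> complex) \<Rightarrow> (real \<Rightarrow> complex) \<Rightarrow> (real \<Rightarrow> real) \<Rightarrow> nat \<Rightarrow>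
     real \<Rightarrow> complex" where
  "v_fun x p q r j t =
     (let p1 = weak_deriv 1 (cell x j) p t; p2 = weak_deriv 2 (cell x j) p t;
          r0 = complex_of_real (r t);
          r1 = complex_of_real (weak_deriv 1 (cell x j) r t);
          r2 = complex_of_real (weak_deriv 2 (cell x j) r t)
      in 1 / r0 ^ 2 * (q t / p t + 1/2 * (p2 / p t) - 1/4 * (p1 / p t) ^ 2
                        + 1/2 * (r2 / r0) - 3/4 * (r1 / r0) ^ 2))"

definition V_const ::
    "(nat \<Rightarrow> real) \<Rightarrow> (real \<Rightarrow> complex) \<Rightarrow> (real \<Rightarrow> complex) \<Rightarrow> (real \<Rightarrow> real) \<Rightarrow> nat \<Rightarrow> real" where
  "V_const x p q r j = Linf_norm (cell x j) (v_fun x p q r j)"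

definition rho0 ::
    "nat \<Rightarrow> (nat \<Rightarrow> real) \<Rightarrow> (real \<Rightarrow> complex) \<Rightarrow> (real \<Rightarrow> complex) \<Rightarrow> (real \<Rightarrow> real) \<Rightarrow> real" where
  "rho0 m x p q r = 2 * Max ((\<lambda>j. ell_tilde_j x r j * V_const x p q r j) ` {1..m})"

definition alpha :: "nat \<Rightarrow> (nat \<Rightarrow> real) \<Rightarrow> (real \<Rightarrow> complex) \<Rightarrow> nat \<Rightarrow> complex" where
  "alpha m x \<sigma> j = lim_plus m x j \<sigma> / lim_minus x j \<sigma>"

definition beta ::
    "nat \<Rightarrow> (nat \<Rightarrow> real) \<Rightarrow> (real \<Rightarrow> complex) \<Rightarrow> (real \<Rightarrow> real) \<Rightarrow> (real \<Rightarrow> complex) \<Rightarrow>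
     nat \<Rightarrow> complex" where
  "beta m x p r \<sigma> j =
     1/2 * ((lim_plus m x j (\<lambda>t. vector_derivative (pr p r) (at t)) / of_real (lim_plus m x j r)
             - lim_minus x j (\<lambda>t. vector_derivative (pr p r) (at t)) / of_real (lim_minus x j r))
            / (lim_plus m x j \<sigma> * lim_minus x j \<sigma>))"

definition Gamma_const :: "nat \<Rightarrow> (nat \<Rightarrow> real) \<Rightarrow> (real \<Rightarrow> complex) \<Rightarrow> complex" where
  "Gamma_const m x \<sigma> = (\<Prod>j=1..m. 1/2 * (alpha m x \<sigma> j + inverse (alpha m x \<sigma> j)))"

definition c_tilde :: "nat \<Rightarrow> (nat \<Rightarrow> real) \<Rightarrow> (real \<Rightarrow> complex) \<Rightarrow> real" where
  "c_tilde m x \<sigma> =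
     Max ((\<lambda>j. max (cmod (alpha m x \<sigma> j)) (inverse (cmod (alpha m x \<sigma> j)))) ` {1..m})"

definition d_tilde ::
    "nat \<Rightarrow> (nat \<Rightarrow> real) \<Rightarrow> (real \<Rightarrow> complex) \<Rightarrow> (real \<Rightarrow> complex) \<Rightarrow> (real \<Rightarrow> real) \<Rightarrow>
     (real \<Rightarrow> complex) \<Rightarrow> real" where
  "d_tilde m x p q r \<sigma> =
     Max ((\<lambda>j. cmod (beta m x p r \<sigma> j)
        + 2 * max (max (cmod (alpha m x \<sigma> j)) (inverse (cmod (alpha m x \<sigma> j))))
                  (cmod (beta m x p r \<sigma> j) / rho0 m x p q r)
            * (4 * ell_tilde_j x r j * V_const x p q r j
               + 1 / (sqrt 2 * exp 1 * ell_tilde_j x r j))) ` {1..m})"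

end

theory Submission
  imports Defs
begin

text \<open>
  The bound compares two evaluations of the trace of the monodromy matrix.

  On a cell put \<open>z = \<sigma> y\<close> and measure length by \<open>r dt\<close>.  Since \<open>\<sigma>\<^sup>2 = p r\<close> and
  \<open>w = p r\<^sup>2\<close>, the equation with \<open>\<lambda> = - \<kappa>\<^sup>2\<close> becomes \<open>z'' = (\<kappa>\<^sup>2 + v) z\<close> with \<open>v\<close> the function
  \<open>v_fun\<close>, which \<open>V_const\<close> bounds.  In the coordinates \<open>P = (z + z' / \<kappa>) / 2\<close> and
  \<open>Q = (z - z' / \<kappa>) / 2\<close> the unperturbed flow over a cell of length \<open>\<ell>\<close> is diagonal with entries
  \<open>exp (\<plusminus> \<kappa> \<ell>)\<close>, and \<open>v\<close> disturbs it by a relative error of order \<open>\<ell> V / \<bar>\<kappa>\<bar>\<close>.  At an interface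
  \<open>y\<close> and \<open>p y'\<close> are continuous, so \<open>z\<close> is multiplied by \<open>\<alpha>\<close> and \<open>z'\<close> becomes
  \<open>z' / \<alpha> + \<beta> z\<close>.  After division by \<open>exp (\<kappa> \<ell>)\<close>, crossing a cell and the interface at its right
  end is the matrix with rows \<open>(g, 0)\<close> and \<open>(h, 0)\<close>, where \<open>g = (\<alpha> + 1 / \<alpha>) / 2\<close> and
  \<open>h = (\<alpha> - 1 / \<alpha>) / 2\<close>, up to an error that is at most \<open>f = d / (\<surd>2 \<bar>\<kappa>\<bar>)\<close> in the maximum norm
  (lemma \<open>transfer_step\<close>); here \<open>d\<close> is \<open>d_tilde\<close> and \<open>\<bar>\<kappa>\<bar> \<ge> \<surd>2 \<rho>\<^sub>0\<close> is assumed.  Multiplying \<open>m\<close> such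
  matrices (lemma \<open>perturbed_triangular_recursion\<close>) shows that the trace of the monodromy matrix,
  divided by \<open>exp (\<kappa> L)\<close> with \<open>L\<close> the total length, differs from \<open>\<Gamma>\<close> by at most \<open>2 \<eta>\<close>,
  where \<open>\<eta> = (c + f)\<^sup>m - c\<^sup>m\<close>.

  On the other hand the Wronskian is constant, so the monodromy matrix has determinant 1; at an
  eigenvalue it has the eigenvalue \<open>exp (\<i> \<phi>)\<close>, and therefore its trace is \<open>2 cos \<phi>\<close>.  Together,
  \<open>\<bar>\<Gamma>\<bar> \<le> 2 \<eta> + 2 exp (- Re \<kappa> L)\<close>.  Because \<open>Re \<lambda> < 0\<close> gives \<open>\<bar>\<kappa>\<bar> \<le> \<surd>2 Re \<kappa>\<close>, this fails as soon as
  \<open>\<bar>\<kappa>\<bar> / \<surd>2\<close> exceeds the three quantities in the maximum: beyond the first the perturbation argument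
  applies, beyond the second \<open>2 \<eta> < \<bar>\<Gamma>\<bar> / 2\<close>, beyond the third \<open>2 exp (- Re \<kappa> L) < \<bar>\<Gamma>\<bar> / 2\<close>
  (lemma \<open>final_numeric_bound\<close>).

  Only the eigenfunction is given, so a second solution has to be constructed before one can speak of
  a monodromy matrix; this is lemma \<open>linear_system_solution_exists\<close>.  The coefficients are merely
  bounded and measurable, hence all functions are handled through the relation \<open>primitive_on S f g\<close>:
  the increments of \<open>f\<close> are the integrals of the bounded function \<open>g\<close>.  It satisfies a product rule
  (lemma \<open>primitive_on_bilinear\<close>), it holds for absolutely continuous solutions (lemma
  \<open>abs_continuous_has_integral\<close>), and it describes the functions with two bounded weak derivatives (lemmas
  \<open>W2inf_imp_C11\<close> and \<open>weak_deriv_primitive\<close>).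
\<close>

section \<open>Primitives of bounded functions\<close>

text \<open>The derivative is 0 everywhere.  This is how integral identities are proved below without any theorem
  on differentiation almost everywhere: both sides are compared over short intervals, and an error
  that is quadratic in the length disappears.\<close>

lemma quadratic_increments_imp_eq:
  fixes F :: "real \<Rightarrow> 'a::real_normed_vector"
  assumes "a \<le> b"
    and quad: "\<And>s t. a \<le> s \<Longrightarrow> s \<le> t \<Longrightarrow> t \<le> b \<Longrightarrow> norm (F t - F s) \<le> C * (t - s)\<^sup>2"
  shows "F a = F b"
proof -
  have "(F has_derivative (\<lambda>h. 0)) (at x within {a..b})" if x: "x \<in> {a..b}" for x
    unfolding has_derivative_within
  proof (intro conjI)
    have bound: "norm ((1 / norm (y - x)) *\<^sub>R (F y - (F x + 0))) \<le> \<bar>C\<bar> * \<bar>y - x\<bar>" if "y \<in> {a..b}" for y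
    proof -
      have "norm (F y - F x) \<le> C * (y - x)\<^sup>2"
        using quad[of x y] quad[of y x] x that
        by (cases "x \<le> y") (auto simp: norm_minus_commute power2_commute)
      also have "\<dots> \<le> \<bar>C\<bar> * (\<bar>y - x\<bar> * \<bar>y - x\<bar>)"
        by (simp add: power2_eq_square[symmetric] mult_right_mono)
      finally show ?thesis
        by (cases "y = x") (auto simp: divide_simps mult.assoc)
    qed
    have "((\<lambda>y. \<bar>C\<bar> * \<bar>y - x\<bar>) \<longlongrightarrow> \<bar>C\<bar> * \<bar>x - x\<bar>) (at x within {a..b})"
      by (intro tendsto_intros)
    then have *: "((\<lambda>y. \<bar>C\<bar> * \<bar>y - x\<bar>) \<longlongrightarrow> 0) (at x within {a..b})" by simp
    show "((\<lambda>y. (1 / norm (y - x)) *\<^sub>R (F y - (F x + 0))) \<longlongrightarrow> 0) (at x within {a..b})"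
      by (rule Lim_null_comparison[OF _ *])
         (unfold eventually_at_filter, use bound in \<open>intro always_eventually allI impI\<close>)
  qed auto
  then show ?thesis
    using has_derivative_zero_constant[of "{a..b}" F] \<open>a \<le> b\<close>
    by (metis atLeastAtMost_iff convex_real_interval(5) order_refl)
qed

text \<open>A relation rather than a derivative, because \<open>g\<close> only matters almost everywhere.  Quantifying over
  compact subintervals makes it meaningful on open cells and on closed intervals alike, and boundedness of
  \<open>g\<close> makes \<open>f\<close> Lipschitz.\<close>

definition primitive_on :: "real set \<Rightarrow> (real \<Rightarrow> 'a::euclidean_space) \<Rightarrow> (real \<Rightarrow> 'a) \<Rightarrow> bool" where
  "primitive_on S f g \<longleftrightarrow>
     (\<forall>s t. s \<le> t \<longrightarrow> {s..t} \<subseteq> S \<longrightarrow> (g has_integral (f t - f s)) {s..t}) \<and> bounded (g ` S)"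

lemma primitive_onD:
  "primitive_on S f g \<Longrightarrow> s \<le> t \<Longrightarrow> {s..t} \<subseteq> S \<Longrightarrow> (g has_integral (f t - f s)) {s..t}"
  by (simp add: primitive_on_def)

lemma primitive_on_subset: "primitive_on S f g \<Longrightarrow> T \<subseteq> S \<Longrightarrow> primitive_on T f g"
  unfolding primitive_on_def by (meson bounded_subset image_mono order_trans)

lemma primitive_on_bounded: "primitive_on S f g \<Longrightarrow> bounded (g ` S)"
  by (simp add: primitive_on_def)

lemma has_integral_bound_interval:
  fixes f :: "real \<Rightarrow> 'a::real_normed_vector"
  assumes "(f has_integral i) {s..t}" "s \<le> t" "0 \<le> C" "\<And>x. x \<in> {s..t} \<Longrightarrow> norm (f x) \<le> C"
  shows "norm i \<le> C * (t - s)"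
  using has_integral_bound_real[OF \<open>0 \<le> C\<close> finite.emptyI assms(1)] assms by simp

lemma primitive_on_lipschitz:
  assumes "primitive_on S f g"
  obtains C where "C \<ge> 0" "\<And>s t. s \<le> t \<Longrightarrow> {s..t} \<subseteq> S \<Longrightarrow> norm (f t - f s) \<le> C * (t - s)"
    "\<And>t. t \<in> S \<Longrightarrow> norm (g t) \<le> C"
proof -
  obtain C where C: "C > 0" "\<And>x. x \<in> g ` S \<Longrightarrow> norm x \<le> C"
    using primitive_on_bounded[OF assms] bounded_pos by metis
  show ?thesis
  proof
    show "0 \<le> C" using C by simp
    show "norm (f t - f s) \<le> C * (t - s)" if "s \<le> t" "{s..t} \<subseteq> S" for s t
      using has_integral_bound_interval[OF primitive_onD[OF assms that]] that C by (auto simp: subset_iff)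
    show "\<And>t. t \<in> S \<Longrightarrow> norm (g t) \<le> C" using C by auto
  qed
qed

lemma primitive_on_dist:
  assumes "primitive_on S f g" and S: "is_interval S"
  obtains C where "C \<ge> 0" "\<And>s t. s \<in> S \<Longrightarrow> t \<in> S \<Longrightarrow> dist (f t) (f s) \<le> C * dist t s"
proof -
  obtain C where C: "C \<ge> 0" "\<And>s t. s \<le> t \<Longrightarrow> {s..t} \<subseteq> S \<Longrightarrow> norm (f t - f s) \<le> C * (t - s)"
    using primitive_on_lipschitz[OF assms(1)] by metis
  have sub: "{s..t} \<subseteq> S" if "s \<in> S" "t \<in> S" for s t
    using mem_is_interval_1_I[OF S that] by auto
  have "dist (f t) (f s) \<le> C * dist t s" if st: "s \<in> S" "t \<in> S" for s t
  proof (cases "s \<le> t")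
    case True
    then show ?thesis using C(2)[of s t] sub[OF st] by (simp add: dist_norm)
  next
    case False
    then show ?thesis using C(2)[of t s] sub[OF st(2,1)] dist_commute[of "f t" "f s"]
      by (simp add: dist_norm)
  qed
  then show ?thesis using that C(1) by blast
qed

lemma primitive_on_uniformly_continuous:
  assumes "primitive_on S f g" "is_interval S"
  shows "uniformly_continuous_on S f"
proof -
  obtain C where C: "C \<ge> 0" "\<And>s t. s \<in> S \<Longrightarrow> t \<in> S \<Longrightarrow> dist (f t) (f s) \<le> C * dist t s"
    using primitive_on_dist[OF assms] by metis
  then have "C-lipschitz_on S f" by (auto intro!: lipschitz_onI simp: dist_commute)
  then show ?thesis by (rule lipschitz_on_uniformly_continuous)
qed

lemma primitive_on_continuous:
  "primitive_on S f g \<Longrightarrow> is_interval S \<Longrightarrow> continuous_on S f"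
  using primitive_on_uniformly_continuous uniformly_continuous_imp_continuous by blast

lemma primitive_on_bounded_primitive:
  assumes "primitive_on S f g" "is_interval S" "bounded S"
  shows "bounded (f ` S)"
  using bounded_uniformly_continuous_image[OF primitive_on_uniformly_continuous] assms by blast

lemma primitive_on_integrable:
  assumes "primitive_on S f g" "{s..t} \<subseteq> S"
  shows "g absolutely_integrable_on {s..t}"
proof (cases "s \<le> t")
  case True
  obtain C where C: "C \<ge> 0" "\<And>t. t \<in> S \<Longrightarrow> norm (g t) \<le> C"
    using primitive_on_lipschitz[OF assms(1)] by metis
  have g: "g integrable_on {s..t}" using primitive_onD[OF assms(1) True assms(2)] by blast
  show ?thesis
    by (rule measurable_bounded_by_integrable_imp_absolutely_integrable[where g = "\<lambda>_. C"])
       (use C assms integrable_imp_measurable[OF g] in auto)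
qed (simp add: absolutely_integrable_on_def)

lemma absolutely_integrable_continuous_product:
  fixes prod :: "'a::euclidean_space \<Rightarrow> 'b::euclidean_space \<Rightarrow> 'c::euclidean_space"
  assumes "bounded_bilinear prod" "continuous_on {s..t::real} f" "g absolutely_integrable_on {s..t}"
  shows "(\<lambda>x. prod (f x) (g x)) absolutely_integrable_on {s..t}"
proof (rule absolutely_integrable_bounded_measurable_product[where h = prod])
  show "bilinear prod" using assms(1) by (simp add: bilinear_conv_bounded_bilinear)
  show "f \<in> borel_measurable (lebesgue_on {s..t})"
    by (intro continuous_imp_measurable_on_sets_lebesgue assms) auto
  show "bounded (f ` {s..t})"
    by (intro compact_imp_bounded compact_continuous_image assms compact_Icc)
qed (use assms in auto)

text \<open>Over \<open>[s, t]\<close> the increment of the product is the integral of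
  \<open>prod (f' x) (k t) + prod (f s) (k' x)\<close>.  Replacing \<open>k t\<close> by \<open>k x\<close> and \<open>f s\<close> by \<open>f x\<close> costs a
  multiple of \<open>t - s\<close> in the integrand, that is, a quadratic error in the integral.\<close>

lemma primitive_on_bilinear:
  fixes prod :: "'a::euclidean_space \<Rightarrow> 'b::euclidean_space \<Rightarrow> 'c::euclidean_space"
  assumes prod: "bounded_bilinear prod"
    and f: "primitive_on S f f'" and k: "primitive_on S k k'"
    and S: "is_interval S" "bounded S"
  shows "primitive_on S (\<lambda>t. prod (f t) (k t)) (\<lambda>t. prod (f' t) (k t) + prod (f t) (k' t))"
proof -
  interpret bounded_bilinear prod by fact
  obtain B where B: "B > 0" "\<And>x y. norm (prod x y) \<le> norm x * norm y * B"
    using pos_bounded by blast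
  obtain C1 where C1: "C1 \<ge> 0" "\<And>s t. s \<le> t \<Longrightarrow> {s..t} \<subseteq> S \<Longrightarrow> norm (f t - f s) \<le> C1 * (t - s)"
    "\<And>t. t \<in> S \<Longrightarrow> norm (f' t) \<le> C1" using primitive_on_lipschitz[OF f] by metis
  obtain C2 where C2: "C2 \<ge> 0" "\<And>s t. s \<le> t \<Longrightarrow> {s..t} \<subseteq> S \<Longrightarrow> norm (k t - k s) \<le> C2 * (t - s)"
    "\<And>t. t \<in> S \<Longrightarrow> norm (k' t) \<le> C2" using primitive_on_lipschitz[OF k] by metis
  define G where "G t = prod (f' t) (k t) + prod (f t) (k' t)" for t
  have int: "G integrable_on {s..t}" if "{s..t} \<subseteq> S" for s t
  proof -
    have "continuous_on {s..t} f" "continuous_on {s..t} k"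
      using primitive_on_continuous[OF f S(1)] primitive_on_continuous[OF k S(1)]
        continuous_on_subset[OF _ that] by auto
    then have "(\<lambda>t. prod (f' t) (k t)) absolutely_integrable_on {s..t}"
        "(\<lambda>t. prod (f t) (k' t)) absolutely_integrable_on {s..t}"
      using absolutely_integrable_continuous_product[OF bounded_bilinear.flip[OF prod] _ primitive_on_integrable[OF f that]]
        absolutely_integrable_continuous_product[OF prod _ primitive_on_integrable[OF k that]] by auto
    then show ?thesis unfolding G_def
      by (intro integrable_add set_lebesgue_integral_eq_integral(1))
  qed
  have inc: "norm ((prod (f t) (k t) - prod (f s) (k s)) - integral {s..t} G)
                 \<le> (2 * B * C1 * C2) * (t - s)\<^sup>2" if st: "s \<le> t" "{s..t} \<subseteq> S" for s t
  proof -
    let ?h = "\<lambda>x. prod (f' x) (k t) + prod (f s) (k' x)"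
    have "(?h has_integral (prod (f t - f s) (k t) + prod (f s) (k t - k s))) {s..t}"
      by (intro has_integral_add has_integral_linear[OF primitive_onD[OF f st], unfolded o_def, OF bounded_linear_left]
          has_integral_linear[OF primitive_onD[OF k st], unfolded o_def, OF bounded_linear_right])
    then have h: "(?h has_integral (prod (f t) (k t) - prod (f s) (k s))) {s..t}"
      by (simp add: diff_left diff_right)
    have hi: "((\<lambda>x. ?h x - G x) has_integral ((prod (f t) (k t) - prod (f s) (k s)) - integral {s..t} G)) {s..t}"
      by (intro has_integral_diff h integrable_integral int st)
    have hb: "norm (?h x - G x) \<le> (2 * B * C1 * C2) * (t - s)" if x: "x \<in> {s..t}" for x
    proof -
      have sub: "{x..t} \<subseteq> S" "{s..x} \<subseteq> S" "x \<in> S" using st x by auto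
      have "?h x - G x = prod (f' x) (k t - k x) - prod (f x - f s) (k' x)"
        by (simp add: G_def diff_left diff_right)
      also have "norm \<dots> \<le> norm (f' x) * norm (k t - k x) * B + norm (f x - f s) * norm (k' x) * B"
        by (intro order_trans[OF norm_triangle_ineq4] add_mono B)
      also have "\<dots> \<le> C1 * (C2 * (t - s)) * B + (C1 * (t - s)) * C2 * B"
      proof (intro add_mono mult_mono)
        show "norm (k t - k x) \<le> C2 * (t - s)"
          using C2(2)[of x t] sub x st mult_left_mono[of "t - x" "t - s" C2] C2(1) by force
        show "norm (f x - f s) \<le> C1 * (t - s)"
          using C1(2)[of s x] sub x st mult_left_mono[of "x - s" "t - s" C1] C1(1) by force
      qed (use C1 C2 B sub st in auto)
      finally show ?thesis by (simp add: algebra_simps)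
    qed
    have "norm ((prod (f t) (k t) - prod (f s) (k s)) - integral {s..t} G)
        \<le> ((2 * B * C1 * C2) * (t - s)) * (t - s)"
      using st C1(1) C2(1) B(1) by (intro has_integral_bound_interval[OF hi _ _ hb]) auto
    then show ?thesis by (simp add: power2_eq_square mult.assoc)
  qed
  show ?thesis unfolding primitive_on_def
  proof (intro conjI allI impI)
    fix s t assume st: "s \<le> t" "{s..t} \<subseteq> S"
    define F where "F \<tau> = prod (f \<tau>) (k \<tau>) - integral {s..\<tau>} G" for \<tau>
    have "F s = F t"
    proof (rule quadratic_increments_imp_eq[OF st(1)])
      fix u v assume uv: "s \<le> u" "u \<le> v" "v \<le> t"
      have sub: "{s..v} \<subseteq> S" "{u..v} \<subseteq> S" using uv st by auto
      have "F v - F u = (prod (f v) (k v) - prod (f u) (k u)) - integral {u..v} G"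
        using Henstock_Kurzweil_Integration.integral_combine[OF uv(1,2) int[OF sub(1)]]
        by (simp add: F_def algebra_simps)
      then show "norm (F v - F u) \<le> (2 * B * C1 * C2) * (v - u)\<^sup>2"
        using inc[OF uv(2) sub(2)] by simp
    qed
    then have "integral {s..t} G = prod (f t) (k t) - prod (f s) (k s)"
      by (simp add: F_def algebra_simps)
    then show "((\<lambda>t. prod (f' t) (k t) + prod (f t) (k' t)) has_integral prod (f t) (k t) - prod (f s) (k s)) {s..t}"
      using integrable_integral[OF int[OF st(2)]] by (simp add: G_def[abs_def])
  next
    obtain D1 D2 where D: "\<And>t. t \<in> S \<Longrightarrow> norm (f t) \<le> D1" "\<And>t. t \<in> S \<Longrightarrow> norm (k t) \<le> D2"
      using primitive_on_bounded_primitive[OF f S] primitive_on_bounded_primitive[OF k S]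
      by (auto simp: bounded_iff)
    have "norm (prod (f' t) (k t) + prod (f t) (k' t)) \<le> C1 * D2 * B + D1 * C2 * B" if "t \<in> S" for t
      by (intro order_trans[OF norm_triangle_ineq] add_mono order_trans[OF B(2)] mult_right_mono mult_mono)
         (use that C1 C2 D B norm_ge_zero[THEN order_trans, OF D(1)[OF that]] in auto)
    then show "bounded ((\<lambda>t. prod (f' t) (k t) + prod (f t) (k' t)) ` S)"
      by (auto simp: bounded_iff)
  qed
qed

lemma primitive_on_mult:
  fixes f :: "real \<Rightarrow> 'a::{euclidean_space,real_normed_algebra}"
  shows "\<lbrakk>primitive_on S f f'; primitive_on S k k'; is_interval S; bounded S\<rbrakk>
    \<Longrightarrow> primitive_on S (\<lambda>t. f t * k t) (\<lambda>t. f' t * k t + f t * k' t)"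
  by (rule primitive_on_bilinear[OF bounded_bilinear_mult])

lemma primitive_on_add:
  "\<lbrakk>primitive_on S f f'; primitive_on S k k'\<rbrakk> \<Longrightarrow> primitive_on S (\<lambda>t. f t + k t) (\<lambda>t. f' t + k' t)"
  unfolding primitive_on_def
  by (auto simp: bounded_plus_comp add_diff_add intro!: has_integral_add)

lemma primitive_on_linear:
  "\<lbrakk>primitive_on S f f'; bounded_linear h\<rbrakk> \<Longrightarrow> primitive_on S (\<lambda>t. h (f t)) (\<lambda>t. h (f' t))"
  unfolding primitive_on_def
  using has_integral_linear[of f' "f t - f s" "{s..t}" h for s t] bounded_linear_image[of "f' ` S" h]
  by (simp add: o_def linear_simps image_image)

lemma primitive_on_cmult:
  fixes f :: "real \<Rightarrow> 'a::{euclidean_space,real_normed_algebra}"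
  shows "primitive_on S f f' \<Longrightarrow> primitive_on S (\<lambda>t. c * f t) (\<lambda>t. c * f' t)"
  by (rule primitive_on_linear[OF _ bounded_linear_mult_right])

lemma primitive_on_cong:
  assumes "primitive_on S f g" "\<And>t. t \<in> S \<Longrightarrow> f t = f1 t" "\<And>t. t \<in> S \<Longrightarrow> g t = g1 t"
  shows "primitive_on S f1 g1"
  unfolding primitive_on_def
proof (intro conjI allI impI)
  fix s t assume st: "s \<le> t" "{s..t} \<subseteq> S"
  then have "f1 t - f1 s = f t - f s" using assms(2)[of t] assms(2)[of s] by (auto simp: subset_iff)
  then show "(g1 has_integral f1 t - f1 s) {s..t}"
    using has_integral_eq[OF _ primitive_onD[OF assms(1) st], of g1] assms(3) st
    by (metis subset_iff)
next
  show "bounded (g1 ` S)"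
    using primitive_on_bounded[OF assms(1)] assms(3) by (metis image_cong)
qed

lemma primitive_on_AE_cong:
  assumes "primitive_on S f g" "negligible N" "\<And>t. t \<in> S - N \<Longrightarrow> g t = h t" "bounded (h ` S)"
  shows "primitive_on S f h"
  unfolding primitive_on_def
proof (intro conjI allI impI assms(4))
  fix s t assume st: "s \<le> t" "{s..t} \<subseteq> S"
  show "(h has_integral f t - f s) {s..t}"
    by (rule has_integral_spike[OF assms(2) _ primitive_onD[OF assms(1) st]])
       (use assms(3) st in auto)
qed

text \<open>Classical derivatives enter through the fundamental theorem of calculus for the gauge integral.\<close>

lemma primitive_on_derivative:
  assumes "\<And>t. t \<in> S \<Longrightarrow> (f has_vector_derivative g t) (at t within S)" "bounded (g ` S)"
  shows "primitive_on S f g"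
  unfolding primitive_on_def
proof (intro conjI allI impI assms(2))
  fix s t assume st: "s \<le> t" "{s..t} \<subseteq> S"
  show "(g has_integral f t - f s) {s..t}"
    by (rule fundamental_theorem_of_calculus[OF st(1)])
       (use assms(1) st has_vector_derivative_within_subset in blast)
qed

lemma primitive_on_constant_zero:
  assumes "primitive_on S f g" "\<And>t. t \<in> S \<Longrightarrow> g t = 0" "s \<le> t" "{s..t} \<subseteq> S"
  shows "f s = f t"
proof -
  have "((\<lambda>_. 0) has_integral f t - f s) {s..t}"
    using primitive_onD[OF primitive_on_cong[OF assms(1), of f "\<lambda>_. 0"]] assms by auto
  then show ?thesis using has_integral_unique[OF has_integral_0] by fastforce
qed

lemma primitive_on_limits:
  assumes "primitive_on {a<..<b} f g" "a < b"
  obtains l l' where "(f \<longlongrightarrow> l) (at_right a)" "(f \<longlongrightarrow> l') (at_left b)"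
proof -
  have u: "uniformly_continuous_on {a<..<b} f"
    by (rule primitive_on_uniformly_continuous[OF assms(1)]) (simp add: is_interval_oo)
  obtain F where F: "uniformly_continuous_on (closure {a<..<b}) F" "\<And>x. x \<in> {a<..<b} \<Longrightarrow> f x = F x"
    using uniformly_continuous_on_extension_on_closure[OF u] by metis
  then have c: "continuous_on {a..b} F"
    using assms(2) uniformly_continuous_imp_continuous by fastforce
  have "(F \<longlongrightarrow> F a) (at_right a)" "(F \<longlongrightarrow> F b) (at_left b)"
    using c assms(2) by (auto simp: continuous_on_Icc_at_rightD continuous_on_Icc_at_leftD)
  moreover have "eventually (\<lambda>x. x \<in> {a<..<b}) (at_right a)" "eventually (\<lambda>x. x \<in> {a<..<b}) (at_left b)"
    using assms(2) eventually_at_right_real eventually_at_left_real by blast+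
  ultimately show ?thesis
    using that F(2) by (smt (verit) Lim_transform_eventually eventually_mono)
qed

section \<open>Absolutely continuous functions and linear systems\<close>

text \<open>The integral of \<open>g\<close> is computed as a gauge integral.  At a tag outside the null set the gauge
  makes the difference quotient close to \<open>g\<close>; at a tag inside, it confines the interval to an open set of
  small measure, where absolute continuity makes the sum of all increments small.\<close>

lemma abs_continuous_has_integral:
  fixes f :: "real \<Rightarrow> 'a::euclidean_space"
  assumes ac: "abs_continuous_on a b f" and N: "negligible N"
    and der: "\<And>t. t \<in> {a..b} - N \<Longrightarrow> (f has_vector_derivative g t) (at t)"
    and st: "a \<le> s" "s \<le> t" "t \<le> b"
  shows "(g has_integral (f t - f s)) {s..t}"
proof -
  \<comment> \<open>The value at the tags in the null set is irrelevant; 0 removes their contribution to the Riemann sums.\<close>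
  define h where "h x = (if x \<in> N then 0 else g x)" for x
  have "(h has_integral (f t - f s)) {s..t}"
    unfolding has_integral_real
  proof (intro allI impI)
    fix e :: real assume e: "e > 0"
    obtain \<delta> where \<delta>: "\<delta> > 0" and ac\<delta>: "\<forall>D. finite D \<longrightarrow> (\<forall>(s, t)\<in>D. a \<le> s \<and> s < t \<and> t \<le> b) \<longrightarrow>
        pairwise (\<lambda>(s, t) (s', t'). {s<..<t} \<inter> {s'<..<t'} = {}) D \<longrightarrow>
        (\<Sum>(s, t)\<in>D. t - s) < \<delta> \<longrightarrow> (\<Sum>(s, t)\<in>D. norm (f t - f s)) < e / 2"
      using ac[unfolded abs_continuous_on_def, THEN spec, THEN mp, OF half_gt_zero[OF e]] by blast
    note acD = ac\<delta>[THEN spec, THEN mp, THEN mp, THEN mp, THEN mp]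
    obtain U where U: "open U" "N \<subseteq> U" "U \<in> lmeasurable" "measure lebesgue U < \<delta>"
    proof -
      obtain U where U: "open U" "N \<subseteq> U" "U - N \<in> lmeasurable" "emeasure lebesgue (U - N) < ennreal \<delta>"
        using sets_lebesgue_outer_open[OF fmeasurableD[OF negligible_imp_measurable[OF N]] \<delta>] by metis
      have NU: "negligible ((U - N) - U \<union> (U - (U - N)))"
        using N by (rule negligible_subset) auto
      have "U \<in> lmeasurable"
        using lmeasurable_negligible_symdiff[OF U(3) NU] .
      moreover have "measure lebesgue U = measure lebesgue (U - N)"
        using measure_negligible_symdiff[OF U(3) NU] by simp
      moreover have "measure lebesgue (U - N) < \<delta>"
        using U(3,4) \<delta> by (simp add: emeasure_eq_measure2 ennreal_less_iff)
      ultimately show ?thesis using that U by metis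
    qed
    define \<eta> where "\<eta> = e / (2 * (t - s + 1))"
    have \<eta>: "\<eta> > 0" using e st by (simp add: \<eta>_def)
    have "\<exists>d>0. \<forall>y. \<bar>y - x\<bar> < d \<longrightarrow> norm (f y - f x - (y - x) *\<^sub>R g x) \<le> \<eta> * \<bar>y - x\<bar>"
      if "x \<in> {a..b} - N" for x
      using der[OF that] \<eta> unfolding has_vector_derivative_def has_derivative_at_alt by auto
    then obtain d where d: "\<And>x. x \<in> {a..b} - N \<Longrightarrow> d x > 0"
      "\<And>x y. x \<in> {a..b} - N \<Longrightarrow> \<bar>y - x\<bar> < d x \<Longrightarrow> norm (f y - f x - (y - x) *\<^sub>R g x) \<le> \<eta> * \<bar>y - x\<bar>"
      by metis
    \<comment> \<open>On the null set one open set serves as the neighbourhood of all its points.\<close>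
    define \<gamma> where "\<gamma> x = (if x \<in> N then U else if x \<in> {a..b} then ball x (d x) else ball x 1)" for x
    have gauge: "gauge \<gamma>"
      using U d(1) by (auto simp: gauge_def \<gamma>_def)
    have close: "norm ((\<Sum>(x,K)\<in>\<D>. measure lborel K *\<^sub>R h x) - (f t - f s)) < e"
      if \<D>: "\<D> tagged_division_of {s..t}" and fine: "\<gamma> fine \<D>" for \<D>
    proof -
      note fin = tagged_division_ofD(1)[OF \<D>]
      have K: "x \<in> K" "K = {Inf K..Sup K}" "Inf K \<le> x" "x \<le> Sup K" "s \<le> Inf K" "Sup K \<le> t"
        "measure lborel K = Sup K - Inf K" "K \<subseteq> \<gamma> x" "interior K = {Inf K<..<Sup K}"
        if xK: "(x, K) \<in> \<D>" for x K
      proof -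
        obtain u v where uv: "K = {u..v}" using tagged_division_ofD(4)[OF \<D> xK] by auto
        have "x \<in> K" "K \<subseteq> {s..t}" using tagged_division_ofD(2,3)[OF \<D> xK] by auto
        then show "x \<in> K" "K = {Inf K..Sup K}" "Inf K \<le> x" "x \<le> Sup K" "s \<le> Inf K" "Sup K \<le> t"
          "measure lborel K = Sup K - Inf K" "interior K = {Inf K<..<Sup K}"
          using uv by auto
        show "K \<subseteq> \<gamma> x" using fineD[OF fine xK] .
      qed
      define \<Delta> where "\<Delta> z = (case z of (x, K) \<Rightarrow> measure lborel K *\<^sub>R h x - (f (Sup K) - f (Inf K)))" for z
      have "(\<Sum>(x,K)\<in>\<D>. measure lborel K *\<^sub>R h x) - (f t - f s) = sum \<Delta> \<D>"
        using additive_tagged_division_1[OF st(2) \<D>, of f]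
        by (simp add: \<Delta>_def case_prod_unfold sum_subtractf)
      also have "\<dots> = sum \<Delta> {z \<in> \<D>. fst z \<notin> N} + sum \<Delta> {z \<in> \<D>. fst z \<in> N}"
        using fin by (subst sum.union_disjoint[symmetric]) (auto intro: sum.cong)
      also have "norm \<dots> \<le> norm (sum \<Delta> {z \<in> \<D>. fst z \<notin> N}) + norm (sum \<Delta> {z \<in> \<D>. fst z \<in> N})"
        by (rule norm_triangle_ineq)
      finally have split: "norm ((\<Sum>(x,K)\<in>\<D>. measure lborel K *\<^sub>R h x) - (f t - f s))
        \<le> norm (sum \<Delta> {z \<in> \<D>. fst z \<notin> N}) + norm (sum \<Delta> {z \<in> \<D>. fst z \<in> N})" .
      have good: "norm (sum \<Delta> {z \<in> \<D>. fst z \<notin> N}) < e / 2"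
      proof -
        have "norm (\<Delta> z) \<le> \<eta> * measure lborel (snd z)" if z: "z \<in> \<D>" "fst z \<notin> N" for z
        proof -
          obtain x K where zz: "z = (x, K)" by (cases z)
          note KK = K[OF z(1)[unfolded zz]]
          have x: "x \<in> {a..b} - N" "h x = g x" using z KK st zz by (auto simp: h_def)
          have "Sup K \<in> K" "Inf K \<in> K" using KK(2,3,4) by (metis atLeastAtMost_iff order_refl order_trans)+
          then have "\<bar>Sup K - x\<bar> < d x" "\<bar>Inf K - x\<bar> < d x"
            using KK(8) x by (auto simp: \<gamma>_def dist_real_def)
          then have "norm (f (Sup K) - f x - (Sup K - x) *\<^sub>R g x) \<le> \<eta> * \<bar>Sup K - x\<bar>"
            "norm (f (Inf K) - f x - (Inf K - x) *\<^sub>R g x) \<le> \<eta> * \<bar>Inf K - x\<bar>"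
            using d(2)[OF x(1)] by auto
          moreover have "\<Delta> z = (f (Inf K) - f x - (Inf K - x) *\<^sub>R g x) - (f (Sup K) - f x - (Sup K - x) *\<^sub>R g x)"
            by (simp add: \<Delta>_def zz KK(7) x scaleR_left_diff_distrib algebra_simps)
          ultimately have "norm (\<Delta> z) \<le> \<eta> * \<bar>Inf K - x\<bar> + \<eta> * \<bar>Sup K - x\<bar>"
            by (metis add_mono norm_triangle_ineq4 order_trans)
          also have "\<dots> = \<eta> * (Sup K - Inf K)" using KK(3,4) by (simp add: algebra_simps)
          also have "\<dots> = \<eta> * measure lborel (snd z)" using KK(7) by (simp add: zz)
          finally show ?thesis .
        qed
        then have "norm (sum \<Delta> {z \<in> \<D>. fst z \<notin> N}) \<le> (\<Sum>z\<in>{z \<in> \<D>. fst z \<notin> N}. \<eta> * measure lborel (snd z))"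
          by (intro order_trans[OF norm_sum] sum_mono) auto
        also have "\<dots> \<le> (\<Sum>z\<in>\<D>. \<eta> * measure lborel (snd z))"
          using \<eta> fin by (intro sum_mono2) auto
        also have "\<dots> = \<eta> * (t - s)"
          using additive_content_tagged_division[of \<D> s t] \<D> st
          by (simp add: sum_distrib_left[symmetric] case_prod_unfold)
        also have "\<dots> < e / 2" using e st by (simp add: \<eta>_def field_simps)
        finally show ?thesis .
      qed
      have bad: "norm (sum \<Delta> {z \<in> \<D>. fst z \<in> N}) < e / 2"
      proof -
        \<comment> \<open>Degenerate intervals are left out: only nondegenerate ones are determined by their end points, and the definition of absolute continuity sums over a set of pairs.\<close>
        define \<N> where "\<N> = {z \<in> \<D>. fst z \<in> N \<and> Inf (snd z) < Sup (snd z)}"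
        define I where "I z = (Inf (snd z), Sup (snd z))" for z :: "real \<times> real set"
        have finN: "finite \<N>" using fin by (simp add: \<N>_def)
        have disj: "interior (snd z) \<inter> interior (snd z') = {}"
          if "z \<in> \<N>" "z' \<in> \<N>" "z \<noteq> z'" for z z'
          using that tagged_division_ofD(5)[OF \<D>, of "fst z" "snd z" "fst z'" "snd z'"]
          by (auto simp: \<N>_def prod_eq_iff)
        have int: "interior (snd z) = {Inf (snd z)<..<Sup (snd z)}" "interior (snd z) \<noteq> {}" if "z \<in> \<N>" for z
          using that K(9)[of "fst z" "snd z"] by (auto simp: \<N>_def)
        have inj: "inj_on I \<N>"
          unfolding inj_on_def I_def using disj int by (metis Int_absorb prod.inject)
        have meas: "(\<Sum>(s, t)\<in>I ` \<N>. t - s) < \<delta>"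
        proof -
          have "(\<Sum>(s, t)\<in>I ` \<N>. t - s) = (\<Sum>z\<in>\<N>. measure lebesgue (snd z))"
            unfolding sum.reindex[OF inj]
          proof (rule sum.cong[OF refl])
            fix z assume "z \<in> \<N>"
            then have z: "(fst z, snd z) \<in> \<D>" by (simp add: \<N>_def)
            obtain u v where uv: "snd z = {u..v}" using K(2)[OF z] by blast
            have "measure lebesgue (snd z) = measure lborel (snd z)" unfolding uv by simp
            then show "((\<lambda>(s, t). t - s) \<circ> I) z = measure lebesgue (snd z)"
              using K(7)[OF z] by (simp add: I_def)
          qed
          also have "\<dots> = measure lebesgue (\<Union>(snd ` \<N>))"
          proof (rule measure_negligible_finite_Union_image[symmetric, OF finN])
            show "snd z \<in> lmeasurable" if "z \<in> \<N>" for z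
              using that K(2)[of "fst z" "snd z"] by (metis (no_types, lifting) \<N>_def lmeasurable_cbox cbox_interval mem_Collect_eq prod.collapse)
            show "pairwise (\<lambda>x y. negligible (snd x \<inter> snd y)) \<N>"
              unfolding pairwise_def
            proof (intro ballI impI)
              fix z z' assume z: "z \<in> \<N>" "z' \<in> \<N>" "z \<noteq> z'"
              have "convex (snd z)" "convex (snd z')"
                using z K(2)[of "fst z" "snd z"] K(2)[of "fst z'" "snd z'"]
                by (metis (no_types, lifting) \<N>_def convex_real_interval(5) mem_Collect_eq prod.collapse)+
              then show "negligible (snd z \<inter> snd z')"
                using disj[OF z] by (simp add: negligible_convex_interior convex_Int)
            qed
          qed
          also have "\<dots> \<le> measure lebesgue U"
          proof (rule measure_mono_fmeasurable)
            show "\<Union>(snd ` \<N>) \<subseteq> U" using K(8) by (fastforce simp: \<N>_def \<gamma>_def)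
            show "\<Union>(snd ` \<N>) \<in> sets lebesgue"
            proof (intro sets.finite_Union finite_imageI finN subsetI)
              fix K' assume "K' \<in> snd ` \<N>"
              then obtain x where "(x, K') \<in> \<D>" by (auto simp: \<N>_def)
              then show "K' \<in> sets lebesgue" using K(2)[of x K'] by (metis lmeasurable_cbox cbox_interval fmeasurableD)
            qed
          qed (fact U)
          finally show ?thesis using U by simp
        qed
        have "sum \<Delta> {z \<in> \<D>. fst z \<in> N} = (\<Sum>z\<in>{z \<in> \<D>. fst z \<in> N}. - (f (Sup (snd z)) - f (Inf (snd z))))"
          by (intro sum.cong) (auto simp: \<Delta>_def h_def)
        also have "\<dots> = (\<Sum>z\<in>\<N>. - (f (Sup (snd z)) - f (Inf (snd z))))"
        proof (rule sum.mono_neutral_right)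
          show "\<forall>i\<in>{z \<in> \<D>. fst z \<in> N} - \<N>. - (f (Sup (snd i)) - f (Inf (snd i))) = 0"
          proof
            fix z assume z: "z \<in> {z \<in> \<D>. fst z \<in> N} - \<N>"
            then have "Inf (snd z) = Sup (snd z)"
              using K(3,4)[of "fst z" "snd z"] by (auto simp: \<N>_def)
            then show "- (f (Sup (snd z)) - f (Inf (snd z))) = 0" by simp
          qed
        qed (use fin in \<open>auto simp: \<N>_def\<close>)
        finally have "norm (sum \<Delta> {z \<in> \<D>. fst z \<in> N}) \<le> (\<Sum>z\<in>\<N>. norm (f (Sup (snd z)) - f (Inf (snd z))))"
          by (metis (no_types, lifting) norm_minus_cancel norm_sum sum.cong)
        also have "\<dots> = (\<Sum>(s, t)\<in>I ` \<N>. norm (f t - f s))"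
          unfolding sum.reindex[OF inj] by (simp add: I_def)
        also have "\<dots> < e / 2"
        proof (rule acD[OF _ _ _ meas])
          show "finite (I ` \<N>)" using finN by simp
          show "\<forall>(s, t)\<in>I ` \<N>. a \<le> s \<and> s < t \<and> t \<le> b"
            using K(5,6) st by (fastforce simp: I_def \<N>_def)
          show "pairwise (\<lambda>(s, t) (s', t'). {s<..<t} \<inter> {s'<..<t'} = {}) (I ` \<N>)"
            unfolding pairwise_image
          proof (rule pairwiseI, rule impI)
            fix z z' assume z: "z \<in> \<N>" "z' \<in> \<N>" "z \<noteq> z'"
            show "(case I z of (s, t) \<Rightarrow> \<lambda>(s', t'). {s<..<t} \<inter> {s'<..<t'} = {}) (I z')"
              using disj[OF z] unfolding int(1)[OF z(1)] int(1)[OF z(2)] by (simp add: I_def)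
          qed
        qed
        finally show ?thesis .
      qed
      show ?thesis using split good bad by linarith
    qed
    show "\<exists>\<gamma>. gauge \<gamma> \<and> (\<forall>\<D>. \<D> tagged_division_of {s..t} \<and> \<gamma> fine \<D> \<longrightarrow>
        norm ((\<Sum>(x,K)\<in>\<D>. measure lborel K *\<^sub>R h x) - (f t - f s)) < e)"
      by (rule exI[of _ \<gamma>]) (use gauge close in blast)
  qed
  then show ?thesis
    by (rule has_integral_spike[OF N, rotated]) (auto simp: h_def)
qed

lemma bounded_imageE:
  assumes "bounded (f ` S)"
  obtains C where "\<And>t. t \<in> S \<Longrightarrow> norm (f t) \<le> C"
  using assms unfolding bounded_iff by auto

lemma bounded_imageI: "(\<And>t. t \<in> S \<Longrightarrow> norm (f t) \<le> C) \<Longrightarrow> bounded (f ` S)"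
  by (rule boundedI[where B = C]) auto

lemma bounded_mult_image:
  fixes f g :: "'b \<Rightarrow> 'a::real_normed_algebra"
  assumes "bounded (f ` S)" "bounded (g ` S)"
  shows "bounded ((\<lambda>x. f x * g x) ` S)"
proof -
  obtain C D where "\<And>x. x \<in> S \<Longrightarrow> norm (f x) \<le> C" "\<And>x. x \<in> S \<Longrightarrow> norm (g x) \<le> D"
    using assms by (auto simp: bounded_iff)
  then have "norm (f x * g x) \<le> C * D" if "x \<in> S" for x
    using that by (intro order_trans[OF norm_mult_ineq] mult_mono')  auto
  then show ?thesis by (auto simp: bounded_iff)
qed

lemma primitive_on_integral:
  assumes "g integrable_on {a..b}" "bounded (g ` {a..b})" "\<And>t. t \<in> {a..b} \<Longrightarrow> f t = c + integral {a..t} g"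
  shows "primitive_on {a..b} f g"
  unfolding primitive_on_def
proof (intro conjI allI impI assms(2))
  fix s t assume st: "s \<le> t" "{s..t} \<subseteq> {a..b}"
  then have "f t - f s = integral {s..t} g"
    using Henstock_Kurzweil_Integration.integral_combine[of a s t g] assms(3)[of s] assms(3)[of t]
      integrable_on_subinterval[OF assms(1), of a t] by (simp add: algebra_simps)
  then show "(g has_integral f t - f s) {s..t}"
    using integrable_integral[OF integrable_on_subinterval[OF assms(1) st(2)]] by simp
qed

text \<open>Picard iteration for the unknown \<open>W t = exp (- K (t - a)) (y t, u t)\<close>.  With the exponential weight the
  integral operator is a contraction on the whole interval as soon as \<open>K\<close> is large compared with the
  coefficients, so that no short intervals have to be glued together.\<close>

lemma linear_system_solution_exists:
  fixes A B :: "real \<Rightarrow> complex"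
  assumes ab: "a \<le> b"
    and A: "A \<in> borel_measurable (lebesgue_on {a..b})" "bounded (A ` {a..b})"
    and B: "B \<in> borel_measurable (lebesgue_on {a..b})" "bounded (B ` {a..b})"
  obtains y u where "y a = y0" "u a = u0"
    "primitive_on {a..b} y (\<lambda>t. A t * u t)" "primitive_on {a..b} u (\<lambda>t. B t * y t)"
proof -
  obtain M1 where M1: "M1 > 0" "\<And>x. x \<in> A ` {a..b} \<Longrightarrow> norm x \<le> M1"
    using A(2) bounded_pos by metis
  obtain M2 where M2: "M2 > 0" "\<And>x. x \<in> B ` {a..b} \<Longrightarrow> norm x \<le> M2"
    using B(2) bounded_pos by metis
  define M where "M = max M1 M2"
  have M: "M > 0" "\<And>t. t \<in> {a..b} \<Longrightarrow> norm (A t) \<le> M" "\<And>t. t \<in> {a..b} \<Longrightarrow> norm (B t) \<le> M"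
    using M1 M2 by (auto simp: M_def le_max_iff_disj)
  \<comment> \<open>Each of the two components of the operator has Lipschitz constant \<open>M / K\<close>; this choice makes their sum 1/2.\<close>
  define K where "K = 4 * M"
  have K: "K > 0" using M by (simp add: K_def)
  \<comment> \<open>Bounded continuous functions live on the whole line; clamping the argument extends functions on \<open>[a, b]\<close>.\<close>
  define c where "c t = max a (min b t)" for t
  have c: "c t \<in> {a..b}" "continuous_on X c" for t X
    using ab by (auto simp: c_def[abs_def] intro!: continuous_intros)
  have int: "(\<lambda>s. C s * k s) absolutely_integrable_on {a..\<tau>}"
    if "C \<in> borel_measurable (lebesgue_on {a..b})" "bounded (C ` {a..b})" "continuous_on {a..b} k" "\<tau> \<in> {a..b}"
    for C k :: "real \<Rightarrow> complex" and \<tau>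
  proof -
    have "(\<lambda>s. C s * k s) absolutely_integrable_on {a..b}"
      by (rule absolutely_integrable_bounded_measurable_product[OF bilinear_times that(1) _ that(2)])
        (use that(3) in \<open>auto intro: absolutely_integrable_continuous_real\<close>)
    then show ?thesis
      using that(4) by (meson absolutely_integrable_on_subinterval atLeastatMost_subset_iff atLeastAtMost_iff order_refl)
  qed
  define J where "J C k t = exp (- (K * (c t - a))) *\<^sub>R integral {a..c t} (\<lambda>s. C s * (exp (K * (s - a)) *\<^sub>R k s))"
    for C k :: "real \<Rightarrow> complex" and t
  define w where "w t = exp (- (K * (c t - a)))" for t
  have Jcont: "continuous_on UNIV (J C k)"
    if C: "C \<in> borel_measurable (lebesgue_on {a..b})" "bounded (C ` {a..b})" and k: "continuous_on UNIV k" for C k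
  proof -
    have k': "continuous_on {a..b} (\<lambda>s. exp (K * (s - a)) *\<^sub>R k s)"
      by (intro continuous_intros continuous_on_subset[OF k]) auto
    have "continuous_on {a..b} (\<lambda>x. integral {a..x} (\<lambda>s. C s * (exp (K * (s - a)) *\<^sub>R k s)))"
      using int[OF C k', of b] ab by (intro indefinite_integral_continuous_1 set_lebesgue_integral_eq_integral(1)) auto
    then have "continuous_on UNIV (\<lambda>t. integral {a..c t} (\<lambda>s. C s * (exp (K * (s - a)) *\<^sub>R k s)))"
      by (rule continuous_on_compose2[OF _ c(2)]) (use c(1) in auto)
    then show ?thesis unfolding J_def[abs_def] by (intro continuous_intros c)
  qed
  have Jdist: "norm (J C k t - J C k' t) \<le> M * D / K"
    if C: "C \<in> borel_measurable (lebesgue_on {a..b})" "bounded (C ` {a..b})" "\<And>t. t \<in> {a..b} \<Longrightarrow> norm (C t) \<le> M"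
      and k: "continuous_on UNIV k" "continuous_on UNIV k'" and D: "\<And>t. norm (k t - k' t) \<le> D"
    for C k k' t D
  proof -
    have D0: "0 \<le> D" using D norm_ge_zero order_trans by blast
    let ?e = "\<lambda>s. exp (K * (s - a))"
    have kc: "continuous_on {a..b} (\<lambda>s. ?e s *\<^sub>R k s)" "continuous_on {a..b} (\<lambda>s. ?e s *\<^sub>R k' s)"
      by (intro continuous_intros continuous_on_subset[OF k(1)] continuous_on_subset[OF k(2)]; simp)+
    note i = int[OF C(1,2) kc(1) c(1), THEN set_lebesgue_integral_eq_integral(1)]
      int[OF C(1,2) kc(2) c(1), THEN set_lebesgue_integral_eq_integral(1)]
    have eint: "((\<lambda>s. (M * D) * ?e s) has_integral (M * D) * (?e (c t) / K - ?e a / K)) {a..c t}"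
    proof (intro has_integral_mult_right fundamental_theorem_of_calculus)
      show "a \<le> c t" using c(1) by simp
      show "((\<lambda>s. ?e s / K) has_vector_derivative ?e s) (at s within {a..c t})" for s
        using K by (auto intro!: derivative_eq_intros simp: has_real_derivative_iff_has_vector_derivative[symmetric])
    qed
    have "norm (integral {a..c t} (\<lambda>s. C s * (?e s *\<^sub>R k s)) - integral {a..c t} (\<lambda>s. C s * (?e s *\<^sub>R k' s)))
        = norm (integral {a..c t} (\<lambda>s. C s * (?e s *\<^sub>R k s) - C s * (?e s *\<^sub>R k' s)))"
      by (rule arg_cong[where f = norm], rule Henstock_Kurzweil_Integration.integral_diff[OF i, symmetric])
    also have "\<dots> \<le> integral {a..c t} (\<lambda>s. (M * D) * ?e s)"
    proof (rule Henstock_Kurzweil_Integration.integral_norm_bound_integral)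
      show "norm (C s * (?e s *\<^sub>R k s) - C s * (?e s *\<^sub>R k' s)) \<le> (M * D) * ?e s" if "s \<in> {a..c t}" for s
      proof -
        have "C s * (?e s *\<^sub>R k s) - C s * (?e s *\<^sub>R k' s) = ?e s *\<^sub>R (C s * (k s - k' s))"
          by (simp add: algebra_simps)
        also have "norm \<dots> = ?e s * (norm (C s) * norm (k s - k' s))" by (simp add: norm_mult)
        also have "\<dots> \<le> ?e s * (M * D)"
          using C(3)[of s] D[of s] M(1) that c(1)[of t] by (intro mult_left_mono mult_mono) auto
        finally show ?thesis by (simp add: mult.commute)
      qed
    qed (use i eint in \<open>auto intro: integrable_diff\<close>)
    also have "\<dots> = (M * D) * (?e (c t) / K - ?e a / K)" using eint by (rule integral_unique)
    also have "\<dots> \<le> (M * D) * (?e (c t) / K)"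
      using M D0 K by (intro mult_left_mono) auto
    finally have "exp (- (K * (c t - a))) * norm (integral {a..c t} (\<lambda>s. C s * (?e s *\<^sub>R k s)) - integral {a..c t} (\<lambda>s. C s * (?e s *\<^sub>R k' s)))
       \<le> exp (- (K * (c t - a))) * ((M * D) * (?e (c t) / K))"
      by (intro mult_left_mono) auto
    also have "\<dots> = M * D / K" by (simp add: exp_minus)
    finally show ?thesis
      by (simp add: J_def scaleR_diff_right[symmetric])
  qed
  define T where "T W t = (w t *\<^sub>R y0 + J A (\<lambda>s. snd (apply_bcontfun W s)) t, w t *\<^sub>R u0 + J B (\<lambda>s. fst (apply_bcontfun W s)) t)"
    for W :: "real \<Rightarrow>\<^sub>C (complex \<times> complex)" and t
  have fc: "continuous_on UNIV (\<lambda>s. fst (apply_bcontfun W s))" "continuous_on UNIV (\<lambda>s. snd (apply_bcontfun W s))"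
    for W :: "real \<Rightarrow>\<^sub>C (complex \<times> complex)"
    by (intro continuous_intros; simp)+
  have Tb: "T W \<in> bcontfun" for W
  proof -
    have cont: "continuous_on UNIV (T W)"
      unfolding T_def[abs_def] w_def using c A B fc by (intro continuous_intros Jcont) auto
    have "T W t = T W (c t)" for t
    proof -
      have "c (c t) = c t" using ab by (simp add: c_def)
      then show ?thesis by (simp add: T_def J_def w_def)
    qed
    then have "range (T W) \<subseteq> T W ` {a..b}" using c(1) by (metis image_iff image_subsetI rangeE)
    moreover have "compact (T W ` {a..b})"
      by (intro compact_continuous_image continuous_on_subset[OF cont]) auto
    ultimately have "bounded (range (T W))" using bounded_subset compact_imp_bounded by blast
    then show ?thesis using cont by (simp add: bcontfun_def)
  qed
  have "\<exists>!W. Bcontfun (T W) = W"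
  proof (rule banach_fix_type[of "1/2"], safe)
    fix W W' :: "real \<Rightarrow>\<^sub>C (complex \<times> complex)"
    show "dist (Bcontfun (T W)) (Bcontfun (T W')) \<le> 1/2 * dist W W'"
    proof (rule dist_bound)
      fix t
      have D1: "norm (snd (apply_bcontfun W s) - snd (apply_bcontfun W' s)) \<le> dist W W'"
        "norm (fst (apply_bcontfun W s) - fst (apply_bcontfun W' s)) \<le> dist W W'" for s
        using order_trans[OF dist_snd_le dist_bounded[of W s W']] order_trans[OF dist_fst_le dist_bounded[of W s W']]
        by (auto simp: dist_norm)
      have "dist (T W t) (T W' t) \<le>
          norm (J A (\<lambda>s. snd (apply_bcontfun W s)) t - J A (\<lambda>s. snd (apply_bcontfun W' s)) t)
        + norm (J B (\<lambda>s. fst (apply_bcontfun W s)) t - J B (\<lambda>s. fst (apply_bcontfun W' s)) t)"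
        unfolding dist_norm T_def by (simp add: order_trans[OF norm_Pair_le])
      also have "\<dots> \<le> M * dist W W' / K + M * dist W W' / K"
        by (intro add_mono Jdist A B M fc D1)
      also have "\<dots> = 1/2 * dist W W'" using M by (simp add: K_def field_simps)
      finally show "dist (apply_bcontfun (Bcontfun (T W)) t) (apply_bcontfun (Bcontfun (T W')) t) \<le> 1/2 * dist W W'"
        by (simp add: Bcontfun_inverse Tb)
    qed
  qed auto
  then obtain W where "Bcontfun (T W) = W" by blast
  then have W: "apply_bcontfun W t = T W t" for t by (metis Bcontfun_inverse Tb)
  define y where "y t = exp (K * (t - a)) *\<^sub>R fst (apply_bcontfun W t)" for t
  define u where "u t = exp (K * (t - a)) *\<^sub>R snd (apply_bcontfun W t)" for t
  have yc: "continuous_on {a..b} y" "continuous_on {a..b} u"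
    unfolding y_def[abs_def] u_def[abs_def]
    by (intro continuous_intros continuous_on_subset[OF fc(1)] continuous_on_subset[OF fc(2)]; simp)+
  have eq: "y t = y0 + integral {a..t} (\<lambda>t. A t * u t)" "u t = u0 + integral {a..t} (\<lambda>t. B t * y t)"
    if t: "t \<in> {a..b}" for t
  proof -
    have ct: "c t = t" using t by (auto simp: c_def)
    have e: "exp (K * (t - a)) *\<^sub>R w t *\<^sub>R z = z" "exp (K * (t - a)) *\<^sub>R exp (- (K * (t - a))) *\<^sub>R z = z"  for z :: complex
      by (simp_all add: w_def ct exp_minus)
    have "y t = exp (K * (t - a)) *\<^sub>R fst (T W t)" "u t = exp (K * (t - a)) *\<^sub>R snd (T W t)"
      by (simp_all add: y_def u_def W)
    then show "y t = y0 + integral {a..t} (\<lambda>t. A t * u t)" "u t = u0 + integral {a..t} (\<lambda>t. B t * y t)"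
      by (simp_all only: T_def fst_conv snd_conv J_def scaleR_add_right e ct y_def u_def)
  qed
  have bp: "bounded ((\<lambda>t. C t * k t) ` {a..b})" if "bounded (C ` {a..b})" "continuous_on {a..b} k" for C k :: "real \<Rightarrow> complex"
  proof -
    have "bounded (k ` {a..b})" using that by (intro compact_imp_bounded compact_continuous_image) auto
    then show ?thesis
      using that(1) bounded_mult_image by blast
  qed
  show ?thesis
  proof
    show "y a = y0" "u a = u0" using eq[of a] ab by auto
    show "primitive_on {a..b} y (\<lambda>t. A t * u t)" "primitive_on {a..b} u (\<lambda>t. B t * y t)"
      using int[OF A yc(2), of b] int[OF B yc(1), of b] ab
      by (intro primitive_on_integral[OF _ _ eq(1)] primitive_on_integral[OF _ _ eq(2)] bp A B yc
            set_lebesgue_integral_eq_integral(1); auto)+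
  qed
qed

lemma wronskian_constant:
  fixes y u y' u' A B :: "real \<Rightarrow> complex"
  assumes "primitive_on S y (\<lambda>t. A t * u t)" "primitive_on S u (\<lambda>t. B t * y t)"
    and "primitive_on S y' (\<lambda>t. A t * u' t)" "primitive_on S u' (\<lambda>t. B t * y' t)"
    and "is_interval S" "bounded S" "s \<le> t" "{s..t} \<subseteq> S"
  shows "y s * u' s - u s * y' s = y t * u' t - u t * y' t"
proof -
  have "primitive_on S (\<lambda>t. y t * u' t + (-1) * (u t * y' t))
     (\<lambda>t. (A t * u t * u' t + y t * (B t * y' t)) + (-1) * (B t * y t * y' t + u t * (A t * u' t)))"
    by (intro primitive_on_add primitive_on_cmult primitive_on_mult assms)
  from primitive_on_constant_zero[OF this _ assms(7,8)] show ?thesis by (simp add: algebra_simps)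
qed

lemma has_integral_norm_bound_le:
  fixes f :: "real \<Rightarrow> 'a::euclidean_space"
  assumes "(f has_integral i) S" "(g has_integral j) S" "\<And>x. x \<in> S \<Longrightarrow> norm (f x) \<le> g x"
  shows "norm i \<le> j"
  using Henstock_Kurzweil_Integration.integral_norm_bound_integral[of f S g] assms
  by (metis has_integral_integrable integral_unique)

section \<open>The exponential dichotomy on a cell\<close>

text \<open>Let \<open>E = exp (- \<kappa> (\<xi> - \<xi> s))\<close>.  Variation of constants gives
  \<open>E P - P s = \<integral> E r w\<close> and \<open>E Q - E\<^sup>2 Q s = - \<integral> E(t)\<^sup>2 / E(x) r w\<close> with
  \<open>w = v / (2 \<kappa>) (P + Q)\<close>, where \<open>\<bar>E(t)\<^sup>2 / E(x)\<bar> \<le> \<bar>E(x)\<bar>\<close> for \<open>x \<le> t\<close>.  If \<open>M\<close> is the maximum of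
  \<open>\<bar>E P\<bar> + \<bar>E Q\<bar>\<close>, both integrals are therefore at most \<open>\<theta> M / 2\<close>, hence
  \<open>M \<le> \<bar>P s\<bar> + \<bar>Q s\<bar> + \<theta> M\<close>.  As \<open>\<theta> < 1\<close> this bounds \<open>M\<close>, and then the two integrals.\<close>

lemma dichotomy_cell_estimate:
  fixes P Q v :: "real \<Rightarrow> complex" and r \<xi> :: "real \<Rightarrow> real" and \<kappa> :: complex
  assumes st: "s \<le> t"
    and P: "primitive_on {s..t} P (\<lambda>x. r x * (\<kappa> * P x + v x / (2 * \<kappa>) * (P x + Q x)))"
    and Q: "primitive_on {s..t} Q (\<lambda>x. - (r x * (\<kappa> * Q x + v x / (2 * \<kappa>) * (P x + Q x))))"
    and \<xi>: "\<And>x. x \<in> {s..t} \<Longrightarrow> (\<xi> has_vector_derivative r x) (at x within {s..t})"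
    and r: "\<And>x. x \<in> {s..t} \<Longrightarrow> 0 \<le> r x" "bounded (r ` {s..t})"
    and v: "\<And>x. x \<in> {s..t} \<Longrightarrow> cmod (v x) \<le> V"
    and \<kappa>: "Re \<kappa> > 0"
    and \<theta>: "\<theta> = V * (\<xi> t - \<xi> s) / cmod \<kappa>" "\<theta> < 1"
  shows "cmod (exp (- \<kappa> * of_real (\<xi> t - \<xi> s)) * P t - P s) \<le> \<theta> / 2 / (1 - \<theta>) * (cmod (P s) + cmod (Q s))"
    and "cmod (exp (- \<kappa> * of_real (\<xi> t - \<xi> s)) * Q t - exp (- 2 * \<kappa> * of_real (\<xi> t - \<xi> s)) * Q s)
           \<le> \<theta> / 2 / (1 - \<theta>) * (cmod (P s) + cmod (Q s))"
proof -
  have k0: "cmod \<kappa> > 0" "\<kappa> \<noteq> 0" using \<kappa> by auto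
  have V0: "0 \<le> V" using v[of s] st norm_ge_zero order_trans by (metis atLeastAtMost_iff order_refl)
  have itv: "is_interval {s..t}" "bounded {s..t}" by (auto simp: is_interval_cc)
  have rint: "(r has_integral \<xi> y - \<xi> x) {x..y}" if "s \<le> x" "x \<le> y" "y \<le> t" for x y
  proof (rule fundamental_theorem_of_calculus[OF that(2)])
    fix z assume "z \<in> {x..y}"
    then show "(\<xi> has_vector_derivative r z) (at z within {x..y})"
      using that by (intro has_vector_derivative_within_subset[OF \<xi>[of z]]) auto
  qed
  have mono: "\<xi> x \<le> \<xi> y" if "s \<le> x" "x \<le> y" "y \<le> t" for x y
    using has_integral_nonneg[OF rint[OF that]] r(1) that by auto
  define E where "E x = exp (- \<kappa> * of_real (\<xi> x - \<xi> s))" for x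
  \<comment> \<open>\<open>E\<close> normalises the growing component, its inverse \<open>E'\<close> turns \<open>Q\<close> into a pure integral.\<close>
  define E' where "E' x = exp (\<kappa> * of_real (\<xi> x - \<xi> s))" for x
  define w where "w x = v x / (2 * \<kappa>) * (P x + Q x)" for x
  have EE: "E x * E' x = 1" for x by (simp add: E_def E'_def exp_minus)
  have normE: "cmod (E x) = exp (- (Re \<kappa> * (\<xi> x - \<xi> s)))" "cmod (E' x) = exp (Re \<kappa> * (\<xi> x - \<xi> s))" for x
    by (simp_all add: E_def E'_def)
  have contxi: "continuous_on {s..t} \<xi>"
    by (rule continuous_on_vector_derivative) (use \<xi> in auto)
  have primE: "primitive_on {s..t} (\<lambda>x. exp (k * of_real (\<xi> x - \<xi> s))) (\<lambda>x. k * of_real (r x) * exp (k * of_real (\<xi> x - \<xi> s)))"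
    for k :: complex
  proof (rule primitive_on_derivative)
    show "((\<lambda>x. exp (k * of_real (\<xi> x - \<xi> s))) has_vector_derivative k * of_real (r x) * exp (k * of_real (\<xi> x - \<xi> s)))
        (at x within {s..t})" if "x \<in> {s..t}" for x
    proof -
      have "((\<lambda>x. \<xi> x - \<xi> s) has_real_derivative r x) (at x within {s..t})"
        using \<xi>[OF that] by (auto intro!: derivative_eq_intros simp: has_real_derivative_iff_has_vector_derivative[symmetric])
      then have "((\<lambda>x. k * complex_of_real (\<xi> x - \<xi> s)) has_vector_derivative k * of_real (r x)) (at x within {s..t})"
        by (intro has_vector_derivative_mult_right has_vector_derivative_of_real)
      from field_vector_diff_chain_within[OF this DERIV_subset[OF DERIV_exp subset_UNIV]] show ?thesis
        by (simp add: o_def)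
    qed
    have "bounded ((\<lambda>x. exp (k * of_real (\<xi> x - \<xi> s))) ` {s..t})"
      by (intro compact_imp_bounded compact_continuous_image continuous_intros contxi) auto
    moreover have "bounded ((\<lambda>x. k * of_real (r x)) ` {s..t})"
      using bounded_linear_image[OF r(2) bounded_linear_const_mult[OF bounded_linear_of_real], of k]
      by (simp add: image_image)
    ultimately show "bounded ((\<lambda>x. k * of_real (r x) * exp (k * of_real (\<xi> x - \<xi> s))) ` {s..t})"
      by (rule bounded_mult_image[rotated])
  qed
  have X: "primitive_on {s..t} (\<lambda>x. E x * P x) (\<lambda>x. E x * r x * w x)"
    by (rule primitive_on_cong[OF primitive_on_mult[OF primE[of "- \<kappa>"] P itv]])
       (auto simp: E_def w_def algebra_simps)
  have G: "primitive_on {s..t} (\<lambda>x. E' x * Q x) (\<lambda>x. - (E' x * r x * w x))"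
    by (rule primitive_on_cong[OF primitive_on_mult[OF primE[of \<kappa>] Q itv]])
       (auto simp: E'_def w_def algebra_simps)
  define S where "S x = cmod (E x * P x) + cmod (E x * Q x)" for x
  have "continuous_on {s..t} S"
    unfolding S_def[abs_def] E_def[abs_def]
    by (intro continuous_intros contxi primitive_on_continuous[OF P] primitive_on_continuous[OF Q] itv)
  then obtain xm where xm: "xm \<in> {s..t}" and max: "\<And>x. x \<in> {s..t} \<Longrightarrow> S x \<le> S xm"
    using continuous_attains_sup[of "{s..t}" S] st by auto
  define M where "M = S xm"
  have wb: "cmod (E x * r x * w x) \<le> V * M / (2 * cmod \<kappa>) * r x" if x: "x \<in> {s..t}" for x
  proof -
    have "cmod (E x * r x * w x) = r x * (cmod (v x) / (2 * cmod \<kappa>)) * cmod (E x * P x + E x * Q x)"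
      using r(1)[OF x] by (simp add: w_def norm_mult norm_divide distrib_left[symmetric])
    also have "\<dots> \<le> r x * (V / (2 * cmod \<kappa>)) * M"
      using r(1)[OF x] v[OF x] k0 V0 order_trans[OF norm_triangle_ineq max[OF x, unfolded S_def[of x]]]
      by (intro mult_mono mult_left_mono divide_right_mono) (auto simp: M_def)
    finally show ?thesis by (simp add: mult_ac)
  qed
  have rb: "((\<lambda>x. V * M / (2 * cmod \<kappa>) * r x) has_integral V * M / (2 * cmod \<kappa>) * (\<xi> \<tau> - \<xi> s)) {s..\<tau>}"
    if "\<tau> \<in> {s..t}" for \<tau>
    using that by (intro has_integral_mult_right rint) auto
  have devX: "cmod (E \<tau> * P \<tau> - P s) \<le> V * M / (2 * cmod \<kappa>) * (\<xi> \<tau> - \<xi> s)" if \<tau>: "\<tau> \<in> {s..t}" for \<tau>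
  proof -
    have "((\<lambda>x. E x * r x * w x) has_integral (E \<tau> * P \<tau> - E s * P s)) {s..\<tau>}"
      using primitive_onD[OF X, of s \<tau>] \<tau> by auto
    from has_integral_norm_bound_le[OF this rb[OF \<tau>]] show ?thesis
      using wb \<tau> by (simp add: E_def)
  qed
  have devY: "cmod (E \<tau> * Q \<tau> - (E \<tau>)\<^sup>2 * Q s) \<le> V * M / (2 * cmod \<kappa>) * (\<xi> \<tau> - \<xi> s)" if \<tau>: "\<tau> \<in> {s..t}" for \<tau>
  proof -
    have "((\<lambda>x. (E \<tau>)\<^sup>2 * - (E' x * r x * w x)) has_integral (E \<tau>)\<^sup>2 * (E' \<tau> * Q \<tau> - E' s * Q s)) {s..\<tau>}"
      using \<tau> by (intro has_integral_mult_right primitive_onD[OF G]) auto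
    moreover have "cmod ((E \<tau>)\<^sup>2 * - (E' x * r x * w x)) \<le> V * M / (2 * cmod \<kappa>) * r x" if x: "x \<in> {s..\<tau>}" for x
    proof -
      have "\<xi> x \<le> \<xi> \<tau>" using mono x \<tau> by auto
      then have "2 * (Re \<kappa> * (\<xi> x - \<xi> s)) \<le> 2 * (Re \<kappa> * (\<xi> \<tau> - \<xi> s))"
        using \<kappa> by (intro mult_left_mono) auto
      then have "cmod ((E \<tau>)\<^sup>2 * E' x) \<le> cmod (E x)"
        by (simp add: norm_mult norm_power normE power2_eq_square mult_exp_exp)
      then have "cmod ((E \<tau>)\<^sup>2 * E' x) * cmod (r x * w x) \<le> cmod (E x) * cmod (r x * w x)"
        by (rule mult_right_mono) simp
      also have "\<dots> \<le> V * M / (2 * cmod \<kappa>) * r x"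
        using wb[of x] x \<tau> by (auto simp: norm_mult mult.assoc)
      finally show ?thesis by (simp add: norm_mult mult.assoc)
    qed
    ultimately have "cmod ((E \<tau>)\<^sup>2 * (E' \<tau> * Q \<tau> - E' s * Q s)) \<le> V * M / (2 * cmod \<kappa>) * (\<xi> \<tau> - \<xi> s)"
      by (rule has_integral_norm_bound_le[OF _ rb[OF \<tau>]])
    moreover have "(E \<tau>)\<^sup>2 * (E' \<tau> * Q \<tau> - E' s * Q s) = E \<tau> * Q \<tau> * (E \<tau> * E' \<tau>) - (E \<tau>)\<^sup>2 * Q s"
      by (simp add: E'_def algebra_simps power2_eq_square)
    ultimately show ?thesis by (simp add: EE)
  qed
  define N where "N = cmod (P s) + cmod (Q s)"
  have M0: "0 \<le> M" by (simp add: M_def S_def)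
  have xms: "V * M / (2 * cmod \<kappa>) * (\<xi> xm - \<xi> s) \<le> \<theta> * M / 2"
  proof -
    have "V * M / (2 * cmod \<kappa>) * (\<xi> xm - \<xi> s) \<le> V * M / (2 * cmod \<kappa>) * (\<xi> t - \<xi> s)"
      using mono[of xm t] xm V0 M0 k0 by (intro mult_left_mono) auto
    also have "\<dots> = \<theta> * M / 2" using k0 by (simp add: \<theta>(1) field_simps)
    finally show ?thesis .
  qed
  have "M \<le> N + \<theta> * M"
  proof -
    have "cmod (E xm) \<le> 1" using mono[of s xm] xm \<kappa> by (auto simp: normE)
    then have "cmod ((E xm)\<^sup>2 * Q s) \<le> 1 * cmod (Q s)"
      unfolding norm_mult norm_power by (intro mult_right_mono power_le_one) auto
    moreover have "cmod (E xm * P xm) \<le> cmod (P s) + cmod (E xm * P xm - P s)"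
      using norm_triangle_sub by (metis)
    moreover have "cmod (E xm * Q xm) \<le> cmod ((E xm)\<^sup>2 * Q s) + cmod (E xm * Q xm - (E xm)\<^sup>2 * Q s)"
      using norm_triangle_sub by (metis)
    ultimately show ?thesis
      using devX[OF xm] devY[OF xm] xms unfolding M_def S_def N_def by linarith
  qed
  then have "M * (1 - \<theta>) \<le> N" by (simp add: algebra_simps)
  then have "M \<le> N / (1 - \<theta>)" using \<theta>(2) by (simp add: field_simps)
  moreover have "0 \<le> \<theta>" using V0 k0 mono[of s t] st by (simp add: \<theta>(1))
  ultimately have M\<theta>: "\<theta> / 2 * M \<le> \<theta> / 2 * (N / (1 - \<theta>))"
    by (intro mult_left_mono) auto
  have "V * M / (2 * cmod \<kappa>) * (\<xi> t - \<xi> s) = \<theta> / 2 * M"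
    using k0 by (simp add: \<theta>(1) field_simps)
  also note M\<theta>
  also have "\<theta> / 2 * (N / (1 - \<theta>)) = \<theta> / 2 / (1 - \<theta>) * N" by simp
  finally have "V * M / (2 * cmod \<kappa>) * (\<xi> t - \<xi> s) \<le> \<theta> / 2 / (1 - \<theta>) * N" .
  then show "cmod (exp (- \<kappa> * of_real (\<xi> t - \<xi> s)) * P t - P s) \<le> \<theta> / 2 / (1 - \<theta>) * (cmod (P s) + cmod (Q s))"
    and "cmod (exp (- \<kappa> * of_real (\<xi> t - \<xi> s)) * Q t - exp (- 2 * \<kappa> * of_real (\<xi> t - \<xi> s)) * Q s)
           \<le> \<theta> / 2 / (1 - \<theta>) * (cmod (P s) + cmod (Q s))"
    using devX[of t] devY[of t] st
    by (auto simp: E_def N_def exp_double[symmetric] mult.assoc)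
qed

section \<open>Test functions and the fundamental lemma\<close>

text \<open>For \<open>k = 0\<close> the classical smooth function that is flat at 0.  The further powers of \<open>1 / x\<close> are included
  because they occur in its derivatives.\<close>

definition flat_exp :: "nat \<Rightarrow> real \<Rightarrow> real" where
  "flat_exp k x = (if x > 0 then exp (- (1 / x)) / x ^ k else 0)"

lemma power_le_fact_exp: "y ^ n \<le> fact n * exp (y::real)" if "0 \<le> y"
proof -
  have "(\<Sum>i\<in>{n}. y ^ i /\<^sub>R fact i) \<le> exp y"
    unfolding exp_def using that by (intro sum_le_suminf summable_exp_generic) auto
  then show ?thesis by (simp add: field_simps)
qed

text \<open>The quadratic decay at 0 makes the function differentiable there, with derivative 0.\<close>

lemma flat_exp_bound: "\<bar>flat_exp k x\<bar> \<le> fact (k + 2) * x\<^sup>2"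
proof (cases "x > 0")
  case True
  define F :: real where "F = fact (k + 2)"
  have "(1 / x) ^ (k + 2) \<le> F * exp (1 / x)"
    unfolding F_def using True by (intro power_le_fact_exp) auto
  then have "1 \<le> F * exp (1 / x) * (x ^ k * x\<^sup>2)"
    using True by (simp add: field_simps power_add power_one_over power2_eq_square)
  then have "exp (- (1 / x)) / x ^ k \<le> F * x\<^sup>2"
    using True by (simp add: exp_minus divide_simps mult_ac)
  then have "exp (- (1 / x)) / x ^ k \<le> fact (k + 2) * x\<^sup>2" unfolding F_def .
  then show ?thesis using True by (simp add: flat_exp_def)
qed (simp add: flat_exp_def)

lemma flat_exp_deriv:
  "(flat_exp k has_real_derivative flat_exp (k + 2) x - real k * flat_exp (k + 1) x) (at x)"
proof -
  consider "x > 0" | "x < 0" | "x = 0" by linarith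
  then show ?thesis
  proof cases
    case 1
    have "((\<lambda>x. exp (- (1 / x)) / x ^ k) has_real_derivative
        (exp (- (1 / x)) * (1 / x\<^sup>2) * x ^ k - exp (- (1 / x)) * (real k * x ^ (k - 1))) / (x ^ k * x ^ k)) (at x)"
      using 1 by (auto intro!: derivative_eq_intros simp: power2_eq_square)
    also have "(exp (- (1 / x)) * (1 / x\<^sup>2) * x ^ k - exp (- (1 / x)) * (real k * x ^ (k - 1))) / (x ^ k * x ^ k)
      = flat_exp (k + 2) x - real k * flat_exp (k + 1) x"
      using 1 by (cases k) (auto simp: flat_exp_def field_simps power_add power2_eq_square)
    finally show ?thesis
      by (rule has_field_derivative_transform_within_open[of _ _ _ "{0<..}"])
        (use 1 in \<open>auto simp: flat_exp_def\<close>)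
  next
    case 2
    show ?thesis
      by (rule has_field_derivative_transform_within_open[of "\<lambda>_. 0" _ _ "{..<0}"])
        (use 2 in \<open>auto simp: flat_exp_def\<close>)
  next
    case 3
    have "((\<lambda>h. flat_exp k h / h) \<longlongrightarrow> 0) (at 0)"
    proof (rule Lim_null_comparison)
      show "\<forall>\<^sub>F h in at 0. norm (flat_exp k h / h) \<le> fact (k + 2) * \<bar>h\<bar>"
      proof (intro eventually_at_filter[THEN iffD2] always_eventually allI impI)
        fix h :: real assume "h \<noteq> 0"
        then show "norm (flat_exp k h / h) \<le> fact (k + 2) * \<bar>h\<bar>"
          using flat_exp_bound[of k h] by (simp add: divide_simps power2_eq_square mult.assoc abs_mult_self_eq)
      qed
      have "((\<lambda>h. fact (k + 2) * \<bar>h\<bar>) \<longlongrightarrow> fact (k + 2) * \<bar>0\<bar>) (at (0::real))"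
        by (intro tendsto_intros)
      then show "((\<lambda>h. fact (k + 2) * \<bar>h\<bar>) \<longlongrightarrow> 0) (at (0::real))" by simp
    qed
    then show ?thesis using 3 by (simp add: has_field_derivative_iff flat_exp_def)
  qed
qed

text \<open>A class of functions that contains the bumps and is closed under differentiation; hence all its
  members are smooth.\<close>

inductive_set bump_span :: "real \<Rightarrow> real \<Rightarrow> real \<Rightarrow> (real \<Rightarrow> real) set" for c s e where
  base: "(\<lambda>t. C * (flat_exp k (c * (t - s)) * flat_exp l (c * (e - t)))) \<in> bump_span c s e"
| add: "f \<in> bump_span c s e \<Longrightarrow> g \<in> bump_span c s e \<Longrightarrow> (\<lambda>t. f t + g t) \<in> bump_span c s e"

lemma bump_span_deriv:
  "f \<in> bump_span c s e \<Longrightarrow> \<exists>f'\<in>bump_span c s e. \<forall>t. (f has_real_derivative f' t) (at t)"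
proof (induction rule: bump_span.induct)
  case (base C k l)
  let ?F = "\<lambda>k t. flat_exp k (c * (t - s))" and ?G = "\<lambda>k t. flat_exp k (c * (e - t))"
  have F: "(?F k has_real_derivative (?F (k + 2) t - real k * ?F (k + 1) t) * c) (at t)" for k t
    by (rule DERIV_chain2[OF flat_exp_deriv]) (auto intro!: derivative_eq_intros)
  have G: "(?G k has_real_derivative (?G (k + 2) t - real k * ?G (k + 1) t) * (- c)) (at t)" for k t
    by (rule DERIV_chain2[OF flat_exp_deriv]) (auto intro!: derivative_eq_intros)
  let ?f' = "\<lambda>t. ((C * c) * (?F (k + 2) t * ?G l t) + (- C * c * real k) * (?F (k + 1) t * ?G l t))
     + ((- C * c) * (?F k t * ?G (l + 2) t) + (C * c * real l) * (?F k t * ?G (l + 1) t))"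
  have "?f' \<in> bump_span c s e" by (intro bump_span.intros)
  moreover have "((\<lambda>t. C * (?F k t * ?G l t)) has_real_derivative ?f' t) (at t)" for t
    by (rule derivative_eq_intros F G refl)+ (simp add: algebra_simps)
  ultimately show ?case by (intro bexI[of _ ?f'] allI)
next
  case (add f g)
  then obtain f' g' where "f' \<in> bump_span c s e" "g' \<in> bump_span c s e"
    "\<forall>t. (f has_real_derivative f' t) (at t)" "\<forall>t. (g has_real_derivative g' t) (at t)" by blast
  then show ?case
    by (intro bexI[of _ "\<lambda>t. f' t + g' t"]) (auto intro: DERIV_add bump_span.add)
qed

lemma bump_span_smooth:
  assumes "f \<in> bump_span c s e"
  shows "((deriv ^^ n) f) differentiable (at t)"
proof -
  have *: "(deriv ^^ n) f \<in> bump_span c s e"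
  proof (induction n)
    case (Suc n)
    from bump_span_deriv[OF this] obtain f' where "f' \<in> bump_span c s e"
      "\<And>t. ((deriv ^^ n) f has_real_derivative f' t) (at t)" by blast
    moreover from this have "deriv ((deriv ^^ n) f) = f'" using DERIV_imp_deriv by blast
    ultimately show ?case by simp
  qed (use assms in simp)
  show ?thesis using bump_span_deriv[OF *] real_differentiable_def by blast
qed

text \<open>The parameter \<open>c\<close> is the steepness: as it grows, the bumps increase to the indicator of the interval.\<close>

definition bump :: "real \<Rightarrow> real \<Rightarrow> real \<Rightarrow> real \<Rightarrow> real" where
  "bump c s e t = flat_exp 0 (c * (t - s)) * flat_exp 0 (c * (e - t))"

lemma bump_test_function:
  assumes "c > 0" "{s..e} \<subseteq> I"
  shows "bump c s e \<in> test_functions I"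
proof -
  have "bump c s e = (\<lambda>t. 1 * (flat_exp 0 (c * (t - s)) * flat_exp 0 (c * (e - t))))"
    by (auto simp: bump_def)
  then have "bump c s e \<in> bump_span c s e" by (metis bump_span.base)
  moreover have "\<forall>t. t \<notin> {s..e} \<longrightarrow> bump c s e t = 0"
    using assms(1) by (auto simp: bump_def flat_exp_def zero_less_mult_iff)
  ultimately show ?thesis
    unfolding test_functions_def using bump_span_smooth assms(2) by blast
qed

lemma bump_bounds: "0 \<le> bump c s e t" "bump c s e t \<le> 1"
proof -
  have "0 \<le> flat_exp 0 x" "flat_exp 0 x \<le> 1" for x by (auto simp: flat_exp_def)
  then show "0 \<le> bump c s e t" "bump c s e t \<le> 1"
    by (auto simp: bump_def intro: mult_le_one)
qed

lemma bump_pos: "0 < c \<Longrightarrow> s < t \<Longrightarrow> t < e \<Longrightarrow> 0 < bump c s e t"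
  by (auto simp: bump_def flat_exp_def)

lemma bump_tendsto_indicator:
  "(\<lambda>n. bump (real (Suc n)) s e t) \<longlonglongrightarrow> indicator {s<..<e} t"
proof -
  have *: "(\<lambda>n. flat_exp 0 (real (Suc n) * x)) \<longlonglongrightarrow> (if x > 0 then 1 else 0)" for x
  proof (cases "x > 0")
    case True
    have "(\<lambda>n. exp (- (inverse (real (Suc n)) * (1 / x)))) \<longlonglongrightarrow> exp (- (0 * (1 / x)))"
      by (intro tendsto_intros LIMSEQ_inverse_real_of_nat)
    moreover have "flat_exp 0 (real (Suc n) * x) = exp (- (inverse (real (Suc n)) * (1 / x)))" for n
      using True by (simp add: flat_exp_def divide_inverse zero_less_mult_iff)
    ultimately show ?thesis using True by simp
  next
    case False
    then have "\<not> real (Suc n) * x > 0" for n by (simp add: zero_less_mult_iff)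
    then show ?thesis using False by (simp add: flat_exp_def del: of_nat_Suc)
  qed
  show ?thesis
    using tendsto_mult[OF *[of "t - s"] *[of "e - t"]]
    by (auto simp: bump_def[abs_def] indicator_def split: if_splits)
qed

lemma test_function_smooth: "\<phi> \<in> test_functions I \<Longrightarrow> ((deriv ^^ n) \<phi>) differentiable (at t)"
  by (simp add: test_functions_def)

lemma test_function_deriv: "\<phi> \<in> test_functions I \<Longrightarrow> (\<phi> has_real_derivative deriv \<phi> t) (at t)"
  using test_function_smooth[of \<phi> I 0 t] by (simp add: DERIV_deriv_iff_real_differentiable)

lemma test_function_deriv_closed:
  assumes "\<phi> \<in> test_functions I"
  shows "deriv \<phi> \<in> test_functions I"
proof -
  obtain K where K: "compact K" "K \<subseteq> I" "\<forall>t. t \<notin> K \<longrightarrow> \<phi> t = 0"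
    using assms by (auto simp: test_functions_def)
  have "deriv \<phi> t = 0" if "t \<notin> K" for t
  proof -
    have "(\<phi> has_real_derivative 0) (at t)"
      by (rule has_field_derivative_transform_within_open[of "\<lambda>_. 0" _ _ "- K"])
         (use K that in \<open>auto intro: compact_imp_closed\<close>)
    then show ?thesis by (rule DERIV_imp_deriv)
  qed
  moreover have "((deriv ^^ n) (deriv \<phi>)) differentiable (at t)" for n t
    using test_function_smooth[OF assms, of "Suc n" t] by (simp add: funpow_swap1)
  ultimately show ?thesis using K unfolding test_functions_def by blast
qed

lemma test_function_continuous: "\<phi> \<in> test_functions I \<Longrightarrow> continuous_on S \<phi>"
  by (meson DERIV_isCont continuous_at_imp_continuous_on test_function_deriv)

lemma test_function_lincomb:
  assumes f: "f \<in> test_functions I" and g: "g \<in> test_functions I"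
  shows "(\<lambda>t. f t + c * g t) \<in> test_functions I"
proof -
  have eq: "(deriv ^^ n) (\<lambda>t. f t + c * g t) = (\<lambda>t. (deriv ^^ n) f t + c * (deriv ^^ n) g t)" for n
  proof (induction n)
    case (Suc n)
    have "((deriv ^^ n) f has_real_derivative deriv ((deriv ^^ n) f) t) (at t)"
      "((deriv ^^ n) g has_real_derivative deriv ((deriv ^^ n) g) t) (at t)" for t
      using test_function_smooth[OF f] test_function_smooth[OF g]
      by (auto simp: DERIV_deriv_iff_real_differentiable)
    then have "((\<lambda>t. (deriv ^^ n) f t + c * (deriv ^^ n) g t) has_real_derivative
       deriv ((deriv ^^ n) f) t + c * deriv ((deriv ^^ n) g) t) (at t)" for t
      by (intro DERIV_add DERIV_cmult)
    then show ?case using DERIV_imp_deriv by (fastforce simp: Suc)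
  qed simp
  obtain K L where K: "compact K" "K \<subseteq> I" "\<forall>t. t \<notin> K \<longrightarrow> f t = 0"
    and L: "compact L" "L \<subseteq> I" "\<forall>t. t \<notin> L \<longrightarrow> g t = 0"
    using f g by (auto simp: test_functions_def)
  have "((deriv ^^ n) (\<lambda>t. f t + c * g t)) differentiable (at t)" for n t
    unfolding eq using test_function_smooth[OF f] test_function_smooth[OF g] by simp
  moreover have "compact (K \<union> L)" "K \<union> L \<subseteq> I" "\<forall>t. t \<notin> K \<union> L \<longrightarrow> f t + c * g t = 0"
    using K L by auto
  ultimately show ?thesis unfolding test_functions_def by blast
qed

lemma test_function_support:
  assumes "\<phi> \<in> test_functions {\<alpha><..<\<beta>}" "\<alpha> < \<beta>"
  obtains s e where "\<alpha> < s" "s \<le> e" "e < \<beta>" "\<And>t. t \<notin> {s..e} \<Longrightarrow> \<phi> t = 0"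
proof -
  obtain K where K: "compact K" "K \<subseteq> {\<alpha><..<\<beta>}" "\<forall>t. t \<notin> K \<longrightarrow> \<phi> t = 0"
    using assms by (auto simp: test_functions_def)
  show ?thesis
  proof (cases "K = {}")
    case True
    then show ?thesis using that[of "(\<alpha> + \<beta>) / 2" "(\<alpha> + \<beta>) / 2"] K assms(2) by auto
  next
    case False
    obtain s where s: "s \<in> K" "\<And>t. t \<in> K \<Longrightarrow> s \<le> t" using compact_attains_inf[OF K(1) False] by auto
    obtain e where e: "e \<in> K" "\<And>t. t \<in> K \<Longrightarrow> t \<le> e" using compact_attains_sup[OF K(1) False] by auto
    show ?thesis
    proof (rule that[of s e])
      show "\<alpha> < s" "e < \<beta>" using s(1) e(1) K(2) by auto
      show "s \<le> e" using s(2)[OF e(1)] .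
      show "\<phi> t = 0" if "t \<notin> {s..e}" for t
      proof -
        have "t \<notin> K" using that s(2) e(2) by auto
        then show ?thesis using K(3) by simp
      qed
    qed
  qed
qed

text \<open>Mean value 0 is what makes the primitive vanish to the right of the support.\<close>

lemma test_function_primitive:
  assumes \<phi>: "\<phi> \<in> test_functions {\<alpha><..<\<beta>}" and ab: "\<alpha> < \<beta>" and zero: "integral {\<alpha>..\<beta>} \<phi> = 0"
  obtains \<Phi> where "\<Phi> \<in> test_functions {\<alpha><..<\<beta>}" "deriv \<Phi> = \<phi>"
proof -
  obtain s e where se: "\<alpha> < s" "s \<le> e" "e < \<beta>" "\<And>t. t \<notin> {s..e} \<Longrightarrow> \<phi> t = 0"
    using test_function_support[OF \<phi> ab] by metis
  have int: "\<phi> integrable_on {u..v}" for u v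
    by (intro integrable_continuous_real test_function_continuous[OF \<phi>])
  \<comment> \<open>For \<open>t < \<alpha>\<close> the interval is empty and the integral is 0, as it should be.\<close>
  define \<Phi> where "\<Phi> t = integral {\<alpha>..t} \<phi>" for t
  have left: "\<Phi> t = 0" if "t < s" for t
    unfolding \<Phi>_def using that se by (intro integral_unique has_integral_is_0) auto
  have right: "\<Phi> t = 0" if "e < t" for t
  proof -
    have "\<Phi> \<beta> = integral {\<alpha>..e} \<phi> + integral {e..\<beta>} \<phi>"
      unfolding \<Phi>_def by (rule Henstock_Kurzweil_Integration.integral_combine[symmetric]) (use se int in auto)
    moreover have "\<Phi> t = integral {\<alpha>..e} \<phi> + integral {e..t} \<phi>"
      unfolding \<Phi>_def by (rule Henstock_Kurzweil_Integration.integral_combine[symmetric]) (use se that int in auto)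
    moreover have "integral {e..v} \<phi> = 0" for v
      by (intro integral_unique has_integral_negligible[of "{e}"]) (use se(4) in auto)
    ultimately show ?thesis using zero by (simp add: \<Phi>_def)
  qed
  have der: "(\<Phi> has_real_derivative \<phi> t) (at t)" for t
  proof (cases "t < s")
    case True
    have "(\<Phi> has_real_derivative 0) (at t)"
      by (rule has_field_derivative_transform_within_open[of "\<lambda>_. 0" _ _ "{..<s}"]) (use True left in auto)
    then show ?thesis using True se(4) by simp
  next
    case False
    have "(\<Phi> has_real_derivative \<phi> t) (at t within {\<alpha>..t + 1})"
      unfolding \<Phi>_def[abs_def]
      by (rule integral_has_real_derivative[OF test_function_continuous[OF \<phi>]]) (use False se in auto)
    moreover have "at t within {\<alpha>..t + 1} = at t"
      by (rule at_within_interior) (use False se in auto)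
    ultimately show ?thesis by simp
  qed
  then have d: "deriv \<Phi> = \<phi>" using DERIV_imp_deriv by blast
  have "((deriv ^^ n) \<Phi>) differentiable (at t)" for n t
  proof (cases n)
    case 0
    then show ?thesis using der real_differentiable_def by (metis funpow_0)
  next
    case (Suc n')
    then show ?thesis using test_function_smooth[OF \<phi>, of n' t] d by (simp add: funpow_swap1)
  qed
  moreover have "\<forall>t. t \<notin> {s..e} \<longrightarrow> \<Phi> t = 0" using left right by (auto simp: not_le)
  moreover have "{s..e} \<subseteq> {\<alpha><..<\<beta>}" using se by auto
  ultimately have "\<Phi> \<in> test_functions {\<alpha><..<\<beta>}" unfolding test_functions_def by blast
  then show ?thesis using that d by blast
qed

lemma negligible_support_of_zero_integral:
  fixes g :: "real \<Rightarrow> real"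
  assumes "(g has_integral 0) S" "\<And>x. x \<in> S \<Longrightarrow> 0 \<le> g x"
  shows "negligible {x \<in> S. g x \<noteq> 0}"
proof -
  define h where "h x = (if x \<in> S then g x else 0)" for x
  have "(h has_integral 0) UNIV" using assms(1) by (simp add: h_def[abs_def] has_integral_restrict_UNIV)
  moreover have "\<And>x. 0 \<le> h x" using assms(2) by (simp add: h_def)
  ultimately have h: "h \<in> borel_measurable lebesgue" "integral\<^sup>N lebesgue h = 0"
    using has_integral_iff_nn_integral_lebesgue[of h 0] by auto
  then have "AE x in lebesgue. ennreal (h x) = 0"
    by (subst (asm) nn_integral_0_iff_AE) auto
  then have "AE x in lebesgue. h x = 0"
    using \<open>\<And>x. 0 \<le> h x\<close> by (auto simp: ennreal_eq_0_iff elim!: eventually_mono intro: antisym)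
  then have "{x. h x \<noteq> 0} \<in> null_sets lebesgue"
    using measurable_sets[OF h(1), of "- {0}"] by (subst (asm) AE_iff_null) (auto simp: vimage_def)
  moreover have "{x. h x \<noteq> 0} = {x \<in> S. g x \<noteq> 0}" by (auto simp: h_def split: if_splits)
  ultimately show ?thesis by (simp add: negligible_iff_null_sets)
qed

text \<open>By Henstock's lemma the Riemann sums of \<open>norm h\<close> tend to 0, since every summand is the distance of
  \<open>content K *\<^sub>R h x\<close> from the integral of \<open>h\<close> over \<open>K\<close>, which is 0.  So \<open>norm h\<close> has integral 0.\<close>

lemma negligible_if_interval_integrals_zero:
  fixes h :: "real \<Rightarrow> 'a::euclidean_space"
  assumes int: "h integrable_on {a..b}" and zero: "\<And>s t. a \<le> s \<Longrightarrow> s \<le> t \<Longrightarrow> t \<le> b \<Longrightarrow> integral {s..t} h = 0"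
  shows "negligible {x \<in> {a..b}. h x \<noteq> 0}"
proof -
  have "((\<lambda>x. norm (h x)) has_integral 0) {a..b}"
    unfolding has_integral_real
  proof (intro allI impI)
    fix e :: real assume "e > 0"
    with Henstock_lemma[of h a b e] int obtain \<gamma> where \<gamma>: "gauge \<gamma>"
      "\<And>p. p tagged_partial_division_of {a..b} \<Longrightarrow> \<gamma> fine p \<Longrightarrow>
         (\<Sum>(x,k)\<in>p. norm (measure lborel k *\<^sub>R h x - integral k h)) < e" by auto
    show "\<exists>\<gamma>. gauge \<gamma> \<and> (\<forall>\<D>. \<D> tagged_division_of {a..b} \<and> \<gamma> fine \<D> \<longrightarrow>
        norm ((\<Sum>(x,K)\<in>\<D>. measure lborel K *\<^sub>R norm (h x)) - 0) < e)"
    proof (rule exI[of _ \<gamma>], intro conjI allI impI \<gamma>(1))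
      fix \<D> assume \<D>: "\<D> tagged_division_of {a..b} \<and> \<gamma> fine \<D>"
      have "(\<Sum>(x,K)\<in>\<D>. measure lborel K *\<^sub>R norm (h x)) = (\<Sum>(x,k)\<in>\<D>. norm (measure lborel k *\<^sub>R h x - integral k h))"
      proof (rule sum.cong[OF refl], clarify)
        fix x K assume xK: "(x, K) \<in> \<D>"
        obtain u v where uv: "K = {u..v}" using tagged_division_ofD(4)[OF conjunct1[OF \<D>] xK] by auto
        have "x \<in> K" "K \<subseteq> {a..b}" using tagged_division_ofD(2,3)[OF conjunct1[OF \<D>] xK] by auto
        then have "integral K h = 0" unfolding uv by (intro zero) auto
        then show "measure lborel K *\<^sub>R norm (h x) = norm (measure lborel K *\<^sub>R h x - integral K h)" by simp
      qed
      also have "\<dots> < e" using \<gamma>(2) \<D> by (simp add: tagged_division_of_def)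
      finally have "(\<Sum>(x,K)\<in>\<D>. measure lborel K *\<^sub>R norm (h x)) < e" .
      moreover have "0 \<le> (\<Sum>(x,K)\<in>\<D>. measure lborel K *\<^sub>R norm (h x))"
        by (intro sum_nonneg) auto
      ultimately show "norm ((\<Sum>(x,K)\<in>\<D>. measure lborel K *\<^sub>R norm (h x)) - 0) < e" by simp
    qed
  qed
  from negligible_support_of_zero_integral[OF this] show ?thesis by simp
qed

lemma integral_cts_scaleR_integrable:
  fixes h :: "real \<Rightarrow> 'a::euclidean_space"
  assumes "continuous_on {a..b} \<phi>" "h absolutely_integrable_on {a..b}"
  shows "(\<lambda>t. \<phi> t *\<^sub>R h t) integrable_on {a..b}"
  using absolutely_integrable_continuous_product[OF bounded_bilinear_scaleR assms]
  by (rule set_lebesgue_integral_eq_integral(1))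

text \<open>Bumps of growing steepness approximate the indicator of an interval, so \<open>h\<close> has integral 0 over every
  interval inside the open interval and, by continuity of the indefinite integral, over every subinterval
  of the closed one.\<close>

lemma fundamental_lemma_calculus_of_variations:
  fixes h :: "real \<Rightarrow> 'a::euclidean_space"
  assumes ab: "\<alpha> < \<beta>" and h: "h absolutely_integrable_on {\<alpha>..\<beta>}"
    and zero: "\<And>\<phi>. \<phi> \<in> test_functions {\<alpha><..<\<beta>} \<Longrightarrow> integral {\<alpha>..\<beta>} (\<lambda>t. \<phi> t *\<^sub>R h t) = 0"
  shows "negligible {t \<in> {\<alpha>..\<beta>}. h t \<noteq> 0}"
proof -
  have hint: "h integrable_on {s..e}" if "{s..e} \<subseteq> {\<alpha>..\<beta>}" for s e
    using h that by (meson absolutely_integrable_on_def integrable_on_subinterval)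
  have inner: "integral {s..e} h = 0" if se: "\<alpha> < s" "e < \<beta>" for s e
  proof -
    have "(\<lambda>k. integral {\<alpha>..\<beta>} (\<lambda>t. bump (real (Suc k)) s e t *\<^sub>R h t)) \<longlonglongrightarrow>
        integral {\<alpha>..\<beta>} (\<lambda>t. indicator {s<..<e} t *\<^sub>R h t)"
    proof (rule dominated_convergence(2))
      show "(\<lambda>t. bump (real (Suc k)) s e t *\<^sub>R h t) integrable_on {\<alpha>..\<beta>}" for k
        using se by (intro integral_cts_scaleR_integrable h test_function_continuous[OF bump_test_function[OF _ subset_UNIV]]) auto
      show "(\<lambda>t. norm (h t)) integrable_on {\<alpha>..\<beta>}" using h by (simp add: absolutely_integrable_on_def)
      show "norm (bump (real (Suc k)) s e t *\<^sub>R h t) \<le> norm (h t)" for k t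
        using bump_bounds[of "real (Suc k)" s e t] by (simp add: mult_left_le_one_le)
      show "(\<lambda>k. bump (real (Suc k)) s e t *\<^sub>R h t) \<longlonglongrightarrow> indicator {s<..<e} t *\<^sub>R h t" for t
        by (intro tendsto_scaleR bump_tendsto_indicator tendsto_const)
    qed
    moreover have "integral {\<alpha>..\<beta>} (\<lambda>t. bump (real (Suc k)) s e t *\<^sub>R h t) = 0" for k
      using se by (intro zero bump_test_function) auto
    ultimately have "integral {\<alpha>..\<beta>} (\<lambda>t. indicator {s<..<e} t *\<^sub>R h t) = 0"
      by (simp add: LIMSEQ_const_iff)
    moreover have "integral {\<alpha>..\<beta>} (\<lambda>t. indicator {s<..<e} t *\<^sub>R h t) = integral {s<..<e} h"
    proof -
      have 1: "(\<lambda>t. indicator {s<..<e} t *\<^sub>R h t) = (\<lambda>t. if t \<in> {s<..<e} then h t else 0)"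
        by (auto simp: indicator_def)
      have 2: "{s<..<e} \<inter> {\<alpha>..\<beta>} = {s<..<e}" using se by auto
      show ?thesis unfolding 1 integral_restrict_Int 2 ..
    qed
    ultimately show ?thesis by (simp add: integral_open_interval_real)
  qed
  define F where "F x = integral {\<alpha>..x} h" for x
  have Fc: "continuous_on {\<alpha>..\<beta>} F"
    unfolding F_def[abs_def] by (intro indefinite_integral_continuous_1 hint) auto
  have comb: "F e - F s = integral {s..e} h" if "\<alpha> \<le> s" "s \<le> e" "e \<le> \<beta>" for s e
    using Henstock_Kurzweil_Integration.integral_combine[OF that(1,2) hint] that by (auto simp: F_def algebra_simps)
  define m where "m = (\<alpha> + \<beta>) / 2"
  have m: "\<alpha> < m" "m < \<beta>" using ab by (auto simp: m_def)
  have Fm: "F x = F m" if x: "\<alpha> < x" "x < \<beta>" for x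
  proof (cases "x \<le> m")
    case True
    have "F m - F x = integral {x..m} h" by (rule comb) (use True m x in auto)
    then show ?thesis using inner[OF x(1) m(2)] by simp
  next
    case False
    have "F x - F m = integral {m..x} h" by (rule comb) (use False m x in auto)
    then show ?thesis using inner[OF m(1) x(2)] by simp
  qed
  have "F x = F m" if "x \<in> {\<alpha>..\<beta>}" for x
  proof (rule continuous_constant_on_closure[of "{\<alpha><..<\<beta>}"])
    show "continuous_on (closure {\<alpha><..<\<beta>}) F" using Fc ab by simp
    show "x \<in> closure {\<alpha><..<\<beta>}" using that ab by simp
  qed (use Fm in auto)
  then have "integral {s..e} h = 0" if "\<alpha> \<le> s" "s \<le> e" "e \<le> \<beta>" for s e
    using comb[OF that] that by (metis atLeastAtMost_iff order_trans right_minus_eq)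
  then show ?thesis
    using negligible_if_interval_integrals_zero[OF hint] by blast
qed

lemma test_function_primitive_on:
  assumes "\<phi> \<in> test_functions I" "bounded S"
  shows "primitive_on S \<phi> (deriv \<phi>)"
proof (rule primitive_on_derivative)
  have "continuous_on (closure S) (deriv \<phi>)"
    by (rule test_function_continuous[OF test_function_deriv_closed[OF assms(1)]])
  then have "bounded (deriv \<phi> ` closure S)"
    using assms(2) by (intro compact_imp_bounded compact_continuous_image) (simp_all add: compact_closure)
  then show "bounded (deriv \<phi> ` S)" by (rule bounded_subset) (use closure_subset in blast)
  show "(\<phi> has_vector_derivative deriv \<phi> t) (at t within S)" for t
    by (rule has_vector_derivative_at_within)
      (use test_function_deriv[OF assms(1), of t] in \<open>simp add: has_real_derivative_iff_has_vector_derivative\<close>)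
qed

text \<open>Subtracting the primitive of \<open>g\<close> reduces the claim to \<open>g = 0\<close>.  Any test function \<open>\<psi>\<close> becomes a
  derivative of a test function after subtracting a multiple of a fixed bump, so the difference \<open>k\<close> is
  orthogonal to all test functions up to a constant \<open>c\<close>.\<close>

lemma du_Bois_Reymond:
  fixes h g :: "real \<Rightarrow> 'a::euclidean_space"
  assumes ab: "\<alpha> < \<beta>" and h: "h absolutely_integrable_on {\<alpha>..\<beta>}"
    and g: "g integrable_on {\<alpha>..\<beta>}" "bounded (g ` {\<alpha>..\<beta>})"
    and weak: "\<And>\<phi>. \<phi> \<in> test_functions {\<alpha><..<\<beta>} \<Longrightarrow>
      integral {\<alpha>..\<beta>} (\<lambda>t. deriv \<phi> t *\<^sub>R h t) = - integral {\<alpha>..\<beta>} (\<lambda>t. \<phi> t *\<^sub>R g t)"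
  obtains c where "negligible {t \<in> {\<alpha>..\<beta>}. h t \<noteq> c + integral {\<alpha>..t} g}"
proof -
  let ?T = "test_functions {\<alpha><..<\<beta>}"
  define G where "G t = integral {\<alpha>..t} g" for t
  have G: "primitive_on {\<alpha>..\<beta>} G g"
    by (rule primitive_on_integral[OF g, of _ 0]) (simp add: G_def)
  have Gc: "continuous_on {\<alpha>..\<beta>} G"
    by (rule primitive_on_continuous[OF G]) (simp add: is_interval_cc)
  have Ga: "G absolutely_integrable_on {\<alpha>..\<beta>}" by (rule absolutely_integrable_continuous_real[OF Gc])
  have gabs: "g absolutely_integrable_on {\<alpha>..\<beta>}" by (rule primitive_on_integrable[OF G]) simp
  have byparts: "integral {\<alpha>..\<beta>} (\<lambda>t. deriv \<phi> t *\<^sub>R G t) = - integral {\<alpha>..\<beta>} (\<lambda>t. \<phi> t *\<^sub>R g t)"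
    if \<phi>: "\<phi> \<in> ?T" for \<phi>
  proof -
    have dc: "continuous_on {\<alpha>..\<beta>} (deriv \<phi>)" "continuous_on {\<alpha>..\<beta>} \<phi>"
      using test_function_continuous test_function_deriv_closed \<phi> by blast+
    have "primitive_on {\<alpha>..\<beta>} \<phi> (deriv \<phi>)" by (rule test_function_primitive_on[OF \<phi>]) simp
    from primitive_on_bilinear[OF bounded_bilinear_scaleR this G] have
      "primitive_on {\<alpha>..\<beta>} (\<lambda>t. \<phi> t *\<^sub>R G t) (\<lambda>t. deriv \<phi> t *\<^sub>R G t + \<phi> t *\<^sub>R g t)"
      by (simp add: is_interval_cc)
    from primitive_onD[OF this, of \<alpha> \<beta>] have
      "((\<lambda>t. deriv \<phi> t *\<^sub>R G t + \<phi> t *\<^sub>R g t) has_integral \<phi> \<beta> *\<^sub>R G \<beta> - \<phi> \<alpha> *\<^sub>R G \<alpha>) {\<alpha>..\<beta>}"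
      using ab by auto
    moreover have "\<phi> \<beta> = 0" "\<phi> \<alpha> = 0" using \<phi> by (auto simp: test_functions_def)
    ultimately have "integral {\<alpha>..\<beta>} (\<lambda>t. deriv \<phi> t *\<^sub>R G t + \<phi> t *\<^sub>R g t) = 0"
      by (simp add: integral_unique)
    then show ?thesis
      by (subst (asm) Henstock_Kurzweil_Integration.integral_add)
         (auto intro!: integral_cts_scaleR_integrable dc Ga gabs simp: eq_neg_iff_add_eq_0)
  qed
  define k where "k t = h t - G t" for t
  have ka: "k absolutely_integrable_on {\<alpha>..\<beta>}"
    unfolding k_def[abs_def] by (intro set_integral_diff h Ga)
  have kzero: "integral {\<alpha>..\<beta>} (\<lambda>t. deriv \<phi> t *\<^sub>R k t) = 0" if \<phi>: "\<phi> \<in> ?T" for \<phi>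
  proof -
    have dc: "continuous_on {\<alpha>..\<beta>} (deriv \<phi>)"
      using test_function_continuous test_function_deriv_closed \<phi> by blast
    have "integral {\<alpha>..\<beta>} (\<lambda>t. deriv \<phi> t *\<^sub>R k t) =
       integral {\<alpha>..\<beta>} (\<lambda>t. deriv \<phi> t *\<^sub>R h t) - integral {\<alpha>..\<beta>} (\<lambda>t. deriv \<phi> t *\<^sub>R G t)"
      unfolding k_def scaleR_diff_right
      by (intro Henstock_Kurzweil_Integration.integral_diff integral_cts_scaleR_integrable dc h Ga)
    then show ?thesis using weak[OF \<phi>] byparts[OF \<phi>] by simp
  qed
  define s where "s = (2 * \<alpha> + \<beta>) / 3"
  define e where "e = (\<alpha> + 2 * \<beta>) / 3"
  have se: "\<alpha> < s" "s < e" "e < \<beta>" using ab by (auto simp: s_def e_def)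
  have b: "bump 1 s e \<in> ?T" using se by (intro bump_test_function) auto
  have bpos: "integral {\<alpha>..\<beta>} (bump 1 s e) > 0"
  proof -
    have bi: "bump 1 s e integrable_on {\<alpha>..\<beta>}"
      by (intro integrable_continuous_real test_function_continuous[OF b])
    have "integral {\<alpha>..\<beta>} (bump 1 s e) \<noteq> 0"
    proof
      assume "integral {\<alpha>..\<beta>} (bump 1 s e) = 0"
      then have "(bump 1 s e has_integral 0) {\<alpha>..\<beta>}" using bi by (metis integrable_integral)
      then have "bump 1 s e ((s + e) / 2) = 0"
        using has_integral_0_cbox_imp_0[of \<alpha> \<beta> "bump 1 s e" "(s + e) / 2"] test_function_continuous[OF b]
          bump_bounds(1) se ab by auto
      then show False using bump_pos[of 1 s "(s + e) / 2" e] se by auto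
    qed
    then show ?thesis using Henstock_Kurzweil_Integration.integral_nonneg[OF bi] bump_bounds(1) by (metis less_eq_real_def)
  qed
  define b0 where "b0 = integral {\<alpha>..\<beta>} (bump 1 s e)"
  define c where "c = integral {\<alpha>..\<beta>} (\<lambda>t. bump 1 s e t *\<^sub>R k t) /\<^sub>R b0"
  have "integral {\<alpha>..\<beta>} (\<lambda>t. \<psi> t *\<^sub>R (k t - c)) = 0" if \<psi>: "\<psi> \<in> ?T" for \<psi>
  proof -
    define d where "d = integral {\<alpha>..\<beta>} \<psi>"
    define \<theta> where "\<theta> t = \<psi> t + (- d / b0) * bump 1 s e t" for t
    have \<theta>T: "\<theta> \<in> ?T" unfolding \<theta>_def[abs_def] by (rule test_function_lincomb[OF \<psi> b])
    have pint: "\<psi> integrable_on {\<alpha>..\<beta>}" "bump 1 s e integrable_on {\<alpha>..\<beta>}"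
      by (intro integrable_continuous_real test_function_continuous[OF \<psi>] test_function_continuous[OF b])+
    have "(\<theta> has_integral d + (- d / b0) * b0) {\<alpha>..\<beta>}"
      unfolding \<theta>_def[abs_def] d_def b0_def
      by (intro has_integral_add has_integral_mult_right integrable_integral pint)
    then have "integral {\<alpha>..\<beta>} \<theta> = 0" using bpos by (simp add: b0_def integral_unique)
    then obtain \<Phi> where "\<Phi> \<in> ?T" "deriv \<Phi> = \<theta>" using test_function_primitive[OF \<theta>T ab] by metis
    from kzero[OF this(1)] this(2) have z: "integral {\<alpha>..\<beta>} (\<lambda>t. \<theta> t *\<^sub>R k t) = 0" by simp
    have pk: "(\<lambda>t. \<psi> t *\<^sub>R k t) integrable_on {\<alpha>..\<beta>}" "(\<lambda>t. bump 1 s e t *\<^sub>R k t) integrable_on {\<alpha>..\<beta>}"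
      by (intro integral_cts_scaleR_integrable ka test_function_continuous[OF \<psi>] test_function_continuous[OF b])+
    have "((\<lambda>t. \<psi> t *\<^sub>R k t + (- d / b0) *\<^sub>R (bump 1 s e t *\<^sub>R k t)) has_integral
      (integral {\<alpha>..\<beta>} (\<lambda>t. \<psi> t *\<^sub>R k t) + (- d / b0) *\<^sub>R integral {\<alpha>..\<beta>} (\<lambda>t. bump 1 s e t *\<^sub>R k t))) {\<alpha>..\<beta>}"
      by (intro has_integral_add has_integral_cmul integrable_integral pk)
    then have "integral {\<alpha>..\<beta>} (\<lambda>t. \<theta> t *\<^sub>R k t) =
       integral {\<alpha>..\<beta>} (\<lambda>t. \<psi> t *\<^sub>R k t) + (- d / b0) *\<^sub>R integral {\<alpha>..\<beta>} (\<lambda>t. bump 1 s e t *\<^sub>R k t)"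
      by (intro integral_unique) (simp add: \<theta>_def scaleR_add_left scaleR_diff_left)
    then have k1: "integral {\<alpha>..\<beta>} (\<lambda>t. \<psi> t *\<^sub>R k t) = d *\<^sub>R c"
      using z by (simp add: c_def divide_inverse algebra_simps add_eq_0_iff)
    have "((\<lambda>t. \<psi> t *\<^sub>R k t) has_integral d *\<^sub>R c) {\<alpha>..\<beta>}"
      using integrable_integral[OF pk(1)] by (simp add: k1)
    moreover have "((\<lambda>t. \<psi> t *\<^sub>R c) has_integral d *\<^sub>R c) {\<alpha>..\<beta>}"
      unfolding d_def by (rule has_integral_scaleR_left[OF integrable_integral[OF pint(1)]])
    ultimately have "((\<lambda>t. \<psi> t *\<^sub>R k t - \<psi> t *\<^sub>R c) has_integral (d *\<^sub>R c - d *\<^sub>R c)) {\<alpha>..\<beta>}"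
      by (rule has_integral_diff)
    then show ?thesis by (simp add: scaleR_diff_right integral_unique)
  qed
  from fundamental_lemma_calculus_of_variations[OF ab _ this] ka
  have "negligible {t \<in> {\<alpha>..\<beta>}. k t - c \<noteq> 0}"
    by (auto intro!: set_integral_diff absolutely_integrable_continuous_real)
  then have "negligible {t \<in> {\<alpha>..\<beta>}. h t \<noteq> c + integral {\<alpha>..t} g}"
    by (rule negligible_subset) (auto simp: k_def G_def algebra_simps)
  then show ?thesis by (rule that)
qed

section \<open>Weak derivatives of order two\<close>

lemma AE_lebesgue_onE:
  assumes "AE t in lebesgue_on S. P t" "S \<in> sets lebesgue"
  obtains N where "negligible N" "\<And>t. t \<in> S - N \<Longrightarrow> P t"
proof -
  obtain N where N: "N \<in> null_sets (lebesgue_on S)" "{t \<in> space (lebesgue_on S). \<not> P t} \<subseteq> N"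
    using assms(1) by (auto simp: eventually_ae_filter)
  then have "negligible N"
    using assms(2) by (simp add: null_sets_restrict_space negligible_iff_null_sets)
  then show ?thesis using that N(2) by (auto simp: space_restrict_space)
qed

lemma AE_lebesgue_onI:
  assumes "negligible N" "\<And>t. t \<in> S - N \<Longrightarrow> P t" "S \<in> sets lebesgue"
  shows "AE t in lebesgue_on S. P t"
proof -
  have "N \<inter> S \<in> null_sets (lebesgue_on S)"
    using assms(1,3) negligible_subset[of N "N \<inter> S"] by (auto simp: null_sets_restrict_space negligible_iff_null_sets[symmetric])
  moreover have "{t \<in> space (lebesgue_on S). \<not> P t} \<subseteq> N \<inter> S" using assms(2) by (auto simp: space_restrict_space)
  ultimately show ?thesis unfolding eventually_ae_filter by blast
qed

text \<open>On a null set the essential supremum is \<open>- \<infinity>\<close>, which converts to 0; the claim is then vacuous.\<close>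

lemma Linf_AE_bound:
  assumes "f \<in> Linf S"
  shows "AE t in lebesgue_on S. norm (f t) \<le> Linf_norm S f"
proof -
  let ?e = "esssup (lebesgue_on S) (\<lambda>t. ereal (norm (f t)))"
  have "AE t in lebesgue_on S. ereal (norm (f t)) \<le> ?e" by (rule esssup_AE)
  moreover have "?e < \<infinity>" using assms by (simp add: Linf_def)
  ultimately show ?thesis
    unfolding Linf_norm_def by (cases ?e) auto
qed

lemma Linf_norm_nonneg:
  assumes "f \<in> Linf S" "\<not> negligible S" "S \<in> sets lebesgue"
  shows "0 \<le> Linf_norm S f"
proof (rule ccontr)
  assume "\<not> 0 \<le> Linf_norm S f"
  obtain N where N: "negligible N" "\<And>t. t \<in> S - N \<Longrightarrow> norm (f t) \<le> Linf_norm S f"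
    using AE_lebesgue_onE[OF Linf_AE_bound[OF assms(1)] assms(3)] by metis
  have "S \<subseteq> N" using N(2) \<open>\<not> 0 \<le> Linf_norm S f\<close> norm_ge_zero order_trans by (metis DiffI subsetI)
  then show False using N(1) assms(2) negligible_subset by blast
qed

lemma bounded_measurable_Linf:
  assumes "f \<in> borel_measurable (lebesgue_on S)" "bounded (f ` S)"
  shows "f \<in> Linf S"
proof -
  obtain C where C: "\<And>t. t \<in> S \<Longrightarrow> norm (f t) \<le> C" using assms(2) by (auto simp: bounded_iff)
  have "esssup (lebesgue_on S) (\<lambda>t. ereal (norm (f t))) \<le> ereal C"
    by (rule esssup_I) (use assms(1) C in \<open>auto simp: space_restrict_space intro!: AE_I2\<close>)
  then show ?thesis using assms(1) by (auto simp: Linf_def)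
qed

lemma bounded_measurable_absolutely_integrable:
  fixes f :: "real \<Rightarrow> 'a::euclidean_space"
  assumes "f \<in> borel_measurable (lebesgue_on S)" "bounded (f ` S)" "S \<in> lmeasurable"
  shows "f absolutely_integrable_on S"
proof -
  obtain C where C: "\<And>t. t \<in> S \<Longrightarrow> norm (f t) \<le> C" using assms(2) by (auto simp: bounded_iff)
  show ?thesis
    by (rule measurable_bounded_by_integrable_imp_absolutely_integrable[where g = "\<lambda>_. C"])
      (use assms C integrable_on_const in auto)
qed

lemma Linf_measurable: "f \<in> Linf S \<Longrightarrow> f \<in> borel_measurable (lebesgue_on S)"
  by (simp add: Linf_def)

text \<open>Elements of \<open>Linf\<close> are bounded only almost everywhere, primitives require bounds everywhere.\<close>

lemma Linf_bounded_representative: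
  fixes f :: "real \<Rightarrow> 'a::euclidean_space"
  assumes "f \<in> Linf S" "S \<in> sets lebesgue"
  obtains g N where "negligible N" "\<And>t. t \<in> S - N \<Longrightarrow> f t = g t"
    "g \<in> borel_measurable (lebesgue_on S)" "\<And>t. norm (g t) \<le> \<bar>Linf_norm S f\<bar>" 
proof -
  let ?C = "\<bar>Linf_norm S f\<bar>"
  obtain N where N: "negligible N" "\<And>t. t \<in> S - N \<Longrightarrow> norm (f t) \<le> Linf_norm S f"
    using AE_lebesgue_onE[OF Linf_AE_bound[OF assms(1)] assms(2)] by metis
  define g where "g t = (if norm (f t) \<le> ?C then f t else 0)" for t
  have "g \<in> borel_measurable (lebesgue_on S)"
    unfolding g_def[abs_def] using Linf_measurable[OF assms(1)] by measurable
  moreover have "f t = g t" if "t \<in> S - N" for t using order_trans[OF N(2)[OF that] abs_ge_self] by (simp add: g_def)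
  moreover have "norm (g t) \<le> ?C" for t by (simp add: g_def)
  ultimately show ?thesis using that N(1) by blast
qed

lemma absolutely_integrable_closed_interval:
  fixes f :: "real \<Rightarrow> 'a::euclidean_space"
  assumes "f absolutely_integrable_on {\<alpha><..<\<beta>}"
  shows "f absolutely_integrable_on {\<alpha>..\<beta>}"
  using assms by (simp add: absolutely_integrable_on_def integrable_on_open_interval_real)

lemma open_interval_lebesgue: "{\<alpha><..<\<beta>::real} \<in> sets lebesgue"
  by simp

lemma lmeasurable_box_real: "{\<alpha><..<\<beta>::real} \<in> lmeasurable"
  using lmeasurable_box[of \<alpha> \<beta>] by simp

lemma Linf_integrable_representative:
  fixes f :: "real \<Rightarrow> 'a::euclidean_space"
  assumes "f \<in> Linf {\<alpha><..<\<beta>}"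
  obtains g N where "negligible N" "\<And>t. t \<in> {\<alpha><..<\<beta>} - N \<Longrightarrow> f t = g t"
    "g absolutely_integrable_on {\<alpha>..\<beta>}" "\<And>X. bounded (g ` X)"
proof (rule Linf_bounded_representative[OF assms open_interval_lebesgue])
  fix g N
  assume g: "negligible N" "\<And>t. t \<in> {\<alpha><..<\<beta>} - N \<Longrightarrow> f t = g t"
    "g \<in> borel_measurable (lebesgue_on {\<alpha><..<\<beta>})" "\<And>t. norm (g t) \<le> \<bar>Linf_norm {\<alpha><..<\<beta>} f\<bar>"
  have b: "bounded (g ` X)" for X by (rule bounded_imageI[OF g(4)])
  show thesis
    by (rule that[OF g(1,2) absolutely_integrable_closed_interval[OF bounded_measurable_absolutely_integrable[OF g(3) b lmeasurable_box_real]] b])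
qed

lemma LINT_open_interval:
  fixes f g :: "real \<Rightarrow> 'a::euclidean_space"
  assumes "f \<in> borel_measurable (lebesgue_on {\<alpha><..<\<beta>})" "continuous_on {\<alpha>..\<beta>} \<psi>"
    and g: "g absolutely_integrable_on {\<alpha>..\<beta>}" and N: "negligible N" "\<And>t. t \<in> {\<alpha><..<\<beta>} - N \<Longrightarrow> f t = g t"
  shows "(LINT t|lebesgue_on {\<alpha><..<\<beta>}. \<psi> t *\<^sub>R f t) = integral {\<alpha>..\<beta>} (\<lambda>t. \<psi> t *\<^sub>R g t)"
proof -
  have "(\<lambda>t. \<psi> t *\<^sub>R g t) absolutely_integrable_on {\<alpha>..\<beta>}"
    by (rule absolutely_integrable_continuous_product[OF bounded_bilinear_scaleR assms(2) g])
  then have "(\<lambda>t. \<psi> t *\<^sub>R g t) absolutely_integrable_on {\<alpha><..<\<beta>}"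
    by (simp add: absolutely_integrable_on_def integrable_on_open_interval_real)
  then have int: "integrable (lebesgue_on {\<alpha><..<\<beta>}) (\<lambda>t. \<psi> t *\<^sub>R g t)"
    by (rule absolutely_integrable_imp_integrable) auto
  have "\<psi> \<in> borel_measurable (lebesgue_on {\<alpha><..<\<beta>})"
    by (intro continuous_imp_measurable_on_sets_lebesgue continuous_on_subset[OF assms(2)]) auto
  then have "(LINT t|lebesgue_on {\<alpha><..<\<beta>}. \<psi> t *\<^sub>R f t) = (LINT t|lebesgue_on {\<alpha><..<\<beta>}. \<psi> t *\<^sub>R g t)"
    using assms(1) int by (intro integral_cong_AE) (auto intro!: AE_lebesgue_onI[OF N(1)] simp: N(2))
  also have "\<dots> = integral {\<alpha><..<\<beta>} (\<lambda>t. \<psi> t *\<^sub>R g t)"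
    by (rule lebesgue_integral_eq_integral[OF int]) auto
  finally show ?thesis by (simp add: integral_open_interval_real)
qed

lemma weak_deriv_unique:
  fixes g g' :: "real \<Rightarrow> 'a::euclidean_space"
  assumes ab: "\<alpha> < \<beta>" and g: "g \<in> Linf {\<alpha><..<\<beta>}" "is_weak_deriv n {\<alpha><..<\<beta>} f g"
    and g': "g' \<in> Linf {\<alpha><..<\<beta>}" "is_weak_deriv n {\<alpha><..<\<beta>} f g'"
  obtains N where "negligible N" "\<And>t. t \<in> {\<alpha><..<\<beta>} - N \<Longrightarrow> g t = g' t"
proof -
  let ?I = "{\<alpha><..<\<beta>}"
  obtain h N where h: "negligible N" "\<And>t. t \<in> ?I - N \<Longrightarrow> g t = h t" "h absolutely_integrable_on {\<alpha>..\<beta>}"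
    by (rule Linf_integrable_representative[OF g(1)], rule that; assumption)
  obtain h' N' where h': "negligible N'" "\<And>t. t \<in> ?I - N' \<Longrightarrow> g' t = h' t" "h' absolutely_integrable_on {\<alpha>..\<beta>}"
    by (rule Linf_integrable_representative[OF g'(1)], rule that; assumption)
  note a = h(3) h'(3)
  have "integral {\<alpha>..\<beta>} (\<lambda>t. \<phi> t *\<^sub>R (h t - h' t)) = 0" if \<phi>: "\<phi> \<in> test_functions ?I" for \<phi>
  proof -
    note c = test_function_continuous[OF \<phi>]
    have "(-1) ^ n *\<^sub>R integral {\<alpha>..\<beta>} (\<lambda>t. \<phi> t *\<^sub>R h t) = (-1) ^ n *\<^sub>R integral {\<alpha>..\<beta>} (\<lambda>t. \<phi> t *\<^sub>R h' t)"
      using g(2) g'(2) \<phi> LINT_open_interval[OF Linf_measurable[OF g(1)] c a(1) h(1,2)]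
        LINT_open_interval[OF Linf_measurable[OF g'(1)] c a(2) h'(1,2)]
      by (simp add: is_weak_deriv_def)
    then have "integral {\<alpha>..\<beta>} (\<lambda>t. \<phi> t *\<^sub>R h t) = integral {\<alpha>..\<beta>} (\<lambda>t. \<phi> t *\<^sub>R h' t)" by simp
    then show ?thesis
      unfolding scaleR_diff_right
      by (subst Henstock_Kurzweil_Integration.integral_diff) (auto intro!: integral_cts_scaleR_integrable c a)
  qed
  from fundamental_lemma_calculus_of_variations[OF ab _ this]
  have "negligible {t \<in> {\<alpha>..\<beta>}. h t - h' t \<noteq> 0}" using a by (auto intro: set_integral_diff)
  then have "negligible (N \<union> N' \<union> {t \<in> {\<alpha>..\<beta>}. h t - h' t \<noteq> 0})" using h(1) h'(1) by (intro negligible_Un)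
  then show ?thesis by (rule that) (use h(2) h'(2) in auto)
qed

text \<open>The weak derivative is defined by choice; this lemma replaces it by any function known to be one.\<close>

lemma weak_deriv_eq_AE:
  fixes g :: "real \<Rightarrow> 'a::euclidean_space"
  assumes ab: "\<alpha> < \<beta>" and g: "g \<in> Linf {\<alpha><..<\<beta>}" "is_weak_deriv n {\<alpha><..<\<beta>} f g"
  shows "weak_deriv n {\<alpha><..<\<beta>} f \<in> Linf {\<alpha><..<\<beta>}"
    "\<exists>N. negligible N \<and> (\<forall>t\<in>{\<alpha><..<\<beta>} - N. weak_deriv n {\<alpha><..<\<beta>} f t = g t)"
proof -
  have *: "weak_deriv n {\<alpha><..<\<beta>} f \<in> Linf {\<alpha><..<\<beta>} \<and> is_weak_deriv n {\<alpha><..<\<beta>} f (weak_deriv n {\<alpha><..<\<beta>} f)"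
    unfolding weak_deriv_def by (rule someI[of _ g]) (use g in simp)
  then show "weak_deriv n {\<alpha><..<\<beta>} f \<in> Linf {\<alpha><..<\<beta>}" by simp
  show "\<exists>N. negligible N \<and> (\<forall>t\<in>{\<alpha><..<\<beta>} - N. weak_deriv n {\<alpha><..<\<beta>} f t = g t)"
    using weak_deriv_unique[OF ab _ _ g] * by metis
qed

text \<open>Testing the first weak derivative against \<open>\<phi>'\<close> shows that the second is the weak derivative of
  the first.  Two applications of du Bois-Reymond make \<open>f\<close> almost everywhere equal to a twice
  integrated bounded function, and continuity of \<open>f\<close> makes the equality hold everywhere.\<close>

lemma W2inf_imp_C11:
  fixes f :: "real \<Rightarrow> 'a::euclidean_space"
  assumes ab: "\<alpha> < \<beta>" and f: "f \<in> W2inf {\<alpha><..<\<beta>}"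
  obtains f1 f2 where "\<And>t. t \<in> {\<alpha><..<\<beta>} \<Longrightarrow> (f has_vector_derivative f1 t) (at t)"
    "primitive_on {\<alpha><..<\<beta>} f1 f2"
proof -
  let ?I = "{\<alpha><..<\<beta>}"
  obtain g1 g2 where fc: "continuous_on ?I f" "f \<in> Linf ?I" and g1: "g1 \<in> Linf ?I" "is_weak_deriv 1 ?I f g1"
    and g2: "g2 \<in> Linf ?I" "is_weak_deriv 2 ?I f g2"
    using f by (auto simp: W2inf_def)
  obtain h0 N0 where h0: "negligible N0" "\<And>t. t \<in> ?I - N0 \<Longrightarrow> f t = h0 t"
    "h0 absolutely_integrable_on {\<alpha>..\<beta>}" "\<And>X. bounded (h0 ` X)"
    by (rule Linf_integrable_representative[OF fc(2)], rule that; assumption)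
  obtain h1 N1 where h1: "negligible N1" "\<And>t. t \<in> ?I - N1 \<Longrightarrow> g1 t = h1 t"
    "h1 absolutely_integrable_on {\<alpha>..\<beta>}" "\<And>X. bounded (h1 ` X)"
    by (rule Linf_integrable_representative[OF g1(1)], rule that; assumption)
  obtain h2 N2 where h2: "negligible N2" "\<And>t. t \<in> ?I - N2 \<Longrightarrow> g2 t = h2 t"
    "h2 absolutely_integrable_on {\<alpha>..\<beta>}" "\<And>X. bounded (h2 ` X)"
    by (rule Linf_integrable_representative[OF g2(1)], rule that; assumption)
  note a = h0(3) h1(3) h2(3) and b = h0(4) h1(4) h2(4)
  note int = set_lebesgue_integral_eq_integral(1)[OF a(1)] set_lebesgue_integral_eq_integral(1)[OF a(2)]
    set_lebesgue_integral_eq_integral(1)[OF a(3)]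
  note L0 = LINT_open_interval[OF Linf_measurable[OF fc(2)] _ a(1) h0(1,2)]
    and L1 = LINT_open_interval[OF Linf_measurable[OF g1(1)] _ a(2) h1(1,2)]
    and L2 = LINT_open_interval[OF Linf_measurable[OF g2(1)] _ a(3) h2(1,2)]
  have w1: "integral {\<alpha>..\<beta>} (\<lambda>t. deriv \<phi> t *\<^sub>R h0 t) = - integral {\<alpha>..\<beta>} (\<lambda>t. \<phi> t *\<^sub>R h1 t)"
    if \<phi>: "\<phi> \<in> test_functions ?I" for \<phi>
  proof -
    have "(LINT t|lebesgue_on ?I. ((deriv ^^ 1) \<phi> t) *\<^sub>R f t) = (- 1) ^ 1 *\<^sub>R (LINT t|lebesgue_on ?I. \<phi> t *\<^sub>R g1 t)"
      using g1(2) \<phi> unfolding is_weak_deriv_def by blast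
    moreover have "(LINT t|lebesgue_on ?I. deriv \<phi> t *\<^sub>R f t) = integral {\<alpha>..\<beta>} (\<lambda>t. deriv \<phi> t *\<^sub>R h0 t)"
      by (rule L0[OF test_function_continuous[OF test_function_deriv_closed[OF \<phi>]]])
    moreover have "(LINT t|lebesgue_on ?I. \<phi> t *\<^sub>R g1 t) = integral {\<alpha>..\<beta>} (\<lambda>t. \<phi> t *\<^sub>R h1 t)"
      by (rule L1[OF test_function_continuous[OF \<phi>]])
    ultimately show ?thesis by simp
  qed
  have w2: "integral {\<alpha>..\<beta>} (\<lambda>t. deriv \<phi> t *\<^sub>R h1 t) = - integral {\<alpha>..\<beta>} (\<lambda>t. \<phi> t *\<^sub>R h2 t)"
    if \<phi>: "\<phi> \<in> test_functions ?I" for \<phi>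
  proof -
    note d1 = test_function_deriv_closed[OF \<phi>]
    note d2 = test_function_deriv_closed[OF d1]
    have "(LINT t|lebesgue_on ?I. ((deriv ^^ 2) \<phi> t) *\<^sub>R f t) = (- 1) ^ 2 *\<^sub>R (LINT t|lebesgue_on ?I. \<phi> t *\<^sub>R g2 t)"
      using g2(2) \<phi> unfolding is_weak_deriv_def by blast
    moreover have "(LINT t|lebesgue_on ?I. deriv (deriv \<phi>) t *\<^sub>R f t) = integral {\<alpha>..\<beta>} (\<lambda>t. deriv (deriv \<phi>) t *\<^sub>R h0 t)"
      by (rule L0[OF test_function_continuous[OF d2]])
    moreover have "(LINT t|lebesgue_on ?I. \<phi> t *\<^sub>R g2 t) = integral {\<alpha>..\<beta>} (\<lambda>t. \<phi> t *\<^sub>R h2 t)"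
      by (rule L2[OF test_function_continuous[OF \<phi>]])
    ultimately have "integral {\<alpha>..\<beta>} (\<lambda>t. deriv (deriv \<phi>) t *\<^sub>R h0 t) = integral {\<alpha>..\<beta>} (\<lambda>t. \<phi> t *\<^sub>R h2 t)"
      by (simp add: numeral_2_eq_2)
    then show ?thesis using w1[OF d1] by (metis minus_minus)
  qed
  obtain c where c: "negligible {t \<in> {\<alpha>..\<beta>}. h1 t \<noteq> c + integral {\<alpha>..t} h2}"
    using du_Bois_Reymond[OF ab a(2) int(3) b(3) w2] by metis
  obtain c0 where c0: "negligible {t \<in> {\<alpha>..\<beta>}. h0 t \<noteq> c0 + integral {\<alpha>..t} h1}"
    using du_Bois_Reymond[OF ab a(1) int(2) b(2) w1] by metis
  define f1 where "f1 t = c + integral {\<alpha>..t} h2" for t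
  have pf1: "primitive_on {\<alpha>..\<beta>} f1 h2"
    by (rule primitive_on_integral[OF int(3) b(3)]) (simp add: f1_def)
  have f1c: "continuous_on {\<alpha>..\<beta>} f1"
    by (rule primitive_on_continuous[OF pf1]) (simp add: is_interval_cc)
  define F where "F t = c0 + integral {\<alpha>..t} f1" for t
  have Ih1: "integral {\<alpha>..t} h1 = integral {\<alpha>..t} f1" if "t \<in> {\<alpha>..\<beta>}" for t
    by (rule integral_spike[OF c]) (use that in \<open>auto simp: f1_def\<close>)
  have Fder: "(F has_vector_derivative f1 t) (at t)" if t: "t \<in> ?I" for t
  proof -
    have "((\<lambda>t. integral {\<alpha>..t} f1) has_vector_derivative f1 t) (at t within {\<alpha>..\<beta>})"
      by (rule integral_has_vector_derivative[OF f1c]) (use t in auto)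
    then have "(F has_vector_derivative 0 + f1 t) (at t within {\<alpha>..\<beta>})"
      unfolding F_def[abs_def] by (intro has_vector_derivative_add has_vector_derivative_const)
    moreover have "at t within {\<alpha>..\<beta>} = at t" by (rule at_within_interior) (use t in auto)
    ultimately show ?thesis by simp
  qed
  have Fc: "continuous_on ?I F"
    using Fder by (meson continuous_on_vector_derivative has_vector_derivative_at_within)
  have eq: "f t = F t" if "t \<in> ?I" for t
  proof -
    have "open {t \<in> ?I. f t - F t \<noteq> 0}"
    proof -
      have "continuous_on ?I (\<lambda>t. f t - F t)" by (intro continuous_intros fc Fc)
      then have "open (?I \<inter> (\<lambda>t. f t - F t) -` (- {0}))"
        by (intro continuous_open_preimage) auto
      moreover have "{t \<in> ?I. f t - F t \<noteq> 0} = ?I \<inter> (\<lambda>t. f t - F t) -` (- {0})" by auto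
      ultimately show ?thesis by simp
    qed
    moreover have "negligible {t \<in> ?I. f t - F t \<noteq> 0}"
    proof (rule negligible_subset[OF negligible_Un[OF h0(1) c0]])
      show "{t \<in> ?I. f t - F t \<noteq> 0} \<subseteq> N0 \<union> {t \<in> {\<alpha>..\<beta>}. h0 t \<noteq> c0 + integral {\<alpha>..t} h1}"
        using h0(2) Ih1 by (auto simp: F_def)
    qed
    ultimately have "{t \<in> ?I. f t - F t \<noteq> 0} = {}" using open_not_negligible by blast
    then show ?thesis using that by auto
  qed
  show ?thesis
  proof (rule that)
    show "(f has_vector_derivative f1 t) (at t)" if "t \<in> ?I" for t
      by (rule has_vector_derivative_transform_within_open[OF Fder[OF that], of ?I]) (use that eq in auto)
    show "primitive_on ?I f1 h2" by (rule primitive_on_subset[OF pf1]) auto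
  qed
qed

text \<open>On the open interval \<open>g\<close> is a bounded limit of its restrictions to compact subintervals.\<close>

lemma primitive_on_open_absolutely_integrable:
  assumes "primitive_on {\<alpha><..<\<beta>} f g" "\<alpha> < \<beta>"
  shows "g absolutely_integrable_on {\<alpha><..<\<beta>}" "g \<in> Linf {\<alpha><..<\<beta>}"
proof -
  obtain C where C: "C \<ge> 0" "\<And>t. t \<in> {\<alpha><..<\<beta>} \<Longrightarrow> norm (g t) \<le> C"
    using primitive_on_lipschitz[OF assms(1)] by metis
  define d where "d n = (\<beta> - \<alpha>) / 2 * inverse (real (Suc n))" for n
  have d0: "d n > 0" for n using assms(2) by (simp add: d_def)
  have d: "d \<longlonglongrightarrow> 0"
    using tendsto_mult[OF tendsto_const LIMSEQ_inverse_real_of_nat, of "(\<beta> - \<alpha>) / 2"] by (simp add: d_def[abs_def])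
  define J where "J n = {\<alpha> + d n..\<beta> - d n}" for n
  have J: "J n \<subseteq> {\<alpha><..<\<beta>}" for n using d0[of n] by (auto simp: J_def)
  have "g integrable_on {\<alpha><..<\<beta>}"
  proof (rule dominated_convergence(1))
    show "(\<lambda>t. if t \<in> J n then g t else 0) integrable_on {\<alpha><..<\<beta>}" for n
    proof -
      have "g integrable_on J n"
        using primitive_on_integrable[OF assms(1)] J[of n] unfolding J_def by (simp add: absolutely_integrable_on_def)
      then have "g integrable_on (J n \<inter> {\<alpha><..<\<beta>})" using J[of n] by (simp add: Int_absorb2)
      then show ?thesis by (simp add: integrable_restrict_Int)
    qed
    show "(\<lambda>t. C) integrable_on {\<alpha><..<\<beta>}" by (simp add: integrable_on_open_interval_real integrable_const_ivl)
    show "norm (if t \<in> J n then g t else 0) \<le> C" if "t \<in> {\<alpha><..<\<beta>}" for t n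
      using C that by auto
    show "(\<lambda>n. if t \<in> J n then g t else 0) \<longlonglongrightarrow> g t" if t: "t \<in> {\<alpha><..<\<beta>}" for t
    proof -
      have "\<forall>\<^sub>F n in sequentially. d n < min (t - \<alpha>) (\<beta> - t)"
        using order_tendstoD(2)[OF d, of "min (t - \<alpha>) (\<beta> - t)"] t by simp
      then have "\<forall>\<^sub>F n in sequentially. (if t \<in> J n then g t else 0) = g t"
        by eventually_elim (auto simp: J_def)
      then show ?thesis by (rule tendsto_eventually)
    qed
  qed
  then have m: "g \<in> borel_measurable (lebesgue_on {\<alpha><..<\<beta>})" by (rule integrable_imp_measurable)
  then show "g absolutely_integrable_on {\<alpha><..<\<beta>}" "g \<in> Linf {\<alpha><..<\<beta>}"
    using primitive_on_bounded[OF assms(1)]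
    by (auto intro: bounded_measurable_absolutely_integrable bounded_measurable_Linf)
qed

text \<open>Integration by parts, over a compact interval at whose ends the test function vanishes.\<close>

lemma primitive_on_weak_deriv:
  assumes f: "primitive_on {\<alpha><..<\<beta>} f g" and ab: "\<alpha> < \<beta>" and \<phi>: "\<phi> \<in> test_functions {\<alpha><..<\<beta>}"
  shows "(LINT t|lebesgue_on {\<alpha><..<\<beta>}. deriv \<phi> t *\<^sub>R f t) = - (LINT t|lebesgue_on {\<alpha><..<\<beta>}. \<phi> t *\<^sub>R g t)"
proof -
  let ?I = "{\<alpha><..<\<beta>}"
  have itv: "is_interval ?I" "bounded ?I" by (auto simp: is_interval_oo)
  have fc: "continuous_on ?I f" by (rule primitive_on_continuous[OF f itv(1)])
  have fm: "f \<in> borel_measurable (lebesgue_on ?I)"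
    by (intro continuous_imp_measurable_on_sets_lebesgue fc) auto
  have fa: "f absolutely_integrable_on ?I"
    by (intro bounded_measurable_absolutely_integrable fm primitive_on_bounded_primitive[OF f itv]) auto
  note ga = primitive_on_open_absolutely_integrable(1)[OF f ab]
  have gm: "g \<in> borel_measurable (lebesgue_on ?I)"
    using primitive_on_open_absolutely_integrable(2)[OF f ab] Linf_measurable by blast
  have dc: "continuous_on {\<alpha>..\<beta>} (deriv \<phi>)" "continuous_on {\<alpha>..\<beta>} \<phi>"
    using test_function_continuous test_function_deriv_closed \<phi> by blast+
  have p\<phi>: "primitive_on ?I \<phi> (deriv \<phi>)" by (rule test_function_primitive_on[OF \<phi> itv(2)])
  obtain s e where se: "\<alpha> < s" "s \<le> e" "e < \<beta>" "\<And>t. t \<notin> {s..e} \<Longrightarrow> \<phi> t = 0"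
    using test_function_support[OF \<phi> ab] by metis
  define s' where "s' = (\<alpha> + s) / 2"
  define e' where "e' = (e + \<beta>) / 2"
  have se': "\<alpha> < s'" "s' < s" "e < e'" "e' < \<beta>" using se by (auto simp: s'_def e'_def)
  have dz: "deriv \<phi> t = 0" if "t \<notin> {s..e}" for t
  proof -
    have "(\<phi> has_real_derivative 0) (at t)"
      by (rule has_field_derivative_transform_within_open[of "\<lambda>_. 0" _ _ "- {s..e}"])
         (use se(4) that in auto)
    then show ?thesis by (rule DERIV_imp_deriv)
  qed
  let ?G = "\<lambda>t. deriv \<phi> t *\<^sub>R f t + \<phi> t *\<^sub>R g t"
  have "primitive_on ?I (\<lambda>t. \<phi> t *\<^sub>R f t) ?G"
    by (rule primitive_on_bilinear[OF bounded_bilinear_scaleR p\<phi> f itv])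
  from primitive_onD[OF this, of s' e'] have
    "(?G has_integral \<phi> e' *\<^sub>R f e' - \<phi> s' *\<^sub>R f s') {s'..e'}"
    using se(2) se' by (simp add: subset_iff)
  moreover have "\<phi> e' = 0" "\<phi> s' = 0" using se' by (auto intro!: se(4))
  ultimately have "(?G has_integral 0) {s'..e'}" by simp
  then have "(?G has_integral 0) {\<alpha>..\<beta>}"
    by (rule has_integral_on_superset) (use se se' dz in auto)
  then have z: "integral {\<alpha>..\<beta>} ?G = 0" by (rule integral_unique)
  note ca = absolutely_integrable_closed_interval[OF fa] absolutely_integrable_closed_interval[OF ga]
  have "integral {\<alpha>..\<beta>} (\<lambda>t. deriv \<phi> t *\<^sub>R f t) = - integral {\<alpha>..\<beta>} (\<lambda>t. \<phi> t *\<^sub>R g t)"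
    using z by (subst (asm) Henstock_Kurzweil_Integration.integral_add)
      (auto intro!: integral_cts_scaleR_integrable dc ca simp: eq_neg_iff_add_eq_0)
  then show ?thesis
    using LINT_open_interval[OF fm dc(1) ca(1) negligible_empty] LINT_open_interval[OF gm dc(2) ca(2) negligible_empty]
    by simp
qed

lemma weak_deriv_primitive:
  assumes f: "primitive_on {\<alpha><..<\<beta>} f f1" and f1: "primitive_on {\<alpha><..<\<beta>} f1 f2" and ab: "\<alpha> < \<beta>"
  shows "weak_deriv 1 {\<alpha><..<\<beta>} f \<in> Linf {\<alpha><..<\<beta>}" "weak_deriv 2 {\<alpha><..<\<beta>} f \<in> Linf {\<alpha><..<\<beta>}"
    "\<exists>N. negligible N \<and> (\<forall>t\<in>{\<alpha><..<\<beta>} - N. weak_deriv 1 {\<alpha><..<\<beta>} f t = f1 t)"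
    "\<exists>N. negligible N \<and> (\<forall>t\<in>{\<alpha><..<\<beta>} - N. weak_deriv 2 {\<alpha><..<\<beta>} f t = f2 t)"
proof -
  let ?I = "{\<alpha><..<\<beta>}"
  have w1: "is_weak_deriv 1 ?I f f1"
    unfolding is_weak_deriv_def using primitive_on_weak_deriv[OF f ab] by simp
  have w2: "is_weak_deriv 2 ?I f f2"
    unfolding is_weak_deriv_def
    using primitive_on_weak_deriv[OF f ab test_function_deriv_closed] primitive_on_weak_deriv[OF f1 ab]
    by (simp add: numeral_2_eq_2)
  note L = primitive_on_open_absolutely_integrable(2)[OF f ab] primitive_on_open_absolutely_integrable(2)[OF f1 ab]
  show "weak_deriv 1 ?I f \<in> Linf ?I" "weak_deriv 2 ?I f \<in> Linf ?I"
    "\<exists>N. negligible N \<and> (\<forall>t\<in>?I - N. weak_deriv 1 ?I f t = f1 t)"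
    "\<exists>N. negligible N \<and> (\<forall>t\<in>?I - N. weak_deriv 2 ?I f t = f2 t)"
    using weak_deriv_eq_AE[OF ab L(1) w1] weak_deriv_eq_AE[OF ab L(2) w2] by auto
qed

section \<open>The Liouville transformation\<close>

lemma cINF_positive_lower_bound:
  fixes f :: "real \<Rightarrow> complex"
  assumes "0 < (INF t\<in>S. cmod (f t))" "t \<in> S"
  shows "(INF t\<in>S. cmod (f t)) \<le> cmod (f t)"
  by (rule cINF_lower[OF _ assms(2)]) (auto intro!: bdd_belowI[of _ 0])

lemma has_vector_derivative_one_over:
  fixes f :: "real \<Rightarrow> complex"
  assumes "(f has_vector_derivative f') (at t)" "f t \<noteq> 0"
  shows "((\<lambda>t. 1 / f t) has_vector_derivative - f' / (f t)\<^sup>2) (at t)"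
proof -
  have "((\<lambda>z. 1 / z) has_field_derivative - (1 / (f t)\<^sup>2)) (at (f t))"
    using assms(2) by (auto intro!: derivative_eq_intros simp: power2_eq_square)
  from field_vector_diff_chain_at[OF assms(1) this] show ?thesis by (simp add: o_def)
qed

lemma inverse_C1:
  fixes f :: "real \<Rightarrow> complex"
  assumes f: "\<And>t. t \<in> S \<Longrightarrow> (f has_vector_derivative f' t) (at t)" "bounded (f' ` S)"
    and c: "0 < c" "\<And>t. t \<in> S \<Longrightarrow> c \<le> cmod (f t)"
  shows "primitive_on S (\<lambda>t. 1 / f t) (\<lambda>t. - f' t / (f t)\<^sup>2)"
proof (rule primitive_on_derivative)
  fix t assume t: "t \<in> S"
  have nz: "f t \<noteq> 0" using c t by force
  have "((\<lambda>t. 1 / f t) has_vector_derivative - f' t / (f t)\<^sup>2) (at t)"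
    by (rule has_vector_derivative_one_over[OF f(1)[OF t] nz])
  then show "((\<lambda>t. 1 / f t) has_vector_derivative - f' t / (f t)\<^sup>2) (at t within S)"
    by (simp add: has_vector_derivative_at_within)
next
  obtain C where C: "\<And>t. t \<in> S \<Longrightarrow> cmod (f' t) \<le> C" using bounded_imageE[OF f(2)] by blast
  have "cmod (- f' t / (f t)\<^sup>2) \<le> C / c\<^sup>2" if "t \<in> S" for t
    unfolding norm_divide norm_power norm_minus_cancel
    using C[OF that] c(1) c(2)[OF that] order_trans[OF norm_ge_zero C[OF that]]
    by (intro frac_le power_mono) (auto intro: order_trans)
  then show "bounded ((\<lambda>t. - f' t / (f t)\<^sup>2) ` S)" by (rule bounded_imageI)
qed

lemma has_vector_derivative_iff_quotient:
  fixes f :: "real \<Rightarrow> 'a::real_normed_vector"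
  shows "(f has_vector_derivative f') (at t) \<longleftrightarrow> ((\<lambda>s. (f s - f t) /\<^sub>R (s - t)) \<longlongrightarrow> f') (at t)"
proof -
  have "(f has_vector_derivative f') (at t) \<longleftrightarrow>
      ((\<lambda>s. norm (f s - f t - (s - t) *\<^sub>R f') / norm (s - t)) \<longlongrightarrow> 0) (at t)"
    by (simp add: has_vector_derivative_def has_derivative_iff_norm bounded_linear_scaleR_left)
  also have "\<dots> \<longleftrightarrow> ((\<lambda>s. norm ((f s - f t) /\<^sub>R (s - t) - f')) \<longlongrightarrow> 0) (at t)"
  proof (rule filterlim_cong[OF refl refl])
    have "norm (f s - f t - (s - t) *\<^sub>R f') / norm (s - t) = norm ((f s - f t) /\<^sub>R (s - t) - f')" if "s \<noteq> t" for s
    proof -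
      have "(f s - f t) /\<^sub>R (s - t) - f' = (f s - f t - (s - t) *\<^sub>R f') /\<^sub>R (s - t)"
        using that by (simp add: scaleR_diff_right)
      then show ?thesis by (simp add: divide_inverse abs_inverse mult.commute)
    qed
    then show "\<forall>\<^sub>F s in at t. norm (f s - f t - (s - t) *\<^sub>R f') / norm (s - t) = norm ((f s - f t) /\<^sub>R (s - t) - f')"
      by (auto simp: eventually_at_filter)
  qed
  also have "\<dots> \<longleftrightarrow> ((\<lambda>s. (f s - f t) /\<^sub>R (s - t)) \<longlongrightarrow> f') (at t)"
    by (simp add: tendsto_norm_zero_iff LIM_zero_iff)
  finally show ?thesis .
qed

text \<open>\<open>h s - h t = (f s - f t) / (h s + h t)\<close>, and the denominator tends to \<open>2 h t\<close>.  A continuous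
  branch may be complex, so the rule serves the positive root \<open>r\<close> as well as the complex root \<open>\<sigma>\<close>.\<close>

lemma square_root_C1:
  fixes h :: "real \<Rightarrow> complex"
  assumes h: "continuous_on S h" "open S" "\<And>t. t \<in> S \<Longrightarrow> (h t)\<^sup>2 = f t"
    and f: "(f has_vector_derivative f') (at t)" and t: "t \<in> S" "f t \<noteq> 0"
  shows "(h has_vector_derivative f' / (2 * h t)) (at t)"
proof -
  have ht: "h t \<noteq> 0" using h(3)[OF t(1)] t(2) by auto
  have lim: "(h \<longlongrightarrow> h t) (at t)"
    using h(1,2) t(1) by (auto simp: continuous_on_eq_continuous_at isCont_def)
  have "((\<lambda>s. (f s - f t) /\<^sub>R (s - t)) \<longlongrightarrow> f') (at t)"
    using f by (simp add: has_vector_derivative_iff_quotient)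
  then have "((\<lambda>s. (f s - f t) /\<^sub>R (s - t) * (1 / (h s + h t))) \<longlongrightarrow> f' * (1 / (h t + h t))) (at t)"
    using ht by (intro tendsto_intros lim) auto
  moreover have "\<forall>\<^sub>F s in at t. (f s - f t) /\<^sub>R (s - t) * (1 / (h s + h t)) = (h s - h t) /\<^sub>R (s - t)"
  proof -
    have "((\<lambda>s. h s + h t) \<longlongrightarrow> h t + h t) (at t)" by (intro tendsto_intros lim)
    then have "\<forall>\<^sub>F s in at t. h s + h t \<noteq> 0" by (rule tendsto_imp_eventually_ne) (use ht in simp)
    moreover have "\<forall>\<^sub>F s in at t. s \<in> S" using h(2) t(1) by (rule eventually_at_in_open')
    ultimately show ?thesis
    proof eventually_elim
      case (elim s)
      have "f s - f t = (h s - h t) * (h s + h t)"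
        using h(3)[OF elim(2)] h(3)[OF t(1)] by (simp add: algebra_simps power2_eq_square)
      then have "(f s - f t) /\<^sub>R (s - t) * (1 / (h s + h t)) = ((h s - h t) /\<^sub>R (s - t)) * ((h s + h t) * (1 / (h s + h t)))"
        by (simp only: mult_scaleR_left mult.assoc)
      then show ?case using elim(1) by simp
    qed
  qed
  ultimately have "((\<lambda>s. (h s - h t) /\<^sub>R (s - t)) \<longlongrightarrow> f' * (1 / (h t + h t))) (at t)"
    by (rule Lim_transform_eventually)
  then show ?thesis by (simp add: has_vector_derivative_iff_quotient)
qed

text \<open>The form in which closure under products is used when the derivative itself is of no interest.\<close>

definition lipschitz_primitive :: "real set \<Rightarrow> (real \<Rightarrow> 'a::euclidean_space) \<Rightarrow> bool" where
  "lipschitz_primitive S f \<longleftrightarrow> (\<exists>g. primitive_on S f g)"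

lemma lipschitz_primitiveI: "primitive_on S f g \<Longrightarrow> lipschitz_primitive S f"
  by (auto simp: lipschitz_primitive_def)

lemma lipschitz_primitive_mult:
  fixes f :: "real \<Rightarrow> 'a::{euclidean_space,real_normed_algebra}"
  shows "\<lbrakk>lipschitz_primitive S f; lipschitz_primitive S k; is_interval S; bounded S\<rbrakk>
    \<Longrightarrow> lipschitz_primitive S (\<lambda>t. f t * k t)"
  unfolding lipschitz_primitive_def by (elim exE, rule exI, rule primitive_on_mult)

lemma lipschitz_primitive_add:
  "\<lbrakk>lipschitz_primitive S f; lipschitz_primitive S k\<rbrakk> \<Longrightarrow> lipschitz_primitive S (\<lambda>t. f t + k t)"
  unfolding lipschitz_primitive_def by (elim exE, rule exI, rule primitive_on_add)

lemma lipschitz_primitive_cmult: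
  fixes f :: "real \<Rightarrow> 'a::{euclidean_space,real_normed_algebra}"
  shows "lipschitz_primitive S f \<Longrightarrow> lipschitz_primitive S (\<lambda>t. c * f t)"
  unfolding lipschitz_primitive_def by (elim exE, rule exI, rule primitive_on_cmult)

text \<open>The function \<open>r = \<surd>(w / p)\<close> inherits two bounded derivatives from \<open>p\<close> and \<open>w\<close>, because \<open>p\<close> and \<open>w\<close>
  are bounded away from 0.  The constant \<open>c\<close> is a common lower bound.\<close>

lemma cell_coefficients:
  fixes p w :: "real \<Rightarrow> complex" and r :: "real \<Rightarrow> real"
  assumes ab: "\<alpha> < \<beta>" and pw: "p \<in> W2inf {\<alpha><..<\<beta>}" "w \<in> W2inf {\<alpha><..<\<beta>}"
    and pinf: "0 < (INF t\<in>{\<alpha><..<\<beta>}. cmod (p t))" and winf: "0 < (INF t\<in>{\<alpha><..<\<beta>}. cmod (w t))"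
    and r: "\<And>t. t \<in> {\<alpha><..<\<beta>} \<Longrightarrow> r t > 0 \<and> w t / p t = of_real (r t ^ 2)"
  obtains p1 p2 r1 r2 c where "c > 0" "\<And>t. t \<in> {\<alpha><..<\<beta>} \<Longrightarrow> c \<le> cmod (p t)"
    "\<And>t. t \<in> {\<alpha><..<\<beta>} \<Longrightarrow> c \<le> r t"
    "\<And>t. t \<in> {\<alpha><..<\<beta>} \<Longrightarrow> (p has_vector_derivative p1 t) (at t)" "primitive_on {\<alpha><..<\<beta>} p1 p2"
    "\<And>t. t \<in> {\<alpha><..<\<beta>} \<Longrightarrow> (r has_vector_derivative r1 t) (at t)" "primitive_on {\<alpha><..<\<beta>} r1 r2"
    "primitive_on {\<alpha><..<\<beta>} p p1" "primitive_on {\<alpha><..<\<beta>} r r1"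
proof -
  let ?I = "{\<alpha><..<\<beta>}"
  have itv: "is_interval ?I" "bounded ?I" by (auto simp: is_interval_oo)
  obtain p1 p2 where p: "\<And>t. t \<in> ?I \<Longrightarrow> (p has_vector_derivative p1 t) (at t)" "primitive_on ?I p1 p2"
    using W2inf_imp_C11[OF ab pw(1)] by metis
  obtain w1 w2 where w: "\<And>t. t \<in> ?I \<Longrightarrow> (w has_vector_derivative w1 t) (at t)" "primitive_on ?I w1 w2"
    using W2inf_imp_C11[OF ab pw(2)] by metis
  have bd: "bounded (p1 ` ?I)" "bounded (w1 ` ?I)"
    by (rule primitive_on_bounded_primitive[OF p(2) itv] primitive_on_bounded_primitive[OF w(2) itv])+
  have pp: "primitive_on ?I p p1" by (rule primitive_on_derivative[OF has_vector_derivative_at_within[OF p(1)] bd(1)])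
  have wp: "primitive_on ?I w w1" by (rule primitive_on_derivative[OF has_vector_derivative_at_within[OF w(1)] bd(2)])
  define cp where "cp = (INF t\<in>?I. cmod (p t))"
  define cw where "cw = (INF t\<in>?I. cmod (w t))"
  have c: "0 < cp" "0 < cw" "\<And>t. t \<in> ?I \<Longrightarrow> cp \<le> cmod (p t)" "\<And>t. t \<in> ?I \<Longrightarrow> cw \<le> cmod (w t)"
    using pinf winf cINF_positive_lower_bound unfolding cp_def cw_def by blast+
  obtain P where P: "\<And>t. t \<in> ?I \<Longrightarrow> cmod (p t) \<le> P"
    using bounded_imageE[OF primitive_on_bounded_primitive[OF pp itv]] by blast
  have "0 < P" using P[of "(\<alpha> + \<beta>) / 2"] c(1) c(3)[of "(\<alpha> + \<beta>) / 2"] ab by simp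
  define cr where "cr = sqrt (cw / P)"
  have cr: "0 < cr" using c(2) \<open>0 < P\<close> by (simp add: cr_def)
  have rlow: "cr \<le> r t" if t: "t \<in> ?I" for t
  proof -
    have "(r t)\<^sup>2 = cmod (of_real (r t ^ 2) :: complex)" by (simp only: norm_of_real) simp
    also have "\<dots> = cmod (w t) / cmod (p t)" using r[OF t] by (metis norm_divide)
    also have "cw / P \<le> \<dots>" using c(1,2) c(3)[OF t] c(4)[OF t] P[OF t] by (intro frac_le) auto
    finally show ?thesis using r[OF t] unfolding cr_def by (intro real_le_lsqrt) auto
  qed
  \<comment> \<open>As a complex function \<open>r\<close> falls under the square root rule; real parts are taken at the end.\<close>
  define R where "R t = complex_of_real (r t)" for t
  have ip: "primitive_on ?I (\<lambda>t. 1 / p t) (\<lambda>t. - p1 t / (p t)\<^sup>2)"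
    by (rule inverse_C1[OF p(1) bd(1) c(1,3)])
  define f where "f t = w t * (1 / p t)" for t
  define f1 where "f1 t = w1 t * (1 / p t) + w t * (- p1 t / (p t)\<^sup>2)" for t
  have pnz: "p t \<noteq> 0" if "t \<in> ?I" for t using c(1) c(3)[OF that] by auto
  have fder: "(f has_vector_derivative f1 t) (at t)" if t: "t \<in> ?I" for t
  proof -
    have "((\<lambda>t. 1 / p t) has_vector_derivative - p1 t / (p t)\<^sup>2) (at t)"
      by (rule has_vector_derivative_one_over[OF p(1)[OF t] pnz[OF t]])
    from has_vector_derivative_mult[OF w(1)[OF t] this] show ?thesis
      unfolding f_def[abs_def] f1_def by (simp add: algebra_simps)
  qed
  have fp: "primitive_on ?I f f1"
    unfolding f_def[abs_def] f1_def[abs_def] by (rule primitive_on_mult[OF wp ip itv])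
  have Rf: "(R t)\<^sup>2 = f t" if "t \<in> ?I" for t
    using r[OF that] by (simp add: R_def f_def)
  have Rc: "continuous_on ?I R"
  proof -
    have "continuous_on ?I (\<lambda>t. complex_of_real (sqrt (Re (f t))))"
      by (intro continuous_intros primitive_on_continuous[OF fp itv(1)])
    then show ?thesis
    proof (rule continuous_on_eq)
      fix t assume t: "t \<in> ?I"
      have "Re (f t) = (r t)\<^sup>2" using Rf[OF t] by (metis R_def Re_complex_of_real of_real_power)
      then show "complex_of_real (sqrt (Re (f t))) = R t" using r[OF t] by (simp add: R_def)
    qed
  qed
  have Rnz: "R t \<noteq> 0" if "t \<in> ?I" for t using r[OF that] by (simp add: R_def)
  have Rder: "(R has_vector_derivative f1 t / (2 * R t)) (at t)" if t: "t \<in> ?I" for t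
    by (rule square_root_C1[OF Rc _ Rf fder]) (use t Rnz[OF t] Rf[OF t] in auto)
  define r1 where "r1 t = Re (f1 t / (2 * R t))" for t
  have rder: "(r has_vector_derivative r1 t) (at t)" if t: "t \<in> ?I" for t
    using bounded_linear.has_vector_derivative[OF bounded_linear_Re Rder[OF t]] by (simp add: R_def r1_def)
  have R1: "f1 t / (2 * R t) = complex_of_real (r1 t)" if t: "t \<in> ?I" for t
    using vector_derivative_unique_at[OF Rder[OF t]] has_vector_derivative_of_real[of r "r1 t" "at t"] rder[OF t]
    by (metis R_def ext has_real_derivative_iff_has_vector_derivative)
  have Rlow: "cr \<le> cmod (R t)" if "t \<in> ?I" for t using rlow[OF that] r[OF that] by (simp add: R_def)
  obtain F where F: "\<And>t. t \<in> ?I \<Longrightarrow> cmod (f1 t) \<le> F"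
    using bounded_imageE[OF primitive_on_bounded[OF fp]] by blast
  have bR: "bounded ((\<lambda>t. f1 t / (2 * R t)) ` ?I)"
  proof -
    have "cmod (f1 t / (2 * R t)) \<le> F / (2 * cr)" if "t \<in> ?I" for t
      using F[OF that] Rlow[OF that] cr unfolding norm_divide norm_mult
      by (intro frac_le) (auto intro: order_trans[OF norm_ge_zero])
    then show ?thesis by (rule bounded_imageI)
  qed
  have iR: "primitive_on ?I (\<lambda>t. 1 / R t) (\<lambda>t. - (f1 t / (2 * R t)) / (R t)\<^sup>2)"
    by (rule inverse_C1[OF Rder bR cr Rlow])
  have "lipschitz_primitive ?I (\<lambda>t. (w1 t * (1 / p t) + (-1) * (w t * (p1 t * (1 / p t * (1 / p t))))) * (1 / 2 * (1 / R t)))"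
    by (intro lipschitz_primitive_mult lipschitz_primitive_add lipschitz_primitive_cmult itv
        lipschitz_primitiveI[OF w(2)] lipschitz_primitiveI[OF p(2)] lipschitz_primitiveI[OF ip]
        lipschitz_primitiveI[OF iR] lipschitz_primitiveI[OF wp])
  then obtain R2 where R2: "primitive_on ?I (\<lambda>t. (w1 t * (1 / p t) + (-1) * (w t * (p1 t * (1 / p t * (1 / p t))))) * (1 / 2 * (1 / R t))) R2"
    by (auto simp: lipschitz_primitive_def)
  have "primitive_on ?I (\<lambda>t. f1 t / (2 * R t)) R2"
    by (rule primitive_on_cong[OF R2]) (simp_all add: f1_def power2_eq_square)
  from primitive_on_linear[OF this bounded_linear_Re] have r2: "primitive_on ?I r1 (\<lambda>t. Re (R2 t))"
    by (simp add: r1_def[abs_def])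
  have rp: "primitive_on ?I r r1"
    by (rule primitive_on_derivative[OF has_vector_derivative_at_within[OF rder] primitive_on_bounded_primitive[OF r2 itv]])
  show ?thesis
    by (rule that[of "min cp cr" p1 p2 r1, OF _ _ _ p rder r2 pp rp])
      (use c cr rlow in \<open>auto simp: min_le_iff_disj\<close>)
qed

lemma sigma_derivative:
  fixes p p1 p2 \<sigma> :: "real \<Rightarrow> complex" and r r1 r2 :: "real \<Rightarrow> real"
  assumes c: "c > 0" "\<And>t. t \<in> {\<alpha><..<\<beta>} \<Longrightarrow> c \<le> cmod (p t)" "\<And>t. t \<in> {\<alpha><..<\<beta>} \<Longrightarrow> c \<le> r t"
    and p: "\<And>t. t \<in> {\<alpha><..<\<beta>} \<Longrightarrow> (p has_vector_derivative p1 t) (at t)" "primitive_on {\<alpha><..<\<beta>} p1 p2"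
    and r: "\<And>t. t \<in> {\<alpha><..<\<beta>} \<Longrightarrow> (r has_vector_derivative r1 t) (at t)" "primitive_on {\<alpha><..<\<beta>} r1 r2"
    and pr: "primitive_on {\<alpha><..<\<beta>} p p1" "primitive_on {\<alpha><..<\<beta>} r r1"
    and \<sigma>: "continuous_on {\<alpha><..<\<beta>} \<sigma>" "\<And>t. t \<in> {\<alpha><..<\<beta>} \<Longrightarrow> \<sigma> t ^ 2 = p t * of_real (r t)"
  shows "\<And>t. t \<in> {\<alpha><..<\<beta>} \<Longrightarrow> (pr p r has_vector_derivative (p1 t * r t + p t * r1 t)) (at t)"
    "\<And>t. t \<in> {\<alpha><..<\<beta>} \<Longrightarrow> (\<sigma> has_vector_derivative (p1 t * r t + p t * r1 t) / (2 * \<sigma> t)) (at t)"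
    "\<And>t. t \<in> {\<alpha><..<\<beta>} \<Longrightarrow> c \<le> cmod (\<sigma> t)"
    "primitive_on {\<alpha><..<\<beta>} (\<lambda>t. p1 t * r t + p t * r1 t) (\<lambda>t. (p2 t * r t + p1 t * r1 t) + (p1 t * r1 t + p t * r2 t))"
    "primitive_on {\<alpha><..<\<beta>} \<sigma> (\<lambda>t. (p1 t * r t + p t * r1 t) / (2 * \<sigma> t))"
    "primitive_on {\<alpha><..<\<beta>} (\<lambda>t. 1 / \<sigma> t) (\<lambda>t. - ((p1 t * r t + p t * r1 t) / (2 * \<sigma> t)) / (\<sigma> t)\<^sup>2)"
    "primitive_on {\<alpha><..<\<beta>} (\<lambda>t. 1 / complex_of_real (r t)) (\<lambda>t. - of_real (r1 t) / (of_real (r t))\<^sup>2)"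
proof -
  let ?I = "{\<alpha><..<\<beta>}"
  have itv: "is_interval ?I" "bounded ?I" by (auto simp: is_interval_oo)
  note R = primitive_on_linear[OF pr(2) bounded_linear_of_real[where 'a = complex]]
  note R1 = primitive_on_linear[OF r(2) bounded_linear_of_real[where 'a = complex]]
  show N: "primitive_on ?I (\<lambda>t. p1 t * r t + p t * r1 t) (\<lambda>t. (p2 t * r t + p1 t * r1 t) + (p1 t * r1 t + p t * r2 t))"
    by (intro primitive_on_add primitive_on_mult p(2) pr(1) R R1 itv)
  have Rder: "((\<lambda>t. complex_of_real (r t)) has_vector_derivative of_real (r1 t)) (at t)" if "t \<in> ?I" for t
    using bounded_linear.has_vector_derivative[OF bounded_linear_of_real r(1)[OF that]] .
  show der: "(pr p r has_vector_derivative (p1 t * r t + p t * r1 t)) (at t)" if t: "t \<in> ?I" for t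
    using has_vector_derivative_mult[OF p(1)[OF t] Rder[OF t]] by (simp add: pr_def[abs_def] add.commute)
  show low: "c \<le> cmod (\<sigma> t)" if t: "t \<in> ?I" for t
  proof -
    have "c * c \<le> cmod (p t) * cmod (of_real (r t) :: complex)"
      using c(1) c(2)[OF t] c(3)[OF t] by (intro mult_mono) auto
    also have "\<dots> = (cmod (\<sigma> t))\<^sup>2" using \<sigma>(2)[OF t] by (metis norm_mult norm_power)
    finally have "c\<^sup>2 \<le> (cmod (\<sigma> t))\<^sup>2" unfolding power2_eq_square[of c] .
    then show ?thesis by (rule power2_le_imp_le) simp
  qed
  show sder: "(\<sigma> has_vector_derivative (p1 t * r t + p t * r1 t) / (2 * \<sigma> t)) (at t)" if t: "t \<in> ?I" for t
  proof (rule square_root_C1[OF \<sigma>(1) open_greaterThanLessThan _ der[OF t] t])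
    show "(\<sigma> t)\<^sup>2 = pr p r t" if "t \<in> ?I" for t using \<sigma>(2)[OF that] by (simp add: pr_def)
    have "p t \<noteq> 0" "r t \<noteq> 0" using c(1) c(2)[OF t] c(3)[OF t] by auto
    then show "pr p r t \<noteq> 0" by (simp add: pr_def)
  qed
  obtain B where B: "\<And>t. t \<in> ?I \<Longrightarrow> cmod (p1 t * r t + p t * r1 t) \<le> B"
    using bounded_imageE[OF primitive_on_bounded_primitive[OF N itv]] by blast
  have bS: "bounded ((\<lambda>t. (p1 t * r t + p t * r1 t) / (2 * \<sigma> t)) ` ?I)"
  proof (rule bounded_imageI)
    fix t assume t: "t \<in> ?I"
    show "cmod ((p1 t * r t + p t * r1 t) / (2 * \<sigma> t)) \<le> B / (2 * c)"
      unfolding norm_divide norm_mult[of 2] using B[OF t] low[OF t] c(1) order_trans[OF norm_ge_zero B[OF t]]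
      by (intro frac_le) auto
  qed
  show "primitive_on ?I \<sigma> (\<lambda>t. (p1 t * r t + p t * r1 t) / (2 * \<sigma> t))"
    by (rule primitive_on_derivative[OF has_vector_derivative_at_within[OF sder] bS])
  show "primitive_on ?I (\<lambda>t. 1 / \<sigma> t) (\<lambda>t. - ((p1 t * r t + p t * r1 t) / (2 * \<sigma> t)) / (\<sigma> t)\<^sup>2)"
    by (rule inverse_C1[OF sder bS c(1) low])
  show "primitive_on ?I (\<lambda>t. 1 / complex_of_real (r t)) (\<lambda>t. - of_real (r1 t) / (of_real (r t))\<^sup>2)"
  proof (rule inverse_C1[OF Rder primitive_on_bounded[OF R] c(1)])
    show "c \<le> cmod (of_real (r t))" if "t \<in> ?I" for t using c(1) c(3)[OF that] by simp
  qed
qed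

text \<open>Here \<open>\<tau>\<close> is the derivative of \<open>\<sigma>\<close> with respect to the new length, and
  \<open>z' = u / \<sigma> + \<tau> y\<close>.  The derivatives of \<open>z\<close> and \<open>z'\<close> follow from the product rule; in that of \<open>z'\<close> the
  terms with \<open>u\<close> cancel, and \<open>\<sigma>\<^sup>2 = p r\<close> turns the remaining factor of \<open>y\<close> into
  \<open>r (\<kappa>\<^sup>2 + v) \<sigma>\<close>.  The function \<open>v\<close> may be changed on a null set, so that its essential
  bound holds everywhere.\<close>

lemma liouville_transformation:
  fixes p p1 p2 w q \<sigma> \<tau> y u v P Q :: "real \<Rightarrow> complex" and r r1 r2 :: "real \<Rightarrow> real"
  assumes c: "c > 0" "\<And>t. t \<in> {\<alpha><..<\<beta>} \<Longrightarrow> c \<le> cmod (p t)" "\<And>t. t \<in> {\<alpha><..<\<beta>} \<Longrightarrow> c \<le> r t"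
    and p: "\<And>t. t \<in> {\<alpha><..<\<beta>} \<Longrightarrow> (p has_vector_derivative p1 t) (at t)" "primitive_on {\<alpha><..<\<beta>} p1 p2"
    and r: "\<And>t. t \<in> {\<alpha><..<\<beta>} \<Longrightarrow> (r has_vector_derivative r1 t) (at t)" "primitive_on {\<alpha><..<\<beta>} r1 r2"
    and pr: "primitive_on {\<alpha><..<\<beta>} p p1" "primitive_on {\<alpha><..<\<beta>} r r1"
    and \<sigma>: "continuous_on {\<alpha><..<\<beta>} \<sigma>" "\<And>t. t \<in> {\<alpha><..<\<beta>} \<Longrightarrow> \<sigma> t ^ 2 = p t * of_real (r t)"
    and w: "\<And>t. t \<in> {\<alpha><..<\<beta>} \<Longrightarrow> w t = p t * of_real (r t ^ 2)"
    and y: "primitive_on {\<alpha><..<\<beta>} y (\<lambda>t. u t / p t)"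
    and u: "primitive_on {\<alpha><..<\<beta>} u (\<lambda>t. (q t + \<kappa>\<^sup>2 * w t) * y t)"
    and \<kappa>: "\<kappa> \<noteq> 0"
    and N: "negligible N" "\<And>t. t \<in> {\<alpha><..<\<beta>} - N \<Longrightarrow>
        v t = 1 / of_real (r t) ^ 2 * (q t / p t + 1/2 * (p2 t / p t) - 1/4 * (p1 t / p t) ^ 2
                        + 1/2 * (of_real (r2 t) / of_real (r t)) - 3/4 * (of_real (r1 t) / of_real (r t)) ^ 2)"
    and v: "\<And>t. t \<in> {\<alpha><..<\<beta>} \<Longrightarrow> cmod (v t) \<le> V"
    and \<tau>_def: "\<And>t. \<tau> t = (p1 t * r t + p t * r1 t) / (2 * r t * \<sigma> t)"
    and P_def: "\<And>t. P t = 1/2 * (\<sigma> t * y t + (u t / \<sigma> t + \<tau> t * y t) / \<kappa>)"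
    and Q_def: "\<And>t. Q t = 1/2 * (\<sigma> t * y t - (u t / \<sigma> t + \<tau> t * y t) / \<kappa>)"
  shows "lipschitz_primitive {\<alpha><..<\<beta>} \<tau>"
    "primitive_on {\<alpha><..<\<beta>} P (\<lambda>x. r x * (\<kappa> * P x + v x / (2 * \<kappa>) * (P x + Q x)))"
    "primitive_on {\<alpha><..<\<beta>} Q (\<lambda>x. - (r x * (\<kappa> * Q x + v x / (2 * \<kappa>) * (P x + Q x))))"
proof -
  let ?I = "{\<alpha><..<\<beta>}"
  have itv: "is_interval ?I" "bounded ?I" by (auto simp: is_interval_oo)
  note s = sigma_derivative[OF c p r pr \<sigma>]
  have nz: "p t \<noteq> 0" "r t \<noteq> 0" "\<sigma> t \<noteq> 0" if "t \<in> ?I" for t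
  proof -
    have "c \<le> cmod (\<sigma> t)" by (rule s(3)) (use that in auto)
    then show "p t \<noteq> 0" "r t \<noteq> 0" "\<sigma> t \<noteq> 0" using c(1) c(2)[OF that] c(3)[OF that] by auto
  qed
  define M where "M t = p1 t * r t + p t * r1 t" for t
  define M' where "M' t = (p2 t * r t + p1 t * r1 t) + (p1 t * r1 t + p t * r2 t)" for t
  have Mp: "primitive_on ?I M M'" unfolding M_def[abs_def] M'_def[abs_def] by (rule s(4))
  have sp: "primitive_on ?I \<sigma> (\<lambda>t. M t / (2 * \<sigma> t))"
    "primitive_on ?I (\<lambda>t. 1 / \<sigma> t) (\<lambda>t. - (M t / (2 * \<sigma> t)) / (\<sigma> t)\<^sup>2)"
    "primitive_on ?I (\<lambda>t. 1 / complex_of_real (r t)) (\<lambda>t. - of_real (r1 t) / (of_real (r t))\<^sup>2)"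
    unfolding M_def by (rule s(5) s(6) s(7); assumption)+
  define \<tau>1 where "\<tau>1 t = M' t * (1 / of_real (r t) * (1 / 2 * (1 / \<sigma> t))) + M t * (- of_real (r1 t) / (of_real (r t))\<^sup>2 * (1 / 2 * (1 / \<sigma> t))
      + 1 / of_real (r t) * (1 / 2 * (- (M t / (2 * \<sigma> t)) / (\<sigma> t)\<^sup>2)))" for t
  have "primitive_on ?I (\<lambda>t. M t * (1 / of_real (r t) * (1 / 2 * (1 / \<sigma> t)))) \<tau>1"
    unfolding \<tau>1_def[abs_def] by (intro primitive_on_mult primitive_on_cmult Mp sp itv)
  then have \<tau>: "primitive_on ?I \<tau> \<tau>1"
    by (rule primitive_on_cong) (auto simp: \<tau>_def M_def)
  then show "lipschitz_primitive ?I \<tau>" by (rule lipschitz_primitiveI)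
  define z where "z t = \<sigma> t * y t" for t
  define z' where "z' t = u t / \<sigma> t + \<tau> t * y t" for t
  define v0 where "v0 t = 1 / of_real (r t) ^ 2 * (q t / p t + 1/2 * (p2 t / p t) - 1/4 * (p1 t / p t) ^ 2
                        + 1/2 * (of_real (r2 t) / of_real (r t)) - 3/4 * (of_real (r1 t) / of_real (r t)) ^ 2)" for t
  have zp: "primitive_on ?I z (\<lambda>t. r t * z' t)"
  proof (rule primitive_on_cong)
    show "primitive_on ?I z (\<lambda>t. M t / (2 * \<sigma> t) * y t + \<sigma> t * (u t / p t))"
      unfolding z_def[abs_def] by (rule primitive_on_mult[OF sp(1) y itv])
    show "M t / (2 * \<sigma> t) * y t + \<sigma> t * (u t / p t) = r t * z' t" if t: "t \<in> ?I" for t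
    proof -
      have "\<sigma> t / p t = r t / \<sigma> t" using nz[OF t] \<sigma>(2)[OF t] by (simp add: field_simps power2_eq_square)
      moreover have "M t / (2 * \<sigma> t) = r t * \<tau> t" using nz[OF t] by (simp add: \<tau>_def M_def)
      moreover have "\<sigma> t * (u t / p t) = \<sigma> t / p t * u t" by simp
      ultimately show ?thesis by (simp add: z'_def algebra_simps)
    qed
  qed simp
  have "primitive_on ?I z' (\<lambda>t. r t * (\<kappa>\<^sup>2 + v0 t) * z t)"
  proof (rule primitive_on_cong)
    have "primitive_on ?I (\<lambda>t. u t * (1 / \<sigma> t) + \<tau> t * y t)
       (\<lambda>t. ((q t + \<kappa>\<^sup>2 * w t) * y t * (1 / \<sigma> t) + u t * (- (M t / (2 * \<sigma> t)) / (\<sigma> t)\<^sup>2)) + (\<tau>1 t * y t + \<tau> t * (u t / p t)))"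
      by (intro primitive_on_add primitive_on_mult u y sp \<tau> itv)
    then show "primitive_on ?I z'
       (\<lambda>t. ((q t + \<kappa>\<^sup>2 * w t) * y t * (1 / \<sigma> t) + u t * (- (M t / (2 * \<sigma> t)) / (\<sigma> t)\<^sup>2)) + (\<tau>1 t * y t + \<tau> t * (u t / p t)))"
      by (rule primitive_on_cong) (auto simp: z'_def)
    show "((q t + \<kappa>\<^sup>2 * w t) * y t * (1 / \<sigma> t) + u t * (- (M t / (2 * \<sigma> t)) / (\<sigma> t)\<^sup>2)) + (\<tau>1 t * y t + \<tau> t * (u t / p t))
       = r t * (\<kappa>\<^sup>2 + v0 t) * z t" if t: "t \<in> ?I" for t
    proof -
      let ?R = "complex_of_real (r t)"
      note n = nz[OF t]
      have pe: "p t = (\<sigma> t)\<^sup>2 / ?R" using \<sigma>(2)[OF t] n by (simp add: field_simps)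
      \<comment> \<open>The coefficient of \<open>u\<close> vanishes.\<close>
      have 1: "- (M t / (2 * \<sigma> t)) / (\<sigma> t)\<^sup>2 + \<tau> t / p t = 0"
        using n unfolding pe by (simp add: \<tau>_def M_def[symmetric] power2_eq_square)
      have "q t * (1 / \<sigma> t) + \<tau>1 t = 1 / \<sigma> t * (q t + M' t / (2 * ?R) - M t * r1 t / (2 * ?R\<^sup>2) - (M t)\<^sup>2 / (4 * ?R * (\<sigma> t)\<^sup>2))"
        using n by (simp add: \<tau>1_def field_simps power2_eq_square)
      also have "\<dots> = 1 / \<sigma> t * (p t * ?R\<^sup>2 * v0 t)"
      proof -
        have "q t + M' t / (2 * ?R) - M t * r1 t / (2 * ?R\<^sup>2) - (M t)\<^sup>2 / (4 * ?R * (p t * ?R)) = p t * ?R\<^sup>2 * v0 t"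
          using n(1,2) unfolding v0_def M_def M'_def by (simp add: field_simps power2_eq_square)
        then show ?thesis using \<sigma>(2)[OF t] by simp
      qed
      finally have 2: "q t * (1 / \<sigma> t) + \<tau>1 t = 1 / \<sigma> t * (p t * ?R\<^sup>2 * v0 t)" .
      have 3: "1 / \<sigma> t * (p t * ?R\<^sup>2) = ?R * \<sigma> t"
        using n unfolding pe by (simp add: power2_eq_square)
      have "((q t + \<kappa>\<^sup>2 * w t) * y t * (1 / \<sigma> t) + u t * (- (M t / (2 * \<sigma> t)) / (\<sigma> t)\<^sup>2)) + (\<tau>1 t * y t + \<tau> t * (u t / p t))
         = (q t * (1 / \<sigma> t) + \<tau>1 t) * y t + \<kappa>\<^sup>2 * (1 / \<sigma> t * w t) * y t + u t * (- (M t / (2 * \<sigma> t)) / (\<sigma> t)\<^sup>2 + \<tau> t / p t)"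
        by (simp add: algebra_simps)
      also have "\<dots> = (1 / \<sigma> t * (p t * ?R\<^sup>2)) * (\<kappa>\<^sup>2 + v0 t) * y t"
        unfolding 1 2 w[OF t] by (simp add: algebra_simps add_divide_distrib)
      also have "\<dots> = r t * (\<kappa>\<^sup>2 + v0 t) * z t" unfolding 3 by (simp add: z_def)
      finally show ?thesis .
    qed
  qed simp
  then have z'p: "primitive_on ?I z' (\<lambda>t. r t * (\<kappa>\<^sup>2 + v t) * z t)"
  proof (rule primitive_on_AE_cong[OF _ N(1)])
    show "r t * (\<kappa>\<^sup>2 + v0 t) * z t = r t * (\<kappa>\<^sup>2 + v t) * z t" if "t \<in> ?I - N" for t
      using N(2)[OF that] by (simp add: v0_def)
    have "bounded ((\<lambda>t. \<kappa>\<^sup>2 + v t) ` ?I)"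
      by (rule bounded_imageI[of _ _ "cmod (\<kappa>\<^sup>2) + V"]) (intro order_trans[OF norm_triangle_ineq] add_left_mono v)
    then show "bounded ((\<lambda>t. r t * (\<kappa>\<^sup>2 + v t) * z t) ` ?I)"
      by (intro bounded_mult_image primitive_on_bounded_primitive[OF zp itv]
          primitive_on_bounded_primitive[OF primitive_on_linear[OF pr(2) bounded_linear_of_real] itv])
  qed
  have Pz: "P t = 1/2 * (z t + z' t / \<kappa>)" and Qz: "Q t = 1/2 * (z t - z' t / \<kappa>)" for t
    by (simp_all add: P_def Q_def z_def z'_def)
  have half: "1/2 * (A + B) + 1/2 * (A - B) = A" for A B :: complex by (simp add: field_simps)
  have PQ: "P t + Q t = z t" for t unfolding P_def Q_def z_def by (rule half)
  have "primitive_on ?I (\<lambda>t. 1 / 2 * z t + 1 / (2 * \<kappa>) * z' t) (\<lambda>t. 1 / 2 * (r t * z' t) + 1 / (2 * \<kappa>) * (r t * (\<kappa>\<^sup>2 + v t) * z t))"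
    by (intro primitive_on_add primitive_on_cmult zp z'p)
  then show "primitive_on ?I P (\<lambda>x. r x * (\<kappa> * P x + v x / (2 * \<kappa>) * (P x + Q x)))"
    unfolding PQ
    by (rule primitive_on_cong) (use \<kappa> in \<open>simp_all add: Pz field_simps power2_eq_square\<close>)
  have "primitive_on ?I (\<lambda>t. 1 / 2 * z t + (- 1 / (2 * \<kappa>)) * z' t) (\<lambda>t. 1 / 2 * (r t * z' t) + (- 1 / (2 * \<kappa>)) * (r t * (\<kappa>\<^sup>2 + v t) * z t))"
    by (intro primitive_on_add primitive_on_cmult zp z'p)
  then show "primitive_on ?I Q (\<lambda>x. - (r x * (\<kappa> * Q x + v x / (2 * \<kappa>) * (P x + Q x))))"
    unfolding PQ
    by (rule primitive_on_cong) (use \<kappa> in \<open>simp_all add: Qz field_simps power2_eq_square\<close>)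
qed

section \<open>Transfer across a cell and an interface\<close>

text \<open>The estimate on \<open>[\<alpha> + d n, \<beta> - d n]\<close> in the limit \<open>d n \<rightarrow> 0\<close>; the end points of the
  cell enter through one-sided limits.\<close>

lemma dichotomy_open_cell:
  fixes P Q v :: "real \<Rightarrow> complex" and r :: "real \<Rightarrow> real" and \<kappa> :: complex
  assumes ab: "\<alpha> < \<beta>"
    and P: "primitive_on {\<alpha><..<\<beta>} P (\<lambda>x. r x * (\<kappa> * P x + v x / (2 * \<kappa>) * (P x + Q x)))"
    and Q: "primitive_on {\<alpha><..<\<beta>} Q (\<lambda>x. - (r x * (\<kappa> * Q x + v x / (2 * \<kappa>) * (P x + Q x))))"
    and r: "\<And>x. x \<in> {\<alpha><..<\<beta>} \<Longrightarrow> 0 \<le> r x" "bounded (r ` {\<alpha><..<\<beta>})" "continuous_on {\<alpha><..<\<beta>} r"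
    and v: "\<And>x. x \<in> {\<alpha><..<\<beta>} \<Longrightarrow> cmod (v x) \<le> V"
    and \<kappa>: "Re \<kappa> > 0"
    and \<theta>: "\<theta> = V * (LINT s|lebesgue_on {\<alpha><..<\<beta>}. r s) / cmod \<kappa>" "\<theta> < 1"
    and lim: "(P \<longlongrightarrow> Pa) (at_right \<alpha>)" "(Q \<longlongrightarrow> Qa) (at_right \<alpha>)"
      "(P \<longlongrightarrow> Pb) (at_left \<beta>)" "(Q \<longlongrightarrow> Qb) (at_left \<beta>)"
    and len: "len = (LINT s|lebesgue_on {\<alpha><..<\<beta>}. r s)"
  shows "cmod (exp (- \<kappa> * of_real len) * Pb - Pa) \<le> \<theta> / 2 / (1 - \<theta>) * (cmod Pa + cmod Qa)"
    and "cmod (exp (- \<kappa> * of_real len) * Qb - exp (- 2 * \<kappa> * of_real len) * Qa) \<le> \<theta> / 2 / (1 - \<theta>) * (cmod Pa + cmod Qa)"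
proof -
  let ?I = "{\<alpha><..<\<beta>}"
  have rI: "r absolutely_integrable_on ?I"
    by (intro bounded_measurable_absolutely_integrable r(2) continuous_imp_measurable_on_sets_lebesgue r(3)) auto
  have rc: "r integrable_on {\<alpha>..\<beta>}"
    using absolutely_integrable_closed_interval[OF rI] by (rule set_lebesgue_integral_eq_integral(1))
  define F where "F x = integral {\<alpha>..x} r" for x
  have Fc: "continuous_on {\<alpha>..\<beta>} F"
    unfolding F_def[abs_def] by (rule indefinite_integral_continuous_1[OF rc])
  have F\<beta>: "F \<beta> = len"
    unfolding F_def len by (subst lebesgue_integral_eq_integral[OF absolutely_integrable_imp_integrable[OF rI]])
      (auto simp: integral_open_interval_real)
  have F\<alpha>: "F \<alpha> = 0" by (simp add: F_def)
  define d where "d n = (\<beta> - \<alpha>) / 3 * inverse (real (Suc n))" for n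
  have d0: "d n > 0" "d n \<le> (\<beta> - \<alpha>) / 3" for n
  proof -
    show "d n > 0" using ab by (simp add: d_def)
    have "(\<beta> - \<alpha>) / 3 * inverse (real (Suc n)) \<le> (\<beta> - \<alpha>) / 3 * 1"
      using ab by (intro mult_left_mono) (auto simp: inverse_le_1_iff)
    then show "d n \<le> (\<beta> - \<alpha>) / 3" by (simp add: d_def)
  qed
  have d: "d \<longlonglongrightarrow> 0"
    using tendsto_mult[OF tendsto_const LIMSEQ_inverse_real_of_nat, of "(\<beta> - \<alpha>) / 3"] by (simp add: d_def[abs_def])
  define s where "s n = \<alpha> + d n" for n
  define t where "t n = \<beta> - d n" for n
  have st: "\<alpha> < s n" "s n < t n" "t n < \<beta>" for n using d0[of n] ab by (auto simp: s_def t_def)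
  have ne: "s n \<noteq> \<alpha>" "t n \<noteq> \<beta>" for n using st[of n] by auto
  have sl: "s \<longlonglongrightarrow> \<alpha>" "t \<longlonglongrightarrow> \<beta>"
    using tendsto_add[OF tendsto_const d, of \<alpha>] tendsto_diff[OF tendsto_const d, of \<beta>]
    by (simp_all add: s_def[abs_def] t_def[abs_def])
  have sfl: "filterlim s (at_right \<alpha>) sequentially" "filterlim t (at_left \<beta>) sequentially"
    using sl st ne by (auto simp: filterlim_at)
  have slim: "(\<lambda>n. P (s n)) \<longlonglongrightarrow> Pa" "(\<lambda>n. Q (s n)) \<longlonglongrightarrow> Qa" "(\<lambda>n. P (t n)) \<longlonglongrightarrow> Pb" "(\<lambda>n. Q (t n)) \<longlonglongrightarrow> Qb"
    by (rule filterlim_compose[OF lim(1) sfl(1)] filterlim_compose[OF lim(2) sfl(1)]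
        filterlim_compose[OF lim(3) sfl(2)] filterlim_compose[OF lim(4) sfl(2)])+
  define L where "L n = integral {s n..t n} r" for n
  have Leq: "L n = F (t n) - F (s n)" for n
  proof -
    have "r integrable_on {\<alpha>..t n}" by (rule integrable_on_subinterval[OF rc]) (use st[of n] in auto)
    then show ?thesis
      using Henstock_Kurzweil_Integration.integral_combine[of \<alpha> "s n" "t n" r] st[of n]
      by (simp add: F_def L_def)
  qed
  have Llim: "L \<longlonglongrightarrow> len"
  proof -
    have mem: "s n \<in> {\<alpha>..\<beta>}" "t n \<in> {\<alpha>..\<beta>}" for n using st[of n] by auto
    have ends: "\<alpha> \<in> {\<alpha>..\<beta>}" "\<beta> \<in> {\<alpha>..\<beta>}" using ab by auto
    have "(\<lambda>n. F (t n)) \<longlonglongrightarrow> F \<beta>"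
      by (rule continuous_on_tendsto_compose[OF Fc sl(2) ends(2) always_eventually]) (simp only: mem simp_thms)
    moreover have "(\<lambda>n. F (s n)) \<longlonglongrightarrow> F \<alpha>"
      by (rule continuous_on_tendsto_compose[OF Fc sl(1) ends(1) always_eventually]) (simp only: mem simp_thms)
    ultimately have "(\<lambda>n. F (t n) - F (s n)) \<longlonglongrightarrow> F \<beta> - F \<alpha>" by (rule tendsto_diff)
    then show ?thesis by (simp add: Leq[abs_def] F\<alpha> F\<beta>)
  qed
  define \<Theta> where "\<Theta> n = V * L n / cmod \<kappa>" for n
  have \<Theta>lim: "\<Theta> \<longlonglongrightarrow> \<theta>"
    unfolding \<Theta>_def[abs_def] \<theta>(1) len[symmetric] by (intro tendsto_intros Llim) (use \<kappa> in auto)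
  have ev: "\<forall>\<^sub>F n in sequentially. \<Theta> n < 1" using order_tendstoD(2)[OF \<Theta>lim \<theta>(2)] .
  have est: "cmod (exp (- \<kappa> * of_real (L n)) * P (t n) - P (s n)) \<le> \<Theta> n / 2 / (1 - \<Theta> n) * (cmod (P (s n)) + cmod (Q (s n)))"
    "cmod (exp (- \<kappa> * of_real (L n)) * Q (t n) - exp (- 2 * \<kappa> * of_real (L n)) * Q (s n))
       \<le> \<Theta> n / 2 / (1 - \<Theta> n) * (cmod (P (s n)) + cmod (Q (s n)))" if \<Theta>: "\<Theta> n < 1" for n
  proof -
    define \<xi> where "\<xi> x = integral {s n..x} r" for x
    have sub: "{s n..t n} \<subseteq> ?I" using st[of n] by auto
    have xi: "\<xi> (t n) - \<xi> (s n) = L n" by (simp add: \<xi>_def L_def)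
    have xider: "(\<xi> has_vector_derivative r x) (at x within {s n..t n})" if "x \<in> {s n..t n}" for x
      unfolding \<xi>_def[abs_def]
      by (rule integral_has_vector_derivative[OF continuous_on_subset[OF r(3) sub] that])
    have rb: "bounded (r ` {s n..t n})" by (rule bounded_subset[OF r(2)]) (use sub in auto)
    have rv: "0 \<le> r x" "cmod (v x) \<le> V" if "x \<in> {s n..t n}" for x
      using r(1)[of x] v[of x] sub that by blast+
    show "cmod (exp (- \<kappa> * of_real (L n)) * P (t n) - P (s n)) \<le> \<Theta> n / 2 / (1 - \<Theta> n) * (cmod (P (s n)) + cmod (Q (s n)))"
      "cmod (exp (- \<kappa> * of_real (L n)) * Q (t n) - exp (- 2 * \<kappa> * of_real (L n)) * Q (s n))
       \<le> \<Theta> n / 2 / (1 - \<Theta> n) * (cmod (P (s n)) + cmod (Q (s n)))"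
      using dichotomy_cell_estimate[of "s n" "t n" P r \<kappa> v Q \<xi> V "\<Theta> n", OF less_imp_le[OF st(2)]
          primitive_on_subset[OF P sub] primitive_on_subset[OF Q sub] xider rv(1) rb rv(2) \<kappa> _ \<Theta>]
      unfolding xi by (simp_all add: \<Theta>_def)
  qed
  have rhs: "(\<lambda>n. \<Theta> n / 2 / (1 - \<Theta> n) * (cmod (P (s n)) + cmod (Q (s n)))) \<longlonglongrightarrow> \<theta> / 2 / (1 - \<theta>) * (cmod Pa + cmod Qa)"
    by (intro tendsto_intros \<Theta>lim slim) (use \<theta>(2) in auto)
  show "cmod (exp (- \<kappa> * of_real len) * Pb - Pa) \<le> \<theta> / 2 / (1 - \<theta>) * (cmod Pa + cmod Qa)"
  proof (rule tendsto_le[OF trivial_limit_sequentially rhs])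
    show "(\<lambda>n. cmod (exp (- \<kappa> * of_real (L n)) * P (t n) - P (s n))) \<longlonglongrightarrow> cmod (exp (- \<kappa> * of_real len) * Pb - Pa)"
      by (intro tendsto_intros slim Llim)
  qed (rule eventually_mono[OF ev est(1)])
  show "cmod (exp (- \<kappa> * of_real len) * Qb - exp (- 2 * \<kappa> * of_real len) * Qa) \<le> \<theta> / 2 / (1 - \<theta>) * (cmod Pa + cmod Qa)"
  proof (rule tendsto_le[OF trivial_limit_sequentially rhs])
    show "(\<lambda>n. cmod (exp (- \<kappa> * of_real (L n)) * Q (t n) - exp (- 2 * \<kappa> * of_real (L n)) * Q (s n)))
        \<longlonglongrightarrow> cmod (exp (- \<kappa> * of_real len) * Qb - exp (- 2 * \<kappa> * of_real len) * Qa)"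
      by (intro tendsto_intros slim Llim)
  qed (rule eventually_mono[OF ev est(2)])
qed

lemma exp_minus_le: "exp (- x) \<le> 1 / (exp 1 * x)" if "x > (0::real)"
proof -
  have "1 + (x - 1) \<le> exp (x - 1)" by (rule exp_ge_add_one_self)
  then have "x * exp 1 \<le> exp x" by (simp add: exp_diff field_simps)
  then show ?thesis using that by (simp add: exp_minus field_simps)
qed

text \<open>Index 0 is the state at the left end of the cell, 1 at its right end and 2 beyond the interface.
  With \<open>E\<^sub>1, E\<^sub>2\<close> the errors of the cell estimate,
  \<open>exp (- \<kappa> len) P2 - g P0 = b P0 + (g + b) E\<^sub>1 + (h + b) (exp (- 2 \<kappa> len) Q0 + E\<^sub>2)\<close>, and similarly for \<open>Q2\<close>.
  The factor \<open>exp (- 2 \<kappa> len)\<close> is small because \<open>exp (- x) \<le> 1 / (e x)\<close>, which is where the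
  summand \<open>1 / (\<surd>2 e len)\<close> of \<open>d\<close> comes from.\<close>

lemma transfer_step:
  fixes P0 Q0 P1 Q1 P2 Q2 \<alpha> \<beta> \<kappa> g h b :: complex and len V \<rho> d :: real
  assumes \<kappa>: "cmod \<kappa> \<le> sqrt 2 * Re \<kappa>" "sqrt 2 * \<rho> \<le> cmod \<kappa>" "0 < \<rho>"
    and len: "0 < len" "0 \<le> V" "len * V \<le> \<rho> / 2"
    and \<theta>: "\<theta> = V * len / cmod \<kappa>"
    and P1: "cmod (exp (- \<kappa> * of_real len) * P1 - P0) \<le> \<theta> / 2 / (1 - \<theta>) * (cmod P0 + cmod Q0)"
    and Q1: "cmod (exp (- \<kappa> * of_real len) * Q1 - exp (- 2 * \<kappa> * of_real len) * Q0) \<le> \<theta> / 2 / (1 - \<theta>) * (cmod P0 + cmod Q0)"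
    and ghb: "g = 1/2 * (\<alpha> + inverse \<alpha>)" "h = 1/2 * (\<alpha> - inverse \<alpha>)" "b = \<beta> / (2 * \<kappa>)"
    and PQ2: "P2 = (g + b) * P1 + (h + b) * Q1" "Q2 = (h - b) * P1 + (g - b) * Q1"
    and d: "cmod \<beta> + 2 * max (max (cmod \<alpha>) (inverse (cmod \<alpha>))) (cmod \<beta> / \<rho>) * (4 * len * V + 1 / (sqrt 2 * exp 1 * len)) \<le> d"
  shows "cmod (exp (- \<kappa> * of_real len) * P2 - g * P0) \<le> d / (sqrt 2 * cmod \<kappa>) * max (cmod P0) (cmod Q0)"
    "cmod (exp (- \<kappa> * of_real len) * Q2 - h * P0) \<le> d / (sqrt 2 * cmod \<kappa>) * max (cmod P0) (cmod Q0)"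
proof -
  have s2: "(7/5) \<le> sqrt 2" by (rule real_le_rsqrt) (simp add: power2_eq_square)
  define K where "K = cmod \<kappa>"
  define e where "e = exp (- \<kappa> * of_real len)"
  define M where "M = max (cmod P0) (cmod Q0)"
  define mx where "mx = max (max (cmod \<alpha>) (inverse (cmod \<alpha>))) (cmod \<beta> / \<rho>)"
  define \<omega> where "\<omega> = 1 / (sqrt 2 * exp 1 * K * len)"
  define \<delta> where "\<delta> = \<theta> / (1 - \<theta>)"
  have K\<rho>: "(7/5) * \<rho> \<le> K"
  proof -
    have "(7/5) * \<rho> \<le> sqrt 2 * \<rho>" by (rule mult_right_mono[OF s2]) (use \<kappa>(3) in simp)
    then show ?thesis using \<kappa>(2) unfolding K_def by linarith
  qed
  then have K0: "0 < K" using \<kappa>(3) by linarith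
  have M0: "0 \<le> M" "cmod P0 \<le> M" "cmod Q0 \<le> M" by (auto simp: M_def le_max_iff_disj)
  have \<theta>0: "0 \<le> \<theta>" using len K0 by (simp add: \<theta> K_def)
  \<comment> \<open>From \<open>\<rho> \<le> \<bar>\<kappa>\<bar> / \<surd>2\<close> one gets \<open>\<theta>, \<bar>b\<bar> / mx \<le> 1 / (2 \<surd>2)\<close>, here rounded to 9/25; then \<open>\<theta> / (1 - \<theta>) \<le> 8/5 \<theta>\<close>.\<close>
  have \<theta>1: "\<theta> \<le> (9/25)"
  proof -
    have "V * len \<le> (9/25) * K" using len(3) K\<rho> \<kappa>(3) by (simp add: mult.commute)
    then show ?thesis using K0 by (simp add: \<theta> K_def divide_le_eq)
  qed
  have \<delta>: "0 \<le> \<delta>" "\<delta> \<le> (8/5) * \<theta>"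
  proof -
    show "0 \<le> \<delta>" using \<theta>0 \<theta>1 by (simp add: \<delta>_def)
    have "\<theta> * 1 \<le> \<theta> * ((8/5) * (1 - \<theta>))" using \<theta>0 \<theta>1 by (intro mult_left_mono) auto
    then show "\<delta> \<le> (8/5) * \<theta>" using \<theta>1 by (simp add: \<delta>_def divide_le_eq mult_ac)
  qed
  have \<omega>0: "0 \<le> \<omega>" using K0 len(1) by (simp add: \<omega>_def)
  have ee: "cmod (exp (- 2 * \<kappa> * of_real len)) \<le> \<omega>"
  proof -
    have pos: "0 < sqrt 2 * K * len" using K0 len(1) by simp
    have "sqrt 2 * K \<le> sqrt 2 * (sqrt 2 * Re \<kappa>)"
      unfolding K_def by (rule mult_left_mono[OF \<kappa>(1)]) simp
    then have "sqrt 2 * K \<le> 2 * Re \<kappa>" by (simp flip: mult.assoc)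
    then have "sqrt 2 * K * len \<le> 2 * Re \<kappa> * len" using len(1) by (intro mult_right_mono) auto
    then have "cmod (exp (- 2 * \<kappa> * of_real len)) \<le> exp (- (sqrt 2 * K * len))" by simp
    also have "\<dots> \<le> 1 / (exp 1 * (sqrt 2 * K * len))" by (rule exp_minus_le[OF pos])
    also have "\<dots> = \<omega>" by (simp add: \<omega>_def mult_ac)
    finally show ?thesis .
  qed
  have mx0: "0 \<le> mx" "cmod \<alpha> \<le> mx" "inverse (cmod \<alpha>) \<le> mx" "cmod \<beta> / \<rho> \<le> mx"
    by (auto simp: mx_def intro: order_trans[OF norm_ge_zero] le_max_iff_disj[THEN iffD2])
  have g: "cmod g \<le> mx" "cmod h \<le> mx"
  proof -
    have "cmod (\<alpha> + inverse \<alpha>) \<le> mx + mx" "cmod (\<alpha> - inverse \<alpha>) \<le> mx + mx"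
      using mx0 by (intro order_trans[OF norm_triangle_ineq] order_trans[OF norm_triangle_ineq4] add_mono; simp add: norm_inverse)+
    then show "cmod g \<le> mx" "cmod h \<le> mx" unfolding ghb norm_mult by simp_all
  qed
  have b: "cmod b = cmod \<beta> / (2 * K)" by (simp add: ghb norm_divide norm_mult K_def)
  have bmx: "cmod b \<le> (9/25) * mx"
  proof -
    have "cmod \<beta> \<le> mx * \<rho>" using mx0(4) \<kappa>(3) by (simp add: divide_le_eq)
    also have "\<dots> \<le> mx * ((18/25) * K)" using K\<rho> \<kappa>(3) mx0(1) by (intro mult_left_mono) auto
    finally show ?thesis using K0 by (simp add: b divide_le_eq)
  qed
  define E1 where "E1 = e * P1 - P0"
  define E2 where "E2 = e * Q1 - exp (- 2 * \<kappa> * of_real len) * Q0"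
  define W where "W = exp (- 2 * \<kappa> * of_real len) * Q0"
  have PQM: "\<theta> / 2 / (1 - \<theta>) * (cmod P0 + cmod Q0) \<le> \<delta> * M"
  proof -
    have \<delta>2: "\<theta> / 2 / (1 - \<theta>) = \<delta> / 2" by (simp add: \<delta>_def)
    have "\<delta> / 2 * (cmod P0 + cmod Q0) \<le> \<delta> / 2 * (M + M)"
      using M0 \<delta>(1) by (intro mult_left_mono add_mono) auto
    also have "\<dots> = \<delta> * M" by simp
    finally show ?thesis unfolding \<delta>2 .
  qed
  have E: "cmod E1 \<le> \<delta> * M" "cmod E2 \<le> \<delta> * M"
    using order_trans[OF P1 PQM] order_trans[OF Q1 PQM] by (simp_all add: E1_def E2_def e_def)
  have W: "cmod W \<le> \<omega> * M"
    unfolding W_def norm_mult by (intro mult_mono ee M0 \<omega>0 norm_ge_zero)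
  have main: "cmod (b' * P0 + x1 * E1 + x2 * (W + E2)) \<le> d / (sqrt 2 * K) * M"
    if "cmod b' = cmod b" "cmod x1 \<le> (34/25) * mx" "cmod x2 \<le> (34/25) * mx" for b' x1 x2
  proof -
    have "cmod (b' * P0 + x1 * E1 + x2 * (W + E2)) \<le> cmod (b' * P0) + cmod (x1 * E1) + cmod (x2 * (W + E2))"
      by (intro order_trans[OF norm_triangle_ineq] add_mono norm_triangle_ineq order_refl)
    also have "\<dots> \<le> cmod b * M + ((34/25) * mx) * (\<delta> * M) + ((34/25) * mx) * (\<omega> * M + \<delta> * M)"
      unfolding norm_mult using that mx0(1)
      by (intro add_mono mult_mono order_trans[OF norm_triangle_ineq] M0 E W) (auto simp: M0)
    also have "\<dots> = (cmod b + (34/25) * mx * (2 * \<delta> + \<omega>)) * M" by (simp add: algebra_simps)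
    also have "\<dots> \<le> d / (sqrt 2 * K) * M"
    proof (rule mult_right_mono[OF _ M0(1)])
      have "K * (2 * \<delta> + \<omega>) \<le> K * (2 * ((8/5) * \<theta>) + \<omega>)"
        using K0 \<delta>(2) by (intro mult_left_mono) auto
      also have "\<dots> = (16/5) * (len * V) + 1 / (sqrt 2 * exp 1 * len)"
        using K0 by (simp add: \<theta> \<omega>_def K_def[symmetric] field_simps)
      finally have A: "K * (2 * \<delta> + \<omega>) \<le> (16/5) * (len * V) + 1 / (sqrt 2 * exp 1 * len)" .
      define T where "T = 1 / (sqrt 2 * exp 1 * len)"
      have T0: "0 \<le> T" using len(1) by (simp add: T_def)
      have lV: "0 \<le> len * V" using len by simp
      have "sqrt 2 * K * (cmod b + (34/25) * mx * (2 * \<delta> + \<omega>)) = sqrt 2 * (cmod \<beta> / 2) + sqrt 2 * ((34/25) * mx) * (K * (2 * \<delta> + \<omega>))"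
        using K0 by (simp add: b algebra_simps)
      also have "\<dots> \<le> sqrt 2 * (cmod \<beta> / 2) + sqrt 2 * ((34/25) * mx) * ((16/5) * (len * V) + T)"
        using A mx0(1) by (intro add_left_mono mult_left_mono) (auto simp: T_def)
      \<comment> \<open>There is room to spare: \<open>\<surd>2 \<cdot> 34/25 < 2\<close>, and \<open>16/5 < 4\<close>.\<close>
      also have "\<dots> \<le> cmod \<beta> + 2 * mx * (4 * len * V + T)"
      proof (rule add_mono)
        have s3: "sqrt 2 \<le> (71/50)" by (rule real_le_lsqrt) (auto simp: power2_eq_square)
        have "sqrt 2 * (cmod \<beta> / 2) \<le> 2 * (cmod \<beta> / 2)"
          by (intro mult_right_mono real_le_lsqrt) auto
        then show "sqrt 2 * (cmod \<beta> / 2) \<le> cmod \<beta>" by simp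
        have "sqrt 2 * ((34/25) * mx) * ((16/5) * (len * V) + T) \<le> (71/50) * ((34/25) * mx) * ((16/5) * (len * V) + T)"
          using s3 mx0(1) lV T0 by (intro mult_right_mono) auto
        also have "\<dots> = mx * ((71/50) * (34/25) * ((16/5) * (len * V) + T))" by simp
        also have "\<dots> \<le> mx * (2 * (4 * (len * V) + T))"
          using lV T0 by (intro mult_left_mono mx0(1)) (simp add: algebra_simps)
        finally show "sqrt 2 * ((34/25) * mx) * ((16/5) * (len * V) + T) \<le> 2 * mx * (4 * len * V + T)"
          by (simp add: mult_ac)
      qed
      also have "\<dots> \<le> d" using d by (simp add: mx_def T_def)
      finally show "cmod b + (34/25) * mx * (2 * \<delta> + \<omega>) \<le> d / (sqrt 2 * K)"
        using K0 by (simp add: pos_le_divide_eq mult.commute)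
    qed
    finally show ?thesis .
  qed
  have eP: "e * P1 = P0 + E1" and eQ: "e * Q1 = W + E2" by (simp_all add: E1_def E2_def W_def)
  have 1: "e * P2 - g * P0 = b * P0 + (g + b) * E1 + (h + b) * (W + E2)"
  proof -
    have "e * P2 = (g + b) * (e * P1) + (h + b) * (e * Q1)" by (simp add: PQ2 algebra_simps)
    then show ?thesis unfolding eP eQ by (simp add: algebra_simps)
  qed
  have 2: "e * Q2 - h * P0 = (- b) * P0 + (h - b) * E1 + (g - b) * (W + E2)"
  proof -
    have "e * Q2 = (h - b) * (e * P1) + (g - b) * (e * Q1)" by (simp add: PQ2 algebra_simps)
    then show ?thesis unfolding eP eQ by (simp add: algebra_simps)
  qed
  have gb: "cmod (g + b) \<le> (34/25) * mx" "cmod (h + b) \<le> (34/25) * mx" "cmod (g - b) \<le> (34/25) * mx" "cmod (h - b) \<le> (34/25) * mx"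
    using g bmx norm_triangle_ineq[of g b] norm_triangle_ineq[of h b] norm_triangle_ineq4[of g b] norm_triangle_ineq4[of h b]
    by linarith+
  show "cmod (exp (- \<kappa> * of_real len) * P2 - g * P0) \<le> d / (sqrt 2 * cmod \<kappa>) * max (cmod P0) (cmod Q0)"
    using main[OF refl gb(1,2)] unfolding e_def[symmetric] 1 K_def M_def .
  show "cmod (exp (- \<kappa> * of_real len) * Q2 - h * P0) \<le> d / (sqrt 2 * cmod \<kappa>) * max (cmod P0) (cmod Q0)"
    using main[OF norm_minus_cancel gb(4,3)] unfolding e_def[symmetric] 2 K_def M_def .
qed

text \<open>The maximum norm suits the limiting matrices with rows \<open>(g, 0)\<close> and \<open>(h, 0)\<close>: their row sums are at
  most \<open>c\<close>.  So the usual telescoping bound for a perturbed product is \<open>(c + f)\<^sup>m - c\<^sup>m\<close>.\<close>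

lemma perturbed_triangular_recursion:
  fixes X Y g h :: "nat \<Rightarrow> complex"
  assumes cf: "0 \<le> c" "0 \<le> f"
    and gh: "\<And>j. j < m \<Longrightarrow> cmod (g j) \<le> c" "\<And>j. j < m \<Longrightarrow> cmod (h j) \<le> c"
    and X: "\<And>j. j < m \<Longrightarrow> cmod (X (Suc j) - g j * X j) \<le> f * max (cmod (X j)) (cmod (Y j))"
    and Y: "\<And>j. j < m \<Longrightarrow> cmod (Y (Suc j) - h j * X j) \<le> f * max (cmod (X j)) (cmod (Y j))"
    and M: "cmod (X 0) \<le> M" "cmod (Y 0) \<le> M"
  shows "cmod (X m - (\<Prod>j<m. g j) * X 0) \<le> ((c + f) ^ m - c ^ m) * M"
    and "X 0 = 0 \<Longrightarrow> 0 < m \<Longrightarrow> cmod (Y m) \<le> ((c + f) ^ m - c ^ m) * M"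
proof -
  have M0: "0 \<le> M" using M(1) norm_ge_zero order_trans by blast
  have step: "cmod (z - k * G) \<le> ((c + f) ^ Suc n - c ^ Suc n) * M"
    if "cmod (z - k * X n) \<le> f * max (cmod (X n)) (cmod (Y n))" "cmod k \<le> c"
      "max (cmod (X n)) (cmod (Y n)) \<le> (c + f) ^ n * M" "cmod (X n - G) \<le> ((c + f) ^ n - c ^ n) * M"
    for z k G n
  proof -
    have "z - k * G = (z - k * X n) + k * (X n - G)" by (simp add: algebra_simps)
    also have "cmod \<dots> \<le> cmod (z - k * X n) + cmod k * cmod (X n - G)"
      by (metis norm_mult norm_triangle_ineq)
    also have "\<dots> \<le> f * ((c + f) ^ n * M) + c * (((c + f) ^ n - c ^ n) * M)"
      using that cf by (intro add_mono mult_mono order_trans[OF that(1)] mult_left_mono) auto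
    also have "\<dots> = ((c + f) ^ Suc n - c ^ Suc n) * M" by (simp add: algebra_simps)
    finally show ?thesis .
  qed
  have bound: "max (cmod (X n)) (cmod (Y n)) \<le> (c + f) ^ n * M" if "n \<le> m" for n
    using that
  proof (induction n)
    case 0
    then show ?case using M by simp
  next
    case (Suc n)
    then have IH: "max (cmod (X n)) (cmod (Y n)) \<le> (c + f) ^ n * M" and n: "n < m" by auto
    have *: "cmod z \<le> (c + f) ^ Suc n * M"
      if "cmod (z - k * X n) \<le> f * max (cmod (X n)) (cmod (Y n))" "cmod k \<le> c" for z k
    proof -
      have "cmod z \<le> cmod (z - k * X n) + cmod (k * X n)" using norm_triangle_sub[of z "k * X n"] by simp
      also have "\<dots> \<le> f * ((c + f) ^ n * M) + c * ((c + f) ^ n * M)"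
        unfolding norm_mult using that IH cf by (intro add_mono mult_mono order_trans[OF that(1)] mult_left_mono) auto
      also have "\<dots> = (c + f) ^ Suc n * M" by (simp add: algebra_simps)
      finally show ?thesis .
    qed
    show ?case using *[OF X[OF n] gh(1)[OF n]] *[OF Y[OF n] gh(2)[OF n]] by simp
  qed
  have dev: "cmod (X n - (\<Prod>j<n. g j) * X 0) \<le> ((c + f) ^ n - c ^ n) * M" if "n \<le> m" for n
    using that
  proof (induction n)
    case (Suc n)
    then have n: "n < m" by simp
    have "cmod (X (Suc n) - g n * ((\<Prod>j<n. g j) * X 0)) \<le> ((c + f) ^ Suc n - c ^ Suc n) * M"
      by (rule step[OF X[OF n] gh(1)[OF n] bound]) (use Suc n in auto)
    then show ?case by (simp add: mult_ac)
  qed simp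
  show "cmod (X m - (\<Prod>j<m. g j) * X 0) \<le> ((c + f) ^ m - c ^ m) * M" by (rule dev) simp
  show "cmod (Y m) \<le> ((c + f) ^ m - c ^ m) * M" if X0: "X 0 = 0" "0 < m"
  proof -
    obtain n where n: "m = Suc n" using X0(2) gr0_implies_Suc by blast
    have "cmod (Y (Suc n) - h n * ((\<Prod>j<n. g j) * X 0)) \<le> ((c + f) ^ Suc n - c ^ Suc n) * M"
      by (rule step[OF Y gh(2) bound dev]) (use n in auto)
    then show ?thesis using X0 n by simp
  qed
qed

text \<open>The left-hand side is a polynomial in \<open>\<mu>\<close> with nonnegative coefficients and no constant term,
  so for \<open>0 \<le> \<mu> \<le> 1\<close> it is at most \<open>\<mu>\<close> times its value at 1.\<close>

lemma power_increment_scale: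
  fixes c D \<mu> :: real
  assumes "0 \<le> c" "0 \<le> D" "0 \<le> \<mu>" "\<mu> \<le> 1"
  shows "(c + \<mu> * D) ^ m - c ^ m \<le> \<mu> * ((c + D) ^ m - c ^ m)"
proof (induction m)
  case (Suc m)
  have le: "0 \<le> (c + D) ^ m - c ^ m" using assms power_mono[of c "c + D" m] by simp
  have \<mu>D: "\<mu> * D \<le> D" using assms mult_right_mono[of \<mu> 1 D] by simp
  have "(c + \<mu> * D) ^ Suc m - c ^ Suc m = (c + \<mu> * D) * ((c + \<mu> * D) ^ m - c ^ m) + \<mu> * D * c ^ m"
    by (simp add: algebra_simps)
  also have "\<dots> \<le> (c + \<mu> * D) * (\<mu> * ((c + D) ^ m - c ^ m)) + \<mu> * D * c ^ m"
    using assms by (intro add_right_mono mult_left_mono Suc) auto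
  also have "\<dots> \<le> (c + D) * (\<mu> * ((c + D) ^ m - c ^ m)) + \<mu> * D * c ^ m"
    using assms le \<mu>D by (intro add_right_mono mult_right_mono) auto
  also have "\<dots> = \<mu> * ((c + D) ^ Suc m - c ^ Suc m)" by (simp add: algebra_simps)
  finally show ?case .
qed simp

text \<open>The characteristic equation \<open>\<mu>\<^sup>2 - (N11 + N22) \<mu> + 1 = 0\<close>.\<close>

lemma trace_of_unimodular_eigenvalue:
  fixes N11 N12 N21 N22 \<mu> p q :: complex
  assumes "N11 * p + N12 * q = \<mu> * p" "N21 * p + N22 * q = \<mu> * q" "p \<noteq> 0 \<or> q \<noteq> 0"
    and det: "N11 * N22 - N12 * N21 = 1" and \<mu>: "cmod \<mu> = 1"
  shows "cmod (N11 + N22) \<le> 2"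
proof -
  have e1: "(N11 - \<mu>) * p = - (N12 * q)" "N21 * p = (\<mu> - N22) * q"
    using assms(1,2) by (simp_all add: algebra_simps add_eq_0_iff eq_neg_iff_add_eq_0 diff_eq_eq)
  have "((N11 - \<mu>) * (N22 - \<mu>)) * p = (N12 * N21) * p" 
  proof -
    have "((N11 - \<mu>) * (N22 - \<mu>)) * p = ((N11 - \<mu>) * p) * (N22 - \<mu>)" by (simp only: mult_ac)
    also have "\<dots> = N12 * ((\<mu> - N22) * q)" unfolding e1(1) by (simp add: algebra_simps)
    finally show ?thesis unfolding e1(2)[symmetric] by (simp only: mult_ac)
  qed
  moreover have "((N11 - \<mu>) * (N22 - \<mu>)) * q = (N12 * N21) * q"
  proof -
    have "((N11 - \<mu>) * (N22 - \<mu>)) * q = (\<mu> - N11) * ((\<mu> - N22) * q)" by (simp add: algebra_simps)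
    also have "\<dots> = - ((N11 - \<mu>) * p) * N21" unfolding e1(2)[symmetric] by (simp add: algebra_simps)
    finally show ?thesis unfolding e1(1) by (simp add: mult_ac)
  qed
  ultimately have "(N11 - \<mu>) * (N22 - \<mu>) = N12 * N21" using assms(3) by auto
  then have "(N11 + N22) * \<mu> = \<mu> * \<mu> + 1" using det by (simp add: algebra_simps)
  then have "cmod (N11 + N22) * cmod \<mu> \<le> cmod \<mu> * cmod \<mu> + 1"
    by (metis norm_mult norm_one norm_triangle_ineq)
  then show ?thesis using \<mu> by simp
qed

text \<open>The coordinates \<open>P\<close> and \<open>Q\<close> of the state \<open>(y, u)\<close> at a point where \<open>\<sigma>\<close> and \<open>\<tau>\<close> have the values
  \<open>s\<close> and \<open>\<tau>\<close>.\<close>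

definition frame_plus :: "complex \<Rightarrow> complex \<Rightarrow> complex \<Rightarrow> complex \<Rightarrow> complex \<Rightarrow> complex" where
  "frame_plus s \<tau> \<kappa> y u = 1/2 * (s * y + (u / s + \<tau> * y) / \<kappa>)"

definition frame_minus :: "complex \<Rightarrow> complex \<Rightarrow> complex \<Rightarrow> complex \<Rightarrow> complex \<Rightarrow> complex" where
  "frame_minus s \<tau> \<kappa> y u = 1/2 * (s * y - (u / s + \<tau> * y) / \<kappa>)"

lemma frame_wronskian:
  assumes "s \<noteq> 0" "\<kappa> \<noteq> 0"
  shows "frame_plus s \<tau> \<kappa> y u * frame_minus s \<tau> \<kappa> y' u' - frame_plus s \<tau> \<kappa> y' u' * frame_minus s \<tau> \<kappa> y u
    = (u * y' - y * u') / (2 * \<kappa>)"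
  using assms by (simp add: frame_plus_def frame_minus_def field_simps)

lemma frame_linear:
  "frame_plus s \<tau> \<kappa> (c * y + d * y') (c * u + d * u') = c * frame_plus s \<tau> \<kappa> y u + d * frame_plus s \<tau> \<kappa> y' u'"
  "frame_minus s \<tau> \<kappa> (c * y + d * y') (c * u + d * u') = c * frame_minus s \<tau> \<kappa> y u + d * frame_minus s \<tau> \<kappa> y' u'"
  by (simp_all add: frame_plus_def frame_minus_def algebra_simps add_divide_distrib)

lemma frame_inverse:
  assumes "s \<noteq> 0" "\<kappa> \<noteq> 0"
  shows "y = (frame_plus s \<tau> \<kappa> y u + frame_minus s \<tau> \<kappa> y u) / s"
    "u = s * (\<kappa> * (frame_plus s \<tau> \<kappa> y u - frame_minus s \<tau> \<kappa> y u) - \<tau> * y)"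
  using assms by (simp_all add: frame_plus_def frame_minus_def field_simps)

lemma frame_surjective:
  assumes "s \<noteq> 0" "\<kappa> \<noteq> 0"
  shows "frame_plus s \<tau> \<kappa> ((P + Q) / s) (s * (\<kappa> * (P - Q) - \<tau> * ((P + Q) / s))) = P"
    "frame_minus s \<tau> \<kappa> ((P + Q) / s) (s * (\<kappa> * (P - Q) - \<tau> * ((P + Q) / s))) = Q"
  using assms by (simp_all add: frame_plus_def frame_minus_def field_simps)

text \<open>The same state \<open>(y, u)\<close> is expressed in the frames to the left, \<open>(s, \<tau>)\<close>, and to the right,
  \<open>(s', \<tau>')\<close>, of an interface.\<close>

lemma frame_jump:
  assumes nz: "s \<noteq> 0" "s' \<noteq> 0" "\<kappa> \<noteq> 0"
    and \<alpha>: "\<alpha> = s' / s" and \<beta>: "\<beta> = (\<tau>' * s' - \<tau> * s) / (s' * s)"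
  defines "g \<equiv> 1/2 * (\<alpha> + inverse \<alpha>)" and "h \<equiv> 1/2 * (\<alpha> - inverse \<alpha>)" and "b \<equiv> \<beta> / (2 * \<kappa>)"
  shows "frame_plus s' \<tau>' \<kappa> y u = (g + b) * frame_plus s \<tau> \<kappa> y u + (h + b) * frame_minus s \<tau> \<kappa> y u"
    "frame_minus s' \<tau>' \<kappa> y u = (h - b) * frame_plus s \<tau> \<kappa> y u + (g - b) * frame_minus s \<tau> \<kappa> y u"
  using nz by (simp_all add: g_def h_def b_def \<alpha> \<beta> frame_plus_def frame_minus_def field_simps)

section \<open>The monodromy trace and the eigenvalue bound\<close>

text \<open>With \<open>T = K / \<surd>2\<close> the hypothesis contains \<open>c + \<mu> (d / \<rho>)\<close> for \<open>\<mu> = \<rho> / (2 T)\<close>.  If \<open>T\<close> exceeded the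
  maximum, \<open>\<mu>\<close> would be at most 1, and \<open>power_increment_scale\<close> would make both summands of the
  hypothesis smaller than \<open>G / 2\<close>.\<close>

lemma final_numeric_bound:
  fixes G \<rho> c d k K len :: real
  assumes G: "0 < G" and \<rho>: "0 < \<rho>" and cd: "0 \<le> c" "0 \<le> d" and K: "K \<le> sqrt 2 * k" and len: "0 < len"
    and hyp: "sqrt 2 * \<rho> \<le> K \<Longrightarrow> G \<le> 2 * ((c + d / (sqrt 2 * K)) ^ m - c ^ m) + 2 * exp (- (k * len))"
  shows "K \<le> sqrt 2 * Max {\<rho>, 2 * \<rho> / G * ((c + d / \<rho>) ^ m - c ^ m), 1 / len * ln (4 / G)}"
proof (rule ccontr)
  define S where "S = (c + d / \<rho>) ^ m - c ^ m"
  define T where "T = K / sqrt 2"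
  define mx where "mx = Max {\<rho>, 2 * \<rho> / G * S, 1 / len * ln (4 / G)}"
  assume "\<not> K \<le> sqrt 2 * Max {\<rho>, 2 * \<rho> / G * ((c + d / \<rho>) ^ m - c ^ m), 1 / len * ln (4 / G)}"
  then have "sqrt 2 * mx < K" unfolding mx_def S_def by (simp only: not_le)
  then have "mx < T" unfolding T_def by (simp add: pos_less_divide_eq mult.commute)
  then have T: "\<rho> < T" "2 * \<rho> / G * S < T" "1 / len * ln (4 / G) < T" by (auto simp: mx_def)
  have T0: "0 < T" using T(1) \<rho> by linarith
  have KT: "K = sqrt 2 * T" by (simp add: T_def)
  define \<mu> where "\<mu> = \<rho> / (2 * T)"
  have \<mu>: "0 \<le> \<mu>" "\<mu> \<le> 1" using T(1) T0 \<rho> by (auto simp: \<mu>_def)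
  have "d / (sqrt 2 * K) = \<mu> * (d / \<rho>)" using \<rho> by (simp add: KT \<mu>_def flip: mult.assoc)
  moreover define X where "X = (c + d / (sqrt 2 * K)) ^ m - c ^ m"
  ultimately have "X \<le> \<mu> * S"
    unfolding S_def using power_increment_scale[OF cd(1) _ \<mu>, of "d / \<rho>" m] cd \<rho> by simp
  moreover have "\<mu> * S < G / 4"
  proof -
    have "\<rho> * S < G * T / 2" using T(2) G by (simp add: field_simps)
    then show ?thesis using T0 by (simp add: \<mu>_def field_simps)
  qed
  moreover have "exp (- (k * len)) < G / 4"
  proof -
    have "T \<le> k" using K by (simp add: KT)
    then have "ln (4 / G) < k * len"
      using T(3) len by (simp add: pos_divide_less_eq less_le_trans mult_right_mono)
    then have "4 / G < exp (k * len)" using G by (metis exp_less_cancel_iff exp_ln divide_pos_pos zero_less_numeral)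
    then show ?thesis using G by (simp add: exp_minus field_simps)
  qed
  moreover have "G \<le> 2 * X + 2 * exp (- (k * len))"
    unfolding X_def by (rule hyp) (use T(1) in \<open>simp add: KT\<close>)
  ultimately show False by linarith
qed

lemma abs_continuous_imp_continuous_on:
  fixes f :: "real \<Rightarrow> 'a::real_normed_vector"
  assumes "abs_continuous_on a b f"
  shows "continuous_on {a..b} f"
  unfolding continuous_on_iff
proof (intro ballI allI impI)
  fix x e :: real assume x: "x \<in> {a..b}" and e: "e > 0"
  obtain \<delta> where \<delta>: "\<delta> > 0" and ac\<delta>: "\<forall>D. finite D \<longrightarrow> (\<forall>(s, t)\<in>D. a \<le> s \<and> s < t \<and> t \<le> b) \<longrightarrow>
      pairwise (\<lambda>(s, t) (s', t'). {s<..<t} \<inter> {s'<..<t'} = {}) D \<longrightarrow>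
      (\<Sum>(s, t)\<in>D. t - s) < \<delta> \<longrightarrow> (\<Sum>(s, t)\<in>D. norm (f t - f s)) < e"
    using assms[unfolded abs_continuous_on_def, THEN spec, THEN mp, OF e] by blast
  have *: "norm (f t - f s) < e" if "a \<le> s" "s < t" "t \<le> b" "t - s < \<delta>" for s t
    using ac\<delta>[THEN spec, of "{(s, t)}"] that by simp
  have "dist (f y) (f x) < e" if y: "y \<in> {a..b}" "dist y x < \<delta>" for y
  proof -
    consider "y = x" | "x < y" | "y < x" by linarith
    then show ?thesis
    proof cases
      case 2
      then show ?thesis using *[of x y] x y by (simp add: dist_norm)
    next
      case 3
      then show ?thesis using *[of y x] x y by (simp add: dist_norm norm_minus_commute)
    qed (use e in simp)
  qed
  then show "\<exists>d>0. \<forall>x'\<in>{a..b}. dist x' x < d \<longrightarrow> dist (f x') (f x) < e" using \<delta> by blast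
qed

text \<open>The difference of the two sides vanishes at \<open>a\<close>, so its Wronskians with the two independent solutions
  vanish everywhere, which forces it to be 0.\<close>

lemma system_solution_unique:
  fixes A B y u y1 u1 y2 u2 :: "real \<Rightarrow> complex"
  assumes s0: "primitive_on {a..b} y (\<lambda>t. A t * u t)" "primitive_on {a..b} u (\<lambda>t. B t * y t)"
    and s1: "primitive_on {a..b} y1 (\<lambda>t. A t * u1 t)" "primitive_on {a..b} u1 (\<lambda>t. B t * y1 t)"
    and s2: "primitive_on {a..b} y2 (\<lambda>t. A t * u2 t)" "primitive_on {a..b} u2 (\<lambda>t. B t * y2 t)"
    and W: "u1 a * y2 a - y1 a * u2 a \<noteq> 0"
    and init: "y a = c * y1 a + d * y2 a" "u a = c * u1 a + d * u2 a" and t: "t \<in> {a..b}"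
  shows "y t = c * y1 t + d * y2 t" "u t = c * u1 t + d * u2 t"
proof -
  define Y where "Y t = y t + ((- c) * y1 t + (- d) * y2 t)" for t
  define U where "U t = u t + ((- c) * u1 t + (- d) * u2 t)" for t
  have "primitive_on {a..b} Y (\<lambda>t. A t * u t + ((- c) * (A t * u1 t) + (- d) * (A t * u2 t)))"
    unfolding Y_def[abs_def] by (intro primitive_on_add primitive_on_cmult s0 s1 s2)
  then have Y: "primitive_on {a..b} Y (\<lambda>t. A t * U t)"
    by (rule primitive_on_cong) (simp_all add: U_def algebra_simps)
  have "primitive_on {a..b} U (\<lambda>t. B t * y t + ((- c) * (B t * y1 t) + (- d) * (B t * y2 t)))"
    unfolding U_def[abs_def] by (intro primitive_on_add primitive_on_cmult s0 s1 s2)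
  then have U: "primitive_on {a..b} U (\<lambda>t. B t * Y t)"
    by (rule primitive_on_cong) (simp_all add: Y_def algebra_simps)
  have itv: "is_interval {a..b}" "bounded {a..b}" "a \<le> t" "{a..t} \<subseteq> {a..b}"
    using t by (auto simp: is_interval_cc)
  have "Y a = 0" "U a = 0" using init by (simp_all add: Y_def U_def)
  then have w1: "Y t * u1 t - U t * y1 t = 0" and w2: "Y t * u2 t - U t * y2 t = 0"
    using wronskian_constant[OF Y U s1 itv] wronskian_constant[OF Y U s2 itv] by simp_all
  have w: "u1 t * y2 t - y1 t * u2 t \<noteq> 0"
  proof -
    have "u1 t * y2 t - y1 t * u2 t = - (y1 t * u2 t - u1 t * y2 t)" by simp
    also have "\<dots> = u1 a * y2 a - y1 a * u2 a" unfolding wronskian_constant[OF s1 s2 itv, symmetric] by simp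
    finally show ?thesis using W by simp
  qed
  have "Y t * (u1 t * y2 t - y1 t * u2 t) = (Y t * u1 t - U t * y1 t) * y2 t - (Y t * u2 t - U t * y2 t) * y1 t"
    by (simp add: algebra_simps)
  then have "Y t = 0" using w w1 w2 by simp
  moreover have "U t * (u1 t * y2 t - y1 t * u2 t) = (Y t * u1 t - U t * y1 t) * u2 t - (Y t * u2 t - U t * y2 t) * u1 t"
    by (simp add: algebra_simps)
  then have "U t = 0" using w w1 w2 by simp
  ultimately show "y t = c * y1 t + d * y2 t" "u t = c * u1 t + d * u2 t"
    by (simp_all add: Y_def U_def algebra_simps eq_neg_iff_add_eq_0)
qed

text \<open>All that the final argument needs to know about a cell.  The frames at its ends are one-sided limits,
  which exist because \<open>\<sigma>\<close>, \<open>r\<close> and the derivative of \<open>p r\<close> are Lipschitz on the cell.\<close>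

lemma cell_transfer:
  fixes p q q0 w \<sigma> :: "real \<Rightarrow> complex" and r :: "real \<Rightarrow> real" and x :: "nat \<Rightarrow> real"
  assumes xx: "x (j - 1) < x j"
    and pw: "p \<in> W2inf (cell x j)" "w \<in> W2inf (cell x j)"
    and pinf: "0 < (INF t\<in>cell x j. cmod (p t))" and winf: "0 < (INF t\<in>cell x j. cmod (w t))"
    and r: "\<And>t. t \<in> cell x j \<Longrightarrow> r t > 0 \<and> w t / p t = of_real (r t ^ 2)"
    and \<sigma>: "continuous_on (cell x j) \<sigma>" "\<And>t. t \<in> cell x j \<Longrightarrow> \<sigma> t ^ 2 = pr p r t"
    and q: "q \<in> borel_measurable (lebesgue_on (cell x j))"
    and q0: "negligible N0" "\<And>t. t \<in> cell x j - N0 \<Longrightarrow> q t = q0 t" "bounded (q0 ` cell x j)"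
  defines "sR \<equiv> Lim (at_right (x (j - 1))) \<sigma>" and "sL \<equiv> Lim (at_left (x j)) \<sigma>"
    and "tR \<equiv> Lim (at_right (x (j - 1))) (\<lambda>t. vector_derivative (pr p r) (at t)) /
               (2 * of_real (Lim (at_right (x (j - 1))) r) * Lim (at_right (x (j - 1))) \<sigma>)"
    and "tL \<equiv> Lim (at_left (x j)) (\<lambda>t. vector_derivative (pr p r) (at t)) /
               (2 * of_real (Lim (at_left (x j)) r) * Lim (at_left (x j)) \<sigma>)"
    and "V \<equiv> V_const x p q r j" and "len \<equiv> ell_tilde_j x r j"
  shows "sR \<noteq> 0" "sL \<noteq> 0" "Lim (at_right (x (j - 1))) (pr p r) = sR\<^sup>2" "Lim (at_left (x j)) (pr p r) = sL\<^sup>2"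
    "0 \<le> V" "0 < len"
    "bounded ((\<lambda>t. 1 / p t) ` cell x j)" "bounded (w ` cell x j)"
    "\<And>t. t \<in> cell x j \<Longrightarrow> p t \<noteq> 0"
    "\<And>y u \<kappa> ya ua yb ub. \<lbrakk>primitive_on (cell x j) y (\<lambda>t. u t / p t);
        primitive_on (cell x j) u (\<lambda>t. (q0 t + \<kappa>\<^sup>2 * w t) * y t); Re \<kappa> > 0; V * len / cmod \<kappa> < 1;
        (y \<longlongrightarrow> ya) (at_right (x (j - 1))); (u \<longlongrightarrow> ua) (at_right (x (j - 1)));
        (y \<longlongrightarrow> yb) (at_left (x j)); (u \<longlongrightarrow> ub) (at_left (x j))\<rbrakk> \<Longrightarrow>
      cmod (exp (- \<kappa> * of_real len) * frame_plus sL tL \<kappa> yb ub - frame_plus sR tR \<kappa> ya ua)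
        \<le> (V * len / cmod \<kappa>) / 2 / (1 - V * len / cmod \<kappa>) * (cmod (frame_plus sR tR \<kappa> ya ua) + cmod (frame_minus sR tR \<kappa> ya ua)) \<and>
      cmod (exp (- \<kappa> * of_real len) * frame_minus sL tL \<kappa> yb ub - exp (- 2 * \<kappa> * of_real len) * frame_minus sR tR \<kappa> ya ua)
        \<le> (V * len / cmod \<kappa>) / 2 / (1 - V * len / cmod \<kappa>) * (cmod (frame_plus sR tR \<kappa> ya ua) + cmod (frame_minus sR tR \<kappa> ya ua))"
proof -
  define \<alpha> where "\<alpha> = x (j - 1)"
  define \<beta> where "\<beta> = x j"
  have I: "cell x j = {\<alpha><..<\<beta>}" by (simp add: cell_def \<alpha>_def \<beta>_def)
  have ab: "\<alpha> < \<beta>" using xx by (simp add: \<alpha>_def \<beta>_def)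
  let ?I = "{\<alpha><..<\<beta>}"
  have itv: "is_interval ?I" "bounded ?I" by (auto simp: is_interval_oo)
  obtain p1 p2 r1 r2 c where c: "c > 0" "\<And>t. t \<in> ?I \<Longrightarrow> c \<le> cmod (p t)" "\<And>t. t \<in> ?I \<Longrightarrow> c \<le> r t"
    and p: "\<And>t. t \<in> ?I \<Longrightarrow> (p has_vector_derivative p1 t) (at t)" "primitive_on ?I p1 p2"
    and rd: "\<And>t. t \<in> ?I \<Longrightarrow> (r has_vector_derivative r1 t) (at t)" "primitive_on ?I r1 r2"
    and ppr: "primitive_on ?I p p1" "primitive_on ?I r r1"
    by (rule cell_coefficients[OF ab pw[unfolded I] pinf[unfolded I] winf[unfolded I] r[unfolded I]]; assumption?; blast)
  have \<sigma>': "continuous_on ?I \<sigma>" "\<And>t. t \<in> ?I \<Longrightarrow> \<sigma> t ^ 2 = p t * of_real (r t)"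
    using \<sigma> unfolding I pr_def by auto
  note sd = sigma_derivative[OF c p rd ppr \<sigma>']
  define M where "M t = p1 t * r t + p t * r1 t" for t
  have Mder: "(pr p r has_vector_derivative M t) (at t)" if "t \<in> ?I" for t
    unfolding M_def by (rule sd(1)) (use that in auto)
  have slow: "c \<le> cmod (\<sigma> t)" if "t \<in> ?I" for t by (rule sd(3)) (use that in auto)
  have sM: "primitive_on ?I M (\<lambda>t. (p2 t * r t + p1 t * r1 t) + (p1 t * r1 t + p t * r2 t))"
    unfolding M_def[abs_def] by (rule sd(4); assumption)
  have sS: "primitive_on ?I \<sigma> (\<lambda>t. M t / (2 * \<sigma> t))"
    unfolding M_def[abs_def] by (rule sd(5); assumption)
  have siR: "primitive_on ?I (\<lambda>t. 1 / complex_of_real (r t)) (\<lambda>t. - of_real (r1 t) / (of_real (r t))\<^sup>2)"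
    by (rule sd(7); assumption)
  have evR: "\<forall>\<^sub>F t in at_right \<alpha>. t \<in> ?I" and evL: "\<forall>\<^sub>F t in at_left \<beta>. t \<in> ?I"
    using ab eventually_at_right_real eventually_at_left_real by blast+
  obtain sa sb where slim: "(\<sigma> \<longlongrightarrow> sa) (at_right \<alpha>)" "(\<sigma> \<longlongrightarrow> sb) (at_left \<beta>)"
    using primitive_on_limits[OF sS ab] by metis
  obtain Ma Mb where Mlim: "(M \<longlongrightarrow> Ma) (at_right \<alpha>)" "(M \<longlongrightarrow> Mb) (at_left \<beta>)"
    using primitive_on_limits[OF sM ab] by metis
  obtain ra rb where rlim: "(r \<longlongrightarrow> ra) (at_right \<alpha>)" "(r \<longlongrightarrow> rb) (at_left \<beta>)"
    using primitive_on_limits[OF ppr(2) ab] by metis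
  have D: "((\<lambda>t. vector_derivative (pr p r) (at t)) \<longlongrightarrow> Ma) (at_right \<alpha>)"
    "((\<lambda>t. vector_derivative (pr p r) (at t)) \<longlongrightarrow> Mb) (at_left \<beta>)"
    by (rule Lim_transform_eventually[OF Mlim(1) eventually_mono[OF evR]]
             Lim_transform_eventually[OF Mlim(2) eventually_mono[OF evL]]; simp add: vector_derivative_at[OF Mder])+
  have clow: "c \<le> cmod sa" "c \<le> cmod sb" "c \<le> ra" "c \<le> rb"
    by (rule tendsto_lowerbound[OF tendsto_norm[OF slim(1)] eventually_mono[OF evR slow]]
          tendsto_lowerbound[OF tendsto_norm[OF slim(2)] eventually_mono[OF evL slow]]
          tendsto_lowerbound[OF rlim(1) eventually_mono[OF evR c(3)]]
          tendsto_lowerbound[OF rlim(2) eventually_mono[OF evL c(3)]]; simp)+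
  have nz: "sa \<noteq> 0" "sb \<noteq> 0" "ra \<noteq> 0" "rb \<noteq> 0" using clow c(1) by auto
  have S: "sR = sa" "sL = sb" "tR = Ma / (2 * of_real ra * sa)" "tL = Mb / (2 * of_real rb * sb)"
    unfolding sR_def sL_def tR_def tL_def \<alpha>_def[symmetric] \<beta>_def[symmetric]
    by (simp_all add: tendsto_Lim[OF _ slim(1)] tendsto_Lim[OF _ slim(2)] tendsto_Lim[OF _ D(1)] tendsto_Lim[OF _ D(2)]
        tendsto_Lim[OF _ rlim(1)] tendsto_Lim[OF _ rlim(2)])
  show "sR \<noteq> 0" "sL \<noteq> 0" by (simp_all add: S nz)
  have "(pr p r \<longlongrightarrow> sa\<^sup>2) (at_right \<alpha>)" "(pr p r \<longlongrightarrow> sb\<^sup>2) (at_left \<beta>)"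
    by (rule Lim_transform_eventually[OF tendsto_power[OF slim(1)] eventually_mono[OF evR]]
             Lim_transform_eventually[OF tendsto_power[OF slim(2)] eventually_mono[OF evL]]; simp add: \<sigma>'(2) pr_def)+
  then show "Lim (at_right (x (j - 1))) (pr p r) = sR\<^sup>2" "Lim (at_left (x j)) (pr p r) = sL\<^sup>2"
    unfolding \<alpha>_def[symmetric] \<beta>_def[symmetric] by (simp_all add: S tendsto_Lim)
  have pnz: "p t \<noteq> 0" if "t \<in> ?I" for t using c(1) c(2)[OF that] by auto
  then show "\<And>t. t \<in> cell x j \<Longrightarrow> p t \<noteq> 0" by (simp add: I)
  have bip: "bounded ((\<lambda>t. 1 / p t) ` ?I)"
    by (rule bounded_imageI[of _ _ "1 / c"]) (use c(1,2) in \<open>auto simp: norm_divide intro!: frac_le\<close>)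
  then show "bounded ((\<lambda>t. 1 / p t) ` cell x j)" by (simp add: I)
  have bd: "bounded (p ` ?I)" "bounded (r ` ?I)" "bounded (p1 ` ?I)" "bounded (r1 ` ?I)" "bounded (p2 ` ?I)" "bounded (r2 ` ?I)"
    "bounded ((\<lambda>t. 1 / complex_of_real (r t)) ` ?I)"
    by (rule primitive_on_bounded_primitive[OF ppr(1) itv] primitive_on_bounded_primitive[OF ppr(2) itv]
        primitive_on_bounded[OF ppr(1)] primitive_on_bounded[OF ppr(2)] primitive_on_bounded[OF p(2)] primitive_on_bounded[OF rd(2)]
        primitive_on_bounded_primitive[OF siR itv])+
  have bR: "bounded ((\<lambda>t. complex_of_real (f t)) ` ?I)" if "bounded (f ` ?I)" for f
    using bounded_linear_image[OF that bounded_linear_of_real[where 'a = complex]] by (simp add: image_image)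
  have weq: "w t = p t * of_real (r t ^ 2)" if "t \<in> ?I" for t
    using r[of t] pnz[OF that] that unfolding I by (simp add: divide_eq_eq mult.commute)
  have "bounded ((\<lambda>t. p t * (of_real (r t) * of_real (r t))) ` ?I)"
    by (intro bounded_mult_image bd bR)
  moreover have "(\<lambda>t. p t * (of_real (r t) * of_real (r t))) ` ?I = w ` ?I"
    by (rule image_cong) (simp_all add: weq power2_eq_square)
  ultimately show "bounded (w ` cell x j)" by (simp add: I)
  define v0 where "v0 t = 1 / of_real (r t) ^ 2 * (q0 t / p t + 1/2 * (p2 t / p t) - 1/4 * (p1 t / p t) ^ 2
                        + 1/2 * (of_real (r2 t) / of_real (r t)) - 3/4 * (of_real (r1 t) / of_real (r t)) ^ 2)" for t
  have bv0: "bounded (v0 ` ?I)"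
  proof -
    have bc: "bounded ((\<lambda>t. k) ` ?I)" for k :: complex by (rule bounded_imageI[of _ _ "cmod k"]) simp
    let ?iR = "\<lambda>t. 1 / complex_of_real (r t)" and ?ip = "\<lambda>t. 1 / p t"
    have "bounded ((\<lambda>t. (?iR t * ?iR t) * (((q0 t * ?ip t + 1/2 * (p2 t * ?ip t)) - 1/4 * ((p1 t * ?ip t) * (p1 t * ?ip t)))
        + (1/2 * (of_real (r2 t) * ?iR t) - 3/4 * ((of_real (r1 t) * ?iR t) * (of_real (r1 t) * ?iR t))))) ` ?I)"
      by (intro bounded_mult_image bounded_plus_comp bounded_minus_comp bd bR bip q0(3)[unfolded I]
            bc)
    moreover have "(\<lambda>t. (?iR t * ?iR t) * (((q0 t * ?ip t + 1/2 * (p2 t * ?ip t)) - 1/4 * ((p1 t * ?ip t) * (p1 t * ?ip t)))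
        + (1/2 * (of_real (r2 t) * ?iR t) - 3/4 * ((of_real (r1 t) * ?iR t) * (of_real (r1 t) * ?iR t))))) = v0"
      by (rule ext) (simp add: v0_def power2_eq_square algebra_simps)
    ultimately show ?thesis by (simp only:)
  qed
  obtain C where C: "\<And>t. t \<in> ?I \<Longrightarrow> cmod (v0 t) \<le> C" using bounded_imageE[OF bv0] by blast
  let ?vf = "v_fun x p q r j"
  note wp = weak_deriv_primitive[OF ppr(1) p(2) ab] and wr = weak_deriv_primitive[OF ppr(2) rd(2) ab]
  obtain N1 N2 N3 N4 where N: "negligible N1" "negligible N2" "negligible N3" "negligible N4"
    "\<forall>t\<in>?I - N1. weak_deriv 1 ?I p t = p1 t" "\<forall>t\<in>?I - N2. weak_deriv 2 ?I p t = p2 t"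
    "\<forall>t\<in>?I - N3. weak_deriv 1 ?I r t = r1 t" "\<forall>t\<in>?I - N4. weak_deriv 2 ?I r t = r2 t"
    using wp(3,4) wr(3,4) by blast
  define N where "N = N0 \<union> N1 \<union> N2 \<union> N3 \<union> N4"
  have Nneg: "negligible N" unfolding N_def by (intro negligible_Un q0(1) N(1-4))
  have vf: "?vf t = v0 t" if "t \<in> ?I - N" for t
  proof -
    have "weak_deriv 1 ?I p t = p1 t" "weak_deriv 2 ?I p t = p2 t" "weak_deriv 1 ?I r t = r1 t" "weak_deriv 2 ?I r t = r2 t"
      "q t = q0 t"
      using that N(5-8) q0(2)[unfolded I, of t] by (auto simp: N_def)
    then show ?thesis by (simp add: v_fun_def Let_def I v0_def)
  qed
  have pm: "p \<in> borel_measurable (lebesgue_on ?I)" "r \<in> borel_measurable (lebesgue_on ?I)"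
    by (intro continuous_imp_measurable_on_sets_lebesgue primitive_on_continuous[OF ppr(1) itv(1)]
         primitive_on_continuous[OF ppr(2) itv(1)]; simp)+
  have vm: "?vf \<in> borel_measurable (lebesgue_on ?I)"
  proof -
    note [measurable] = pm q[unfolded I] Linf_measurable[OF wp(1)] Linf_measurable[OF wp(2)]
      Linf_measurable[OF wr(1)] Linf_measurable[OF wr(2)]
    show ?thesis unfolding v_fun_def[abs_def] Let_def I by measurable
  qed
  have vL: "?vf \<in> Linf ?I"
  proof -
    have "AE t in lebesgue_on ?I. ereal (cmod (?vf t)) \<le> ereal C"
      by (rule AE_lebesgue_onI[OF Nneg]) (use vf C in auto)
    then have "esssup (lebesgue_on ?I) (\<lambda>t. ereal (cmod (?vf t))) \<le> ereal C"
      using vm by (intro esssup_I) auto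
    then show ?thesis using vm by (auto simp: Linf_def)
  qed
  have VI: "V = Linf_norm ?I ?vf" by (simp add: V_def V_const_def I)
  show V0: "0 \<le> V"
    unfolding VI by (rule Linf_norm_nonneg[OF vL]) (use ab open_not_negligible[of ?I] in auto)
  obtain N5 where N5: "negligible N5" "\<And>t. t \<in> ?I - N5 \<Longrightarrow> cmod (?vf t) \<le> V"
    using AE_lebesgue_onE[OF Linf_AE_bound[OF vL] open_interval_lebesgue] VI by metis
  \<comment> \<open>\<open>v0\<close> is built from classical derivatives and agrees almost everywhere with \<open>v_fun\<close>; truncation makes the essential bound hold at every point.\<close>
  define v where "v t = (if cmod (v0 t) \<le> V then v0 t else 0)" for t
  have vb: "cmod (v t) \<le> V" for t using V0 by (simp add: v_def)
  have veq: "v t = v0 t" if "t \<in> ?I - (N \<union> N5)" for t using N5(2)[of t] vf[of t] that by (simp add: v_def)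
  have rc: "continuous_on ?I r" by (rule primitive_on_continuous[OF ppr(2) itv(1)])
  have rabs: "r absolutely_integrable_on ?I"
    by (intro bounded_measurable_absolutely_integrable bd pm lmeasurable_box_real)
  have lenI: "len = (LINT s|lebesgue_on ?I. r s)" by (simp add: len_def ell_tilde_j_def I)
  show "0 < len"
  proof -
    have "len = integral {\<alpha>..\<beta>} r"
      unfolding lenI by (subst lebesgue_integral_eq_integral[OF absolutely_integrable_imp_integrable[OF rabs]])
        (auto simp: integral_open_interval_real)
    moreover have "integral ?I (\<lambda>_. c) \<le> integral ?I r"
      by (rule integral_le) (use rabs c(3) in \<open>auto simp: absolutely_integrable_on_def integrable_on_open_interval_real\<close>)
    moreover have "integral ?I (\<lambda>_. c) = c * (\<beta> - \<alpha>)" using ab by (simp add: integral_open_interval_real[symmetric])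
    moreover have "0 < c * (\<beta> - \<alpha>)" using c(1) ab by simp
    ultimately show ?thesis unfolding integral_open_interval_real by linarith
  qed
  fix y u :: "real \<Rightarrow> complex" and \<kappa> ya ua yb ub :: complex
  assume y: "primitive_on (cell x j) y (\<lambda>t. u t / p t)"
    and u: "primitive_on (cell x j) u (\<lambda>t. (q0 t + \<kappa>\<^sup>2 * w t) * y t)" and \<kappa>: "Re \<kappa> > 0"
    and small: "V * len / cmod \<kappa> < 1"
    and lim: "(y \<longlongrightarrow> ya) (at_right (x (j - 1)))" "(u \<longlongrightarrow> ua) (at_right (x (j - 1)))"
      "(y \<longlongrightarrow> yb) (at_left (x j))" "(u \<longlongrightarrow> ub) (at_left (x j))"
  note lim' = lim[folded \<alpha>_def \<beta>_def]
  have \<kappa>0: "\<kappa> \<noteq> 0" using \<kappa> by auto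
  define \<tau> where "\<tau> t = (p1 t * r t + p t * r1 t) / (2 * r t * \<sigma> t)" for t
  define P where "P t = 1/2 * (\<sigma> t * y t + (u t / \<sigma> t + \<tau> t * y t) / \<kappa>)" for t
  define Q where "Q t = 1/2 * (\<sigma> t * y t - (u t / \<sigma> t + \<tau> t * y t) / \<kappa>)" for t
  have PQ: "primitive_on ?I P (\<lambda>x. r x * (\<kappa> * P x + v x / (2 * \<kappa>) * (P x + Q x)))"
     "primitive_on ?I Q (\<lambda>x. - (r x * (\<kappa> * Q x + v x / (2 * \<kappa>) * (P x + Q x))))"
    by (rule liouville_transformation(2,3)[OF c p rd ppr \<sigma>' weq y[unfolded I] u[unfolded I] \<kappa>0 negligible_Un[OF Nneg N5(1)]
          veq[unfolded v0_def] vb \<tau>_def P_def Q_def]; assumption)+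
  have \<tau>lim: "(\<tau> \<longlongrightarrow> tR) (at_right \<alpha>)" "(\<tau> \<longlongrightarrow> tL) (at_left \<beta>)"
    unfolding \<tau>_def[abs_def] S M_def[symmetric] using nz
    by (intro tendsto_intros Mlim rlim slim; simp)+
  have Plim: "(P \<longlongrightarrow> frame_plus sR tR \<kappa> ya ua) (at_right \<alpha>)" "(Q \<longlongrightarrow> frame_minus sR tR \<kappa> ya ua) (at_right \<alpha>)"
     "(P \<longlongrightarrow> frame_plus sL tL \<kappa> yb ub) (at_left \<beta>)" "(Q \<longlongrightarrow> frame_minus sL tL \<kappa> yb ub) (at_left \<beta>)"
    unfolding P_def[abs_def] Q_def[abs_def] frame_plus_def frame_minus_def S(1,2) using nz \<kappa>0
    by (intro tendsto_intros slim lim' \<tau>lim; simp)+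
  have r0: "0 \<le> r t" if "t \<in> ?I" for t using c(1) c(3)[OF that] by simp
  note est = dichotomy_open_cell[OF ab PQ r0 bd(2) rc vb \<kappa> _ small Plim lenI]
  show "cmod (exp (- \<kappa> * of_real len) * frame_plus sL tL \<kappa> yb ub - frame_plus sR tR \<kappa> ya ua)
        \<le> (V * len / cmod \<kappa>) / 2 / (1 - V * len / cmod \<kappa>) * (cmod (frame_plus sR tR \<kappa> ya ua) + cmod (frame_minus sR tR \<kappa> ya ua)) \<and>
      cmod (exp (- \<kappa> * of_real len) * frame_minus sL tL \<kappa> yb ub - exp (- 2 * \<kappa> * of_real len) * frame_minus sR tR \<kappa> ya ua)
        \<le> (V * len / cmod \<kappa>) / 2 / (1 - V * len / cmod \<kappa>) * (cmod (frame_plus sR tR \<kappa> ya ua) + cmod (frame_minus sR tR \<kappa> ya ua))"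
    by (intro conjI est) (auto simp: lenI)
qed

lemma piecewise_measurable:
  fixes F :: "real \<Rightarrow> complex"
  assumes "\<And>j. j \<in> {1..m} \<Longrightarrow> F \<in> borel_measurable (lebesgue_on (cell x j))"
    and "\<And>j. j \<in> {1..m} \<Longrightarrow> bounded (F ` cell x j)"
  shows "(\<lambda>t. \<Sum>j=1..m. indicator (cell x j) t *\<^sub>R F t) \<in> borel_measurable (lebesgue_on {a..b})"
    "bounded ((\<lambda>t. \<Sum>j=1..m. indicator (cell x j) t *\<^sub>R F t) ` S)"
proof -
  have "(\<lambda>t. indicator (cell x j) t *\<^sub>R F t) \<in> borel_measurable lebesgue" if "j \<in> {1..m}" for j
    using assms(1)[OF that] by (subst (asm) borel_measurable_restrict_space_iff) (auto simp: cell_def)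
  then show "(\<lambda>t. \<Sum>j=1..m. indicator (cell x j) t *\<^sub>R F t) \<in> borel_measurable (lebesgue_on {a..b})"
    by (intro borel_measurable_sum measurable_restrict_space1) auto
  obtain C where C: "\<And>j t. j \<in> {1..m} \<Longrightarrow> t \<in> cell x j \<Longrightarrow> cmod (F t) \<le> C j"
    using assms(2) by (auto simp: bounded_iff) metis
  have "cmod (\<Sum>j=1..m. indicator (cell x j) t *\<^sub>R F t) \<le> (\<Sum>j=1..m. \<bar>C j\<bar>)" for t
  proof (rule sum_norm_le)
    fix j assume j: "j \<in> {1..m}"
    show "cmod (indicator (cell x j) t *\<^sub>R F t) \<le> \<bar>C j\<bar>"
      using order_trans[OF C[OF j, of t] abs_ge_self] by (cases "t \<in> cell x j") auto
  qed
  then show "bounded ((\<lambda>t. \<Sum>j=1..m. indicator (cell x j) t *\<^sub>R F t) ` S)" by (rule bounded_imageI)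
qed

theorem proposition3p2:
  fixes a b :: real and m :: nat and x :: "nat \<Rightarrow> real"
    and p q w :: "real \<Rightarrow> complex" and r :: "real \<Rightarrow> real" and \<sigma> :: "real \<Rightarrow> complex"
    and \<phi> :: real and lam \<kappa> :: complex
  assumes m: "m \<ge> 1"
    and partition: "x 0 = a" "x m = b" "strict_mono_on {0..m} x"
    and pw_W2inf: "\<And>j. j \<in> {1..m} \<Longrightarrow> p \<in> W2inf (cell x j) \<and> w \<in> W2inf (cell x j)"
    and p_inf: "\<And>j. j \<in> {1..m} \<Longrightarrow> (INF t\<in>cell x j. cmod (p t)) > 0"
    and w_inf: "\<And>j. j \<in> {1..m} \<Longrightarrow> (INF t\<in>cell x j. cmod (w t)) > 0"
    and r: "\<And>j t. j \<in> {1..m} \<Longrightarrow> t \<in> cell x j \<Longrightarrow> r t > 0 \<and> w t / p t = of_real (r t ^ 2)"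
    and q: "q \<in> Linf {a..b}"
    and nonresonance: "\<And>j. j \<in> {1..m} \<Longrightarrow> lim_plus m x j (pr p r) + lim_minus x j (pr p r) \<noteq> 0"
    and sigma: "\<And>j. j \<in> {1..m} \<Longrightarrow> continuous_on (cell x j) \<sigma>"
      "\<And>j t. j \<in> {1..m} \<Longrightarrow> t \<in> cell x j \<Longrightarrow> \<sigma> t ^ 2 = pr p r t"
    \<comment> \<open>the bound divides by \<open>rho0\<close>\<close>
    and rho0_nonzero: "rho0 m x p q r \<noteq> 0"
    and eigenvalue: "is_eigenvalue a b p q w \<phi> lam"
    and lam: "lam = - (\<kappa> ^ 2)" "Re lam < 0" "Re \<kappa> > 0"
  shows "cmod \<kappa> \<le> sqrt 2 *
    Max {rho0 m x p q r,
         2 * rho0 m x p q r / cmod (Gamma_const m x \<sigma>) *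
           ((c_tilde m x \<sigma> + d_tilde m x p q r \<sigma> / rho0 m x p q r) ^ m - c_tilde m x \<sigma> ^ m),
         1 / ell_tilde m x r * ln (4 / cmod (Gamma_const m x \<sigma>))}"
proof -
  define \<rho> where "\<rho> = rho0 m x p q r"
  define len where "len j = ell_tilde_j x r j" for j
  define V where "V j = V_const x p q r j" for j
  define D where "D = (\<lambda>t. vector_derivative (pr p r) (at t))"
  \<comment> \<open>The frames at node \<open>n\<close>; by periodicity the right frame at node \<open>m\<close> is that at node 0, so start and end of the period are compared in the same coordinates.\<close>
  define sR where "sR n = lim_plus m x n \<sigma>" for n
  define sL where "sL n = lim_minus x n \<sigma>" for n
  define tR where "tR n = lim_plus m x n D / (2 * of_real (lim_plus m x n r) * sR n)" for n
  define tL where "tL n = lim_minus x n D / (2 * of_real (lim_minus x n r) * sL n)" for n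
  have xmono: "x i < x k" if "i < k" "k \<le> m" for i k
    using strict_mono_onD[OF partition(3), of i k] that by auto
  have xmono': "x i \<le> x k" if "i \<le> k" "k \<le> m" for i k
    using xmono[of i k] that by (cases "i = k") auto
  have ab: "a < b" using xmono[of 0 m] m partition(1,2) by auto
  have xin: "x n \<in> {a..b}" if "n \<le> m" for n
    using xmono'[of 0 n] xmono'[of n m] that partition(1,2) by auto
  have cell_sub: "cell x j \<subseteq> {a..b}" if "j \<in> {1..m}" for j
  proof -
    have "j - 1 \<le> m" "j \<le> m" using that by auto
    from this[THEN xin] show ?thesis by (auto simp: cell_def)
  qed
  have cell_cover: "\<exists>j\<in>{1..m}. t \<in> cell x j" if t: "t \<in> {a..b}" "t \<notin> x ` {0..m}" for t
  proof -
    define j where "j = (LEAST j. t < x j)"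
    have tm: "t < x m" using t partition(2) by (metis atLeastAtMost_iff image_eqI le0 less_le order_refl)
    have tj: "t < x j" unfolding j_def by (rule LeastI[of _ m]) (rule tm)
    have jm: "j \<le> m" unfolding j_def by (rule Least_le) (rule tm)
    have j0: "j \<noteq> 0" using tj t(1) partition(1) by (cases j) auto
    have "\<not> t < x (j - 1)" unfolding j_def by (rule not_less_Least) (use j0 in \<open>simp add: j_def\<close>)
    moreover have "t \<noteq> x (j - 1)" using t(2) jm by auto
    ultimately show ?thesis using tj jm j0 by (auto simp: cell_def intro!: bexI[of _ j])
  qed
  have cell_disj: "j = k" if "t \<in> cell x j" "t \<in> cell x k" "j \<in> {1..m}" "k \<in> {1..m}" for j k t
  proof (rule ccontr)
    assume "j \<noteq> k"
    then consider "j \<le> k - 1" | "k \<le> j - 1" using that by fastforce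
    then show False
    proof cases
      case 1
      have "k - 1 \<le> m" using that(4) by auto
      from xmono'[OF 1 this] show False using that(1,2) by (simp add: cell_def)
    next
      case 2
      have "j - 1 \<le> m" using that(3) by auto
      from xmono'[OF 2 this] show False using that(1,2) by (simp add: cell_def)
    qed
  qed
  obtain q0 N0 where q0: "negligible N0" "\<And>t. t \<in> {a..b} - N0 \<Longrightarrow> q t = q0 t"
    "q0 \<in> borel_measurable (lebesgue_on {a..b})" "\<And>t. norm (q0 t) \<le> \<bar>Linf_norm {a..b} q\<bar>"
    using Linf_bounded_representative[OF q, of thesis] by auto
  have qm: "q \<in> borel_measurable (lebesgue_on (cell x j))" "q0 \<in> borel_measurable (lebesgue_on (cell x j))" if "j \<in> {1..m}" for j
    using measurable_restrict_mono[OF Linf_measurable[OF q] cell_sub[OF that]]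
      measurable_restrict_mono[OF q0(3) cell_sub[OF that]] by auto
  have q0b: "bounded (q0 ` S)" for S by (rule bounded_imageI[OF q0(4)])
  have xj: "x (j - 1) < x j" if "j \<in> {1..m}" for j using xmono[of "j - 1" j] that by auto
  have q0c: "q t = q0 t" if "j \<in> {1..m}" "t \<in> cell x j - N0" for j t
    using q0(2)[of t] cell_sub[OF that(1)] that(2) by auto
  have lp: "lim_plus m x (j - 1) f = Lim (at_right (x (j - 1))) f" if "j \<in> {1..m}" for j and f :: "real \<Rightarrow> 'z::t2_space"
    using that by (auto simp: lim_plus_def)
  have cell: "sR (j - 1) \<noteq> 0" "sL j \<noteq> 0" "lim_plus m x (j - 1) (pr p r) = (sR (j - 1))\<^sup>2" "lim_minus x j (pr p r) = (sL j)\<^sup>2"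
    "0 \<le> V j" "0 < len j" "bounded ((\<lambda>t. 1 / p t) ` cell x j)" "bounded (w ` cell x j)" "\<And>t. t \<in> cell x j \<Longrightarrow> p t \<noteq> 0"
    if j: "j \<in> {1..m}" for j
    unfolding sR_def sL_def V_def len_def lp[OF j] lim_minus_def
  proof -
    note C = cell_transfer[OF xj[OF j] conjunct1[OF pw_W2inf[OF j]] conjunct2[OF pw_W2inf[OF j]] p_inf[OF j] w_inf[OF j]
        _ sigma(1)[OF j] _ qm(1)[OF j] q0(1) _ q0b]
    note prems = r[OF j] sigma(2)[OF j] q0c[OF j]
    show "Lim (at_right (x (j - 1))) \<sigma> \<noteq> 0" "Lim (at_left (x j)) \<sigma> \<noteq> 0"
      "Lim (at_right (x (j - 1))) (pr p r) = (Lim (at_right (x (j - 1))) \<sigma>)\<^sup>2" "Lim (at_left (x j)) (pr p r) = (Lim (at_left (x j)) \<sigma>)\<^sup>2"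
      "0 \<le> V_const x p q r j" "0 < ell_tilde_j x r j" "bounded ((\<lambda>t. 1 / p t) ` cell x j)" "bounded (w ` cell x j)"
      by (rule C(1) C(2) C(3) C(4) C(5) C(6) C(7) C(8); (rule prems; assumption))+
    show "p t \<noteq> 0" if "t \<in> cell x j" for t
      by (rule C(9)[OF _ _ _ that]; (rule prems; assumption))
  qed
  have est: "cmod (exp (- k * of_real (len j)) * frame_plus (sL j) (tL j) k yb ub - frame_plus (sR (j - 1)) (tR (j - 1)) k ya ua)
        \<le> (V j * len j / cmod k) / 2 / (1 - V j * len j / cmod k)
            * (cmod (frame_plus (sR (j - 1)) (tR (j - 1)) k ya ua) + cmod (frame_minus (sR (j - 1)) (tR (j - 1)) k ya ua)) \<and>
      cmod (exp (- k * of_real (len j)) * frame_minus (sL j) (tL j) k yb ub - exp (- 2 * k * of_real (len j)) * frame_minus (sR (j - 1)) (tR (j - 1)) k ya ua)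
        \<le> (V j * len j / cmod k) / 2 / (1 - V j * len j / cmod k)
            * (cmod (frame_plus (sR (j - 1)) (tR (j - 1)) k ya ua) + cmod (frame_minus (sR (j - 1)) (tR (j - 1)) k ya ua))"
    if j: "j \<in> {1..m}" and prems: "primitive_on (cell x j) y (\<lambda>t. u t / p t)"
        "primitive_on (cell x j) u (\<lambda>t. (q0 t + k\<^sup>2 * w t) * y t)" "Re k > 0" "V j * len j / cmod k < 1"
        "(y \<longlongrightarrow> ya) (at_right (x (j - 1)))" "(u \<longlongrightarrow> ua) (at_right (x (j - 1)))"
        "(y \<longlongrightarrow> yb) (at_left (x j))" "(u \<longlongrightarrow> ub) (at_left (x j))" for j y u k ya ua yb ub
    unfolding sR_def sL_def tR_def tL_def V_def len_def lp[OF j] lim_minus_def D_def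
    by (rule cell_transfer(10)[OF xj[OF j] conjunct1[OF pw_W2inf[OF j]] conjunct2[OF pw_W2inf[OF j]] p_inf[OF j] w_inf[OF j]
        _ sigma(1)[OF j] _ qm(1)[OF j] q0(1) _ q0b prems[unfolded V_def len_def]]; (rule r[OF j] sigma(2)[OF j] q0c[OF j]; assumption))
  have m1: "1 \<in> {1..m}" "m \<in> {1..m}" using m by auto
  have sR0: "sR m = sR 0" "tR m = tR 0" using m by (auto simp: sR_def tR_def lim_plus_def)
  have prR: "lim_plus m x m (pr p r) = lim_plus m x 0 (pr p r)" using m by (auto simp: lim_plus_def)
  have sRn: "sR n \<noteq> 0" if "n \<le> m" for n
  proof (cases "n = m")
    case True
    then show ?thesis using cell(1)[OF m1(1)] sR0 by simp
  next
    case False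
    then show ?thesis using cell(1)[of "Suc n"] that by simp
  qed
  have prRn: "lim_plus m x n (pr p r) = (sR n)\<^sup>2" if "n \<le> m" for n
  proof (cases "n = m")
    case True
    then show ?thesis using cell(3)[OF m1(1)] sR0 prR by simp
  next
    case False
    then show ?thesis using cell(3)[of "Suc n"] that by simp
  qed
  have alpha: "alpha m x \<sigma> j = sR j / sL j" for j by (simp add: alpha_def sR_def sL_def)
  have beta: "beta m x p r \<sigma> j = (tR j * sR j - tL j * sL j) / (sR j * sL j)" if j: "j \<in> {1..m}" for j
  proof -
    have "tR j * sR j = 1/2 * (lim_plus m x j D / of_real (lim_plus m x j r))"
      "tL j * sL j = 1/2 * (lim_minus x j D / of_real (lim_minus x j r))"
      using sRn[of j] cell(2)[OF j] j by (simp_all add: tR_def tL_def)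
    then show ?thesis by (simp add: beta_def sR_def[symmetric] sL_def[symmetric] D_def[symmetric] diff_divide_distrib mult_ac)
  qed
  have Vlen: "len j * V j \<le> \<rho> / 2" if "j \<in> {1..m}" for j
    unfolding \<rho>_def rho0_def len_def V_def using that by simp
  have \<rho>0: "0 < \<rho>"
  proof -
    have "0 \<le> len 1 * V 1" using cell(5,6)[OF m1(1)] by simp
    then have "0 \<le> \<rho>" using Vlen[OF m1(1)] by linarith
    then show ?thesis using rho0_nonzero by (simp add: \<rho>_def less_le)
  qed
  define c where "c = c_tilde m x \<sigma>"
  define d where "d = d_tilde m x p q r \<sigma>"
  have cj: "max (cmod (alpha m x \<sigma> j)) (inverse (cmod (alpha m x \<sigma> j))) \<le> c" if "j \<in> {1..m}" for j
    unfolding c_def c_tilde_def by (rule Max_ge) (use that in auto)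
  have dj: "cmod (beta m x p r \<sigma> j) + 2 * max (max (cmod (alpha m x \<sigma> j)) (inverse (cmod (alpha m x \<sigma> j)))) (cmod (beta m x p r \<sigma> j) / \<rho>)
      * (4 * len j * V j + 1 / (sqrt 2 * exp 1 * len j)) \<le> d" if "j \<in> {1..m}" for j
    unfolding d_def d_tilde_def \<rho>_def len_def V_def by (rule Max_ge) (use that in auto)
  have "cmod (alpha m x \<sigma> 1) \<le> c" using cj[OF m1(1)] by simp
  then have c0: "0 \<le> c" by (rule order_trans[OF norm_ge_zero])
  have d0: "0 \<le> d"
  proof (rule order_trans[OF _ dj[OF m1(1)]])
    show "0 \<le> cmod (beta m x p r \<sigma> 1) + 2 * max (max (cmod (alpha m x \<sigma> 1)) (inverse (cmod (alpha m x \<sigma> 1)))) (cmod (beta m x p r \<sigma> 1) / \<rho>)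
      * (4 * len 1 * V 1 + 1 / (sqrt 2 * exp 1 * len 1))"
      using cell(5,6)[OF m1(1)] by (intro add_nonneg_nonneg mult_nonneg_nonneg) (auto simp: le_max_iff_disj)
  qed
  define g where "g n = 1/2 * (alpha m x \<sigma> (Suc n) + inverse (alpha m x \<sigma> (Suc n)))" for n
  define h where "h n = 1/2 * (alpha m x \<sigma> (Suc n) - inverse (alpha m x \<sigma> (Suc n)))" for n
  have gh: "cmod (g n) \<le> c" "cmod (h n) \<le> c" if "n < m" for n
  proof -
    let ?a = "alpha m x \<sigma> (Suc n)"
    have "cmod ?a \<le> c" "cmod (inverse ?a) \<le> c" using cj[of "Suc n"] that by (auto simp: norm_inverse)
    then have "cmod (?a + inverse ?a) \<le> c + c" "cmod (?a - inverse ?a) \<le> c + c"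
      using norm_triangle_ineq[of ?a "inverse ?a"] norm_triangle_ineq4[of ?a "inverse ?a"] by linarith+
    then show "cmod (g n) \<le> c" "cmod (h n) \<le> c" unfolding g_def h_def norm_mult by simp_all
  qed
  define \<Gamma> where "\<Gamma> = Gamma_const m x \<sigma>"
  have \<Gamma>: "\<Gamma> = (\<Prod>n<m. g n)"
    unfolding \<Gamma>_def Gamma_const_def g_def One_nat_def by (rule prod.atLeast1_atMost_eq)
  have \<Gamma>0: "\<Gamma> \<noteq> 0"
  proof -
    have "g n \<noteq> 0" if n: "n < m" for n
    proof -
      have j: "Suc n \<in> {1..m}" using n by simp
      have nz: "sR (Suc n) \<noteq> 0" "sL (Suc n) \<noteq> 0" using sRn[of "Suc n"] cell(2)[OF j] n by auto
      have "(sR (Suc n))\<^sup>2 + (sL (Suc n))\<^sup>2 \<noteq> 0"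
        using nonresonance[OF j] prRn[of "Suc n"] cell(4)[OF j] n by simp
      moreover have "g n = ((sR (Suc n))\<^sup>2 + (sL (Suc n))\<^sup>2) / (2 * sR (Suc n) * sL (Suc n))"
        using nz by (simp add: g_def alpha field_simps power2_eq_square)
      ultimately show ?thesis using nz by simp
    qed
    then show ?thesis unfolding \<Gamma> by simp
  qed
  have \<kappa>0: "\<kappa> \<noteq> 0" using lam(3) by auto
  have \<kappa>Re: "cmod \<kappa> \<le> sqrt 2 * Re \<kappa>"
  proof -
    have "(Im \<kappa>)\<^sup>2 < (Re \<kappa>)\<^sup>2" using lam(1,2) by (simp add: power2_eq_square)
    then have "(cmod \<kappa>)\<^sup>2 \<le> (sqrt 2 * Re \<kappa>)\<^sup>2" by (simp add: cmod_power2 power_mult_distrib)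
    then show ?thesis by (rule power2_le_imp_le) (use lam(3) in simp)
  qed
  \<comment> \<open>At a node all indicators vanish, which gives a default value on a null set.\<close>
  define A where "A t = (\<Sum>j=1..m. indicator (cell x j) t *\<^sub>R (1 / p t))" for t
  define B where "B t = (\<Sum>j=1..m. indicator (cell x j) t *\<^sub>R (q0 t + \<kappa>\<^sup>2 * w t))" for t
  have pick: "(\<Sum>j=1..m. indicator (cell x j) t *\<^sub>R F t) = F t" if "j \<in> {1..m}" "t \<in> cell x j" for j t and F :: "real \<Rightarrow> complex"
  proof -
    have "(\<Sum>k=1..m. indicator (cell x k) t *\<^sub>R F t) = (\<Sum>k=1..m. if k = j then F t else 0)"
    proof (rule sum.cong[OF refl])
      fix k assume k: "k \<in> {1..m}"
      have "t \<notin> cell x k" if "k \<noteq> j" using cell_disj[OF _ \<open>t \<in> cell x j\<close> k \<open>j \<in> {1..m}\<close>] that by blast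
      then show "indicator (cell x k) t *\<^sub>R F t = (if k = j then F t else 0)"
        using that(2) by simp
    qed
    then show ?thesis using that(1) by simp
  qed
  have Aj: "A t = 1 / p t" and Bj: "B t = q0 t + \<kappa>\<^sup>2 * w t" if "j \<in> {1..m}" "t \<in> cell x j" for j t
    unfolding A_def B_def by (rule pick[OF that, of "\<lambda>t. 1 / p t"] pick[OF that, of "\<lambda>t. q0 t + \<kappa>\<^sup>2 * w t"])+
  have pwm: "p \<in> borel_measurable (lebesgue_on (cell x j))" "w \<in> borel_measurable (lebesgue_on (cell x j))" if "j \<in> {1..m}" for j
  proof -
    have "p \<in> Linf (cell x j)" "w \<in> Linf (cell x j)" using pw_W2inf[OF that] by (simp_all add: W2inf_def)
    from this[THEN Linf_measurable] show "p \<in> borel_measurable (lebesgue_on (cell x j))" "w \<in> borel_measurable (lebesgue_on (cell x j))" .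
  qed
  have Am: "A \<in> borel_measurable (lebesgue_on {a..b})" "bounded (A ` S)" for S
    unfolding A_def[abs_def] by (rule piecewise_measurable; use pwm(1) cell(7) in \<open>auto intro: borel_measurable_divide\<close>)+
  have wqb: "bounded ((\<lambda>t. q0 t + \<kappa>\<^sup>2 * w t) ` cell x j)" if "j \<in> {1..m}" for j
    by (intro bounded_plus_comp q0b bounded_mult_image[of "\<lambda>_. \<kappa>\<^sup>2"] cell(8)[OF that] bounded_imageI[of _ "\<lambda>_. \<kappa>\<^sup>2" "cmod (\<kappa>\<^sup>2)"]) simp
  have Bm: "B \<in> borel_measurable (lebesgue_on {a..b})" "bounded (B ` S)" for S
    unfolding B_def[abs_def] by (rule piecewise_measurable; use pwm(2) qm(2) wqb in \<open>auto\<close>)+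
  \<comment> \<open>The states are divided by the expected growth up to the node.\<close>
  define E where "E n = exp (- \<kappa> * of_real (\<Sum>j=1..n. len j))" for n
  have E_Suc: "E (Suc n) = E n * exp (- \<kappa> * of_real (len (Suc n)))" for n
    unfolding E_def exp_add[symmetric] by (simp add: algebra_simps)
  define L where "L = ell_tilde m x r"
  have L: "L = (\<Sum>j=1..m. len j)" by (simp add: L_def ell_tilde_def len_def)
  have L0: "0 < L" unfolding L by (rule sum_pos) (use cell(6) m in auto)
  have EL: "cmod (E m) = exp (- (Re \<kappa> * L))" by (simp add: E_def L)
  define f where "f = d / (sqrt 2 * cmod \<kappa>)"
  define \<eta> where "\<eta> = (c + f) ^ m - c ^ m"
  have f0: "0 \<le> f" using d0 by (simp add: f_def)
  define FP where "FP = frame_plus (sR 0) (tR 0) \<kappa>"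
  define FM where "FM = frame_minus (sR 0) (tR 0) \<kappa>"
  \<comment> \<open>For initial frame coordinates \<open>(1, 0)\<close> and \<open>(0, 1)\<close> these are the two diagonal entries of the monodromy matrix.\<close>
  have estimate: "cmod (E m * FP (y b) (u b) - \<Gamma> * FP (y a) (u a)) \<le> \<eta> * M"
    "FP (y a) (u a) = 0 \<Longrightarrow> cmod (E m * FM (y b) (u b)) \<le> \<eta> * M"
    if big: "sqrt 2 * \<rho> \<le> cmod \<kappa>"
      and y: "primitive_on {a..b} y (\<lambda>t. A t * u t)" and u: "primitive_on {a..b} u (\<lambda>t. B t * y t)"
      and M: "cmod (FP (y a) (u a)) \<le> M" "cmod (FM (y a) (u a)) \<le> M" for y u M
  proof -
    define ZP where "ZP n = frame_plus (sR n) (tR n) \<kappa> (y (x n)) (u (x n))" for n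
    define ZM where "ZM n = frame_minus (sR n) (tR n) \<kappa> (y (x n)) (u (x n))" for n
    have cont: "continuous_on {a..b} y" "continuous_on {a..b} u"
      by (rule primitive_on_continuous[OF y] primitive_on_continuous[OF u], simp add: is_interval_cc)+
    have step: "cmod (exp (- \<kappa> * of_real (len (Suc n))) * ZP (Suc n) - g n * ZP n) \<le> f * max (cmod (ZP n)) (cmod (ZM n)) \<and>
       cmod (exp (- \<kappa> * of_real (len (Suc n))) * ZM (Suc n) - h n * ZP n) \<le> f * max (cmod (ZP n)) (cmod (ZM n))" if n: "n < m" for n
    proof -
      define j where "j = Suc n"
      have j: "j \<in> {1..m}" "j - 1 = n" "j \<le> m" using n by (auto simp: j_def)
      have cy: "primitive_on (cell x j) y (\<lambda>t. u t / p t)"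
        by (rule primitive_on_cong[OF primitive_on_subset[OF y cell_sub[OF j(1)]]]) (simp_all add: Aj[OF j(1)])
      have cu: "primitive_on (cell x j) u (\<lambda>t. (q0 t + \<kappa>\<^sup>2 * w t) * y t)"
        by (rule primitive_on_cong[OF primitive_on_subset[OF u cell_sub[OF j(1)]]]) (simp_all add: Bj[OF j(1)])
      have sub: "{x n..x j} \<subseteq> {a..b}" using xin[of n] xin[OF j(3)] n by auto
      have lt: "x n < x j" using xj[OF j(1)] j(2) by simp
      have lims: "(y \<longlongrightarrow> y (x n)) (at_right (x n))" "(u \<longlongrightarrow> u (x n)) (at_right (x n))"
        "(y \<longlongrightarrow> y (x j)) (at_left (x j))" "(u \<longlongrightarrow> u (x j)) (at_left (x j))"
        using continuous_on_Icc_at_rightD[OF continuous_on_subset[OF cont(1) sub] lt]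
          continuous_on_Icc_at_rightD[OF continuous_on_subset[OF cont(2) sub] lt]
          continuous_on_Icc_at_leftD[OF continuous_on_subset[OF cont(1) sub] lt]
          continuous_on_Icc_at_leftD[OF continuous_on_subset[OF cont(2) sub] lt] by auto
      have small: "V j * len j / cmod \<kappa> < 1"
      proof -
        have "1 * \<rho> \<le> sqrt 2 * \<rho>" using \<rho>0 by (intro mult_right_mono) auto
        moreover have "V j * len j \<le> \<rho> / 2" using Vlen[OF j(1)] by (simp add: mult.commute)
        ultimately have "V j * len j < cmod \<kappa>" using big \<rho>0 by linarith
        then show ?thesis using \<kappa>0 by simp
      qed
      note e = est[OF j(1) cy cu lam(3) small, unfolded j(2), OF lims]
      note jump = frame_jump[OF cell(2)[OF j(1)] sRn[OF j(3)] \<kappa>0 alpha[of j] beta[OF j(1)], of "y (x j)" "u (x j)"]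
      have "cmod (exp (- \<kappa> * of_real (len j)) * ZP j - g n * ZP n) \<le> d / (sqrt 2 * cmod \<kappa>) * max (cmod (ZP n)) (cmod (ZM n))"
        "cmod (exp (- \<kappa> * of_real (len j)) * ZM j - h n * ZP n) \<le> d / (sqrt 2 * cmod \<kappa>) * max (cmod (ZP n)) (cmod (ZM n))"
        using transfer_step[OF \<kappa>Re big \<rho>0 cell(6)[OF j(1)] cell(5)[OF j(1)] Vlen[OF j(1)] refl conjunct1[OF e] conjunct2[OF e]
            refl refl refl jump dj[OF j(1)]]
        by (simp_all add: ZP_def ZM_def g_def h_def j_def)
      then show ?thesis by (simp add: f_def j_def)
    qed
    define X where "X n = E n * ZP n" for n
    define Y where "Y n = E n * ZM n" for n
    have scaled: "cmod (E (Suc n) * Z' - k * (E n * Z)) \<le> f * max (cmod (X n)) (cmod (Y n))"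
      if "cmod (exp (- \<kappa> * of_real (len (Suc n))) * Z' - k * Z) \<le> f * max (cmod (ZP n)) (cmod (ZM n))" for n k Z Z'
    proof -
      have "E (Suc n) * Z' - k * (E n * Z) = E n * (exp (- \<kappa> * of_real (len (Suc n))) * Z' - k * Z)"
        unfolding E_Suc by (simp add: algebra_simps)
      also have "cmod \<dots> \<le> cmod (E n) * (f * max (cmod (ZP n)) (cmod (ZM n)))"
        unfolding norm_mult by (rule mult_left_mono[OF that]) simp
      also have "\<dots> = f * max (cmod (X n)) (cmod (Y n))"
      proof -
        have "max (cmod (X n)) (cmod (Y n)) = cmod (E n) * max (cmod (ZP n)) (cmod (ZM n))"
          by (simp add: X_def Y_def norm_mult max_mult_distrib_left)
        then show ?thesis by simp
      qed
      finally show ?thesis .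
    qed
    have X0: "X 0 = FP (y a) (u a)" "Y 0 = FM (y a) (u a)"
      by (simp_all add: X_def Y_def E_def ZP_def ZM_def FP_def FM_def partition(1))
    have Xm: "X m = E m * FP (y b) (u b)" "Y m = E m * FM (y b) (u b)"
      by (simp_all add: X_def Y_def ZP_def ZM_def FP_def FM_def partition(2) sR0)
    have rX: "cmod (X (Suc n) - g n * X n) \<le> f * max (cmod (X n)) (cmod (Y n))"
      and rY: "cmod (Y (Suc n) - h n * X n) \<le> f * max (cmod (X n)) (cmod (Y n))" if "n < m" for n
      using scaled[OF conjunct1[OF step[OF that]]] scaled[OF conjunct2[OF step[OF that]]] by (simp_all add: X_def Y_def)
    show "cmod (E m * FP (y b) (u b) - \<Gamma> * FP (y a) (u a)) \<le> \<eta> * M"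
      using perturbed_triangular_recursion(1)[of c f m g h X Y M, OF c0 f0 gh rX rY] M unfolding X0 Xm \<Gamma> \<eta>_def by simp
    show "cmod (E m * FM (y b) (u b)) \<le> \<eta> * M" if "FP (y a) (u a) = 0"
      using perturbed_triangular_recursion(2)[of c f m g h X Y M, OF c0 f0 gh rX rY] M m that unfolding X0 Xm \<eta>_def by simp
  qed
  obtain y u where sol: "is_solution a b p q w lam y u" and nontriv: "\<exists>t\<in>{a..b}. y t \<noteq> 0"
    and bc: "y b = exp (\<i> * of_real \<phi>) * y a" "u b = exp (\<i> * of_real \<phi>) * u a"
    using eigenvalue unfolding is_eigenvalue_def by blast
  have y: "primitive_on {a..b} y (\<lambda>t. A t * u t)" and u: "primitive_on {a..b} u (\<lambda>t. B t * y t)"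
  proof -
    have ac: "abs_continuous_on a b y" "abs_continuous_on a b u" using sol by (auto simp: is_solution_def)
    have "AE t in lebesgue_on {a..b}. \<exists>y' u'. (y has_vector_derivative y') (at t) \<and> u t = p t * y' \<and>
        (u has_vector_derivative u') (at t) \<and> - u' + q t * y t = lam * w t * y t"
      using sol by (simp add: is_solution_def)
    then obtain N1 where N1: "negligible N1" "\<And>t. t \<in> {a..b} - N1 \<Longrightarrow> \<exists>y' u'. (y has_vector_derivative y') (at t) \<and> u t = p t * y' \<and>
        (u has_vector_derivative u') (at t) \<and> - u' + q t * y t = lam * w t * y t"
      by (rule AE_lebesgue_onE) auto
    define N where "N = N0 \<union> N1 \<union> x ` {0..m}"
    have N: "negligible N" unfolding N_def by (intro negligible_Un q0(1) N1(1) negligible_finite) simp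
    have der: "(y has_vector_derivative A t * u t) (at t)" "(u has_vector_derivative B t * y t) (at t)" if t: "t \<in> {a..b} - N" for t
    proof -
      obtain j where j: "j \<in> {1..m}" "t \<in> cell x j" using cell_cover[of t] t by (auto simp: N_def)
      obtain y' u' where yu: "(y has_vector_derivative y') (at t)" "u t = p t * y'"
        "(u has_vector_derivative u') (at t)" "- u' + q t * y t = lam * w t * y t"
        using N1(2)[of t] t by (auto simp: N_def)
      have "y' = A t * u t" using yu(2) cell(9)[OF j] by (simp add: Aj[OF j])
      then show "(y has_vector_derivative A t * u t) (at t)" using yu(1) by simp
      have "q t = q0 t" using q0(2)[of t] t by (auto simp: N_def)
      then have "u' = B t * y t" using yu(4) by (simp add: Bj[OF j] lam(1) algebra_simps add_eq_0_iff eq_neg_iff_add_eq_0)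
      then show "(u has_vector_derivative B t * y t) (at t)" using yu(3) by simp
    qed
    have bd: "bounded ((\<lambda>t. C t * k t) ` {a..b})" if "bounded (C ` {a..b})" "abs_continuous_on a b k" for C k :: "real \<Rightarrow> complex"
      by (intro bounded_mult_image that compact_imp_bounded compact_continuous_image abs_continuous_imp_continuous_on) auto
    have hi: "((\<lambda>t. A t * u t) has_integral y t - y s) {s..t}" "((\<lambda>t. B t * y t) has_integral u t - u s) {s..t}"
      if "s \<le> t" "{s..t} \<subseteq> {a..b}" for s t
      by (rule abs_continuous_has_integral[OF ac(1) N der(1)] abs_continuous_has_integral[OF ac(2) N der(2)]; use that in auto)+
    show "primitive_on {a..b} y (\<lambda>t. A t * u t)" "primitive_on {a..b} u (\<lambda>t. B t * y t)"
      unfolding primitive_on_def by (intro conjI allI impI hi bd Am(2) Bm(2) ac; assumption)+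
  qed
  have s0: "sR 0 \<noteq> 0" by (rule sRn) simp
  define inity where "inity P Q = (P + Q) / sR 0" for P Q :: complex
  define initu where "initu P Q = sR 0 * (\<kappa> * (P - Q) - tR 0 * ((P + Q) / sR 0))" for P Q :: complex
  have init: "FP (inity P Q) (initu P Q) = P" "FM (inity P Q) (initu P Q) = Q" for P Q
    unfolding FP_def FM_def inity_def initu_def by (rule frame_surjective[OF s0 \<kappa>0])+
  obtain y1 u1 where 1: "y1 a = inity 1 0" "u1 a = initu 1 0"
    "primitive_on {a..b} y1 (\<lambda>t. A t * u1 t)" "primitive_on {a..b} u1 (\<lambda>t. B t * y1 t)"
    using linear_system_solution_exists[OF less_imp_le[OF ab] Am Bm] by metis
  obtain y2 u2 where 2: "y2 a = inity 0 1" "u2 a = initu 0 1"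
    "primitive_on {a..b} y2 (\<lambda>t. A t * u2 t)" "primitive_on {a..b} u2 (\<lambda>t. B t * y2 t)"
    using linear_system_solution_exists[OF less_imp_le[OF ab] Am Bm] by metis
  have F12: "FP (y1 a) (u1 a) = 1" "FM (y1 a) (u1 a) = 0" "FP (y2 a) (u2 a) = 0" "FM (y2 a) (u2 a) = 1"
    by (simp_all add: 1 2 init)
  have wr: "FP v z * FM v' z' - FP v' z' * FM v z = (z * v' - v * z') / (2 * \<kappa>)" for v z v' z'
    unfolding FP_def FM_def by (rule frame_wronskian[OF s0 \<kappa>0])
  have Wa: "u1 a * y2 a - y1 a * u2 a = 2 * \<kappa>"
    using wr[of "y1 a" "u1 a" "y2 a" "u2 a"] \<kappa>0 by (simp add: F12)
  have Wb: "u1 b * y2 b - y1 b * u2 b = 2 * \<kappa>"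
  proof -
    have "y1 a * u2 a - u1 a * y2 a = y1 b * u2 b - u1 b * y2 b"
      by (rule wronskian_constant[OF 1(3,4) 2(3,4)]) (use ab in \<open>auto simp: is_interval_cc\<close>)
    then show ?thesis using Wa by (simp add: algebra_simps)
  qed
  define P0 where "P0 = FP (y a) (u a)"
  define Q0 where "Q0 = FM (y a) (u a)"
  have Flin: "FP (c * v + d * v') (c * z + d * z') = c * FP v z + d * FP v' z'"
    "FM (c * v + d * v') (c * z + d * z') = c * FM v z + d * FM v' z'" for c d v v' z z'
    unfolding FP_def FM_def by (rule frame_linear)+
  have Finj: "v = v'" "z = z'" if "FP v z = FP v' z'" "FM v z = FM v' z'" for v z v' z'
  proof -
    have "v = (FP v z + FM v z) / sR 0" "v' = (FP v' z' + FM v' z') / sR 0"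
      unfolding FP_def FM_def by (rule frame_inverse(1)[OF s0 \<kappa>0])+
    then show vv: "v = v'" using that by simp
    have "z = sR 0 * (\<kappa> * (FP v z - FM v z) - tR 0 * v)" "z' = sR 0 * (\<kappa> * (FP v' z' - FM v' z') - tR 0 * v')"
      unfolding FP_def FM_def by (rule frame_inverse(2)[OF s0 \<kappa>0])+
    then show "z = z'" using that vv by simp
  qed
  have ya: "y a = P0 * y1 a + Q0 * y2 a" "u a = P0 * u1 a + Q0 * u2 a"
  proof -
    have "FP (y a) (u a) = FP (P0 * y1 a + Q0 * y2 a) (P0 * u1 a + Q0 * u2 a)"
      "FM (y a) (u a) = FM (P0 * y1 a + Q0 * y2 a) (P0 * u1 a + Q0 * u2 a)"
      unfolding Flin F12 by (simp_all add: P0_def Q0_def)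
    then show "y a = P0 * y1 a + Q0 * y2 a" "u a = P0 * u1 a + Q0 * u2 a" by (rule Finj)+
  qed
  have comb: "y t = P0 * y1 t + Q0 * y2 t" "u t = P0 * u1 t + Q0 * u2 t" if "t \<in> {a..b}" for t
    by (rule system_solution_unique[OF y u 1(3,4) 2(3,4) _ ya that]; use Wa \<kappa>0 in simp)+
  have PQ0: "P0 \<noteq> 0 \<or> Q0 \<noteq> 0" using nontriv comb(1) by auto
  have bin: "b \<in> {a..b}" using ab by simp
  let ?\<mu> = "exp (\<i> * of_real \<phi>)"
  have \<mu>lin: "FP (?\<mu> * v) (?\<mu> * z) = ?\<mu> * FP v z" "FM (?\<mu> * v) (?\<mu> * z) = ?\<mu> * FM v z" for v z
    using Flin(1)[of ?\<mu> v 0 0 z 0] Flin(2)[of ?\<mu> v 0 0 z 0] by simp_all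
  have tr: "cmod (FP (y1 b) (u1 b) + FM (y2 b) (u2 b)) \<le> 2"
  proof (rule trace_of_unimodular_eigenvalue[OF _ _ PQ0, where \<mu> = ?\<mu>])
    have "FP (y b) (u b) = ?\<mu> * P0" "FM (y b) (u b) = ?\<mu> * Q0" unfolding bc \<mu>lin P0_def Q0_def by simp_all
    then show "FP (y1 b) (u1 b) * P0 + FP (y2 b) (u2 b) * Q0 = ?\<mu> * P0" "FM (y1 b) (u1 b) * P0 + FM (y2 b) (u2 b) * Q0 = ?\<mu> * Q0"
      unfolding comb[OF bin] Flin by (simp_all add: mult.commute)
    show "FP (y1 b) (u1 b) * FM (y2 b) (u2 b) - FP (y2 b) (u2 b) * FM (y1 b) (u1 b) = 1"
      unfolding wr Wb using \<kappa>0 by simp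
    show "cmod ?\<mu> = 1" by simp
  qed
  have "cmod \<kappa> \<le> sqrt 2 * Max {\<rho>, 2 * \<rho> / cmod \<Gamma> * ((c + d / \<rho>) ^ m - c ^ m), 1 / L * ln (4 / cmod \<Gamma>)}"
  proof (rule final_numeric_bound[OF _ \<rho>0 c0 d0 \<kappa>Re L0])
    show "0 < cmod \<Gamma>" using \<Gamma>0 by simp
    assume big: "sqrt 2 * \<rho> \<le> cmod \<kappa>"
    have t1: "cmod (E m * FP (y1 b) (u1 b) - \<Gamma>) \<le> \<eta>"
      using estimate(1)[OF big 1(3,4), of 1] by (simp add: F12)
    have t2: "cmod (E m * FM (y2 b) (u2 b)) \<le> \<eta>"
      using estimate(2)[OF big 2(3,4), of 1] by (simp add: F12)
    have t3: "cmod (E m * (FP (y1 b) (u1 b) + FM (y2 b) (u2 b))) \<le> exp (- (Re \<kappa> * L)) * 2"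
      unfolding norm_mult EL by (rule mult_left_mono[OF tr]) simp
    define R where "R = E m * (FP (y1 b) (u1 b) + FM (y2 b) (u2 b))"
    define S where "S = E m * FP (y1 b) (u1 b) - \<Gamma>"
    define T where "T = E m * FM (y2 b) (u2 b)"
    have "\<Gamma> = (R - S) - T" by (simp add: R_def S_def T_def algebra_simps)
    then have "cmod \<Gamma> \<le> cmod R + cmod S + cmod T"
      using norm_triangle_ineq4[of "R - S" T] norm_triangle_ineq4[of R S] by simp
    then have "cmod \<Gamma> \<le> 2 * \<eta> + 2 * exp (- (Re \<kappa> * L))"
      using t1 t2 t3 unfolding R_def S_def T_def by linarith
    then show "cmod \<Gamma> \<le> 2 * ((c + d / (sqrt 2 * cmod \<kappa>)) ^ m - c ^ m) + 2 * exp (- (Re \<kappa> * L))"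
      unfolding \<eta>_def f_def .
  qed
  then show ?thesis
    unfolding \<rho>_def c_def d_def \<Gamma>_def L_def .
qed

end
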